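(* Let $d>2$, $\beta>0$ and $\rho>\rho_c(\beta)$, and let $\nu_\rho$ be the boson random point field on $\mathbb{R}^d$ with particle density $\rho$. Let $f\ge 0$ be a bounded measurable function with compact support in $\mathbb{R}^d$. Then, as $\kappa\to\infty$, $$\frac{1}{\kappa^d}\big\langle f(\cdot/\kappa),\xi\big\rangle \longrightarrow \rho\int_{\mathbb{R}^d} f(x)\,dx \qquad\text{in } L^2(Q(\mathbb{R}^d),\nu_\rho).$$
   Context: $Q(\mathbb{R}^d)$ is the Polish space of locally finite non-negative integer-valued Borel measures (point measures) on $\mathbb{R}^d$; for $\xi=\sum_j\delta_{x_j}\in Q(\mathbb{R}^d)$, $\langle f,\xi\rangle=\sum_j f(x_j)$. $\Delta$ is the self-adjoint Laplacian in $L^2(\mathbb{R}^d)$, $G=e^{\beta\Delta}$, and the critical density is $\rho_c=\rho_c(\beta)=\int_{\mathbb{R}^d}\frac{1}{e^{\beta|p|^2}-1}\frac{dp}{(2\pi)^d}$ (finite since $d>2$). For a non-negative bounded measurable compactly supported $f$, put $W_f=(G(1-G)^{-1})^{1/2}\sqrt{1-e^{-f}}$ (a bounded operator on $L^2(\mathbb{R}^d)$, functions acting by multiplication) and $K_f=W_f^*W_f$ (a trace-class operator). For $\rho>\rho_c$, $\nu_\rho$ is the Borel probability measure on $Q(\mathbb{R}^d)$ characterized by $$\int_{Q(\mathbb{R}^d)}e^{-\langle f,\xi\rangle}\,\nu_\rho(d\xi)=\frac{\exp\big(-(\rho-\rho_c)\langle\sqrt{1-e^{-f}},(1+K_f)^{-1}\sqrt{1-e^{-f}}\rangle\big)}{\mathrm{Det}[1+K_f]}$$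 for all non-negative bounded measurable $f$ with compact support, where $\mathrm{Det}$ is the Fredholm determinant and $\langle\cdot,\cdot\rangle$ on the right is the $L^2(\mathbb{R}^d)$ inner product. The existence of $\nu_\rho$ is known and may be assumed. *)

theory Defs
  imports "HOL-Probability.Probability"
begin

text \<open>
  Elements of an $L^2$ space are represented by functions rather than by classes of functions.
  Every operator below that is introduced by a choice is determined up to equality almost everywhere.
\<close>

definition square_integrable :: "'a measure \<Rightarrow> ('a \<Rightarrow> 'b::{real_normed_vector, second_countable_topology}) \<Rightarrow> bool"
  where "square_integrable M u \<longleftrightarrow>
    u \<in> borel_measurable M \<and> integrable M (\<lambda>x. (norm (u x))\<^sup>2)"

definition L2_tendsto ::
    "'a measure \<Rightarrow> ('k \<Rightarrow> 'a \<Rightarrow> 'b::{real_normed_vector, second_countable_topology}) \<Rightarrow> ('a \<Rightarrow> 'b) \<Rightarrow> 'k filter \<Rightarrow> bool"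
  where "L2_tendsto M X Y F \<longleftrightarrow>
    (\<forall>\<^sub>F k in F. square_integrable M (X k)) \<and> square_integrable M Y \<and>
    ((\<lambda>k. sqrt (\<integral>x. (norm (X k x - Y x))\<^sup>2 \<partial>M)) \<longlongrightarrow> 0) F"

text \<open>From here on, $L^2$ is the complex space $L^2(E)$ over Lebesgue measure on a Euclidean space $E$.\<close>

abbreviation L2 :: "('a::euclidean_space \<Rightarrow> complex) \<Rightarrow> bool"
  where "L2 \<equiv> square_integrable lborel"

definition inner_L2 :: "('a::euclidean_space \<Rightarrow> complex) \<Rightarrow> ('a \<Rightarrow> complex) \<Rightarrow> complex"
  where "inner_L2 u v = (\<integral>x. cnj (u x) * v x \<partial>lborel)"

text \<open>The unitary (Plancherel) Fourier transform, as the $L^2$ limit of truncated Fourier integrals.\<close>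

definition fourier_L2 :: "('a::euclidean_space \<Rightarrow> complex) \<Rightarrow> ('a \<Rightarrow> complex)"
  where "fourier_L2 u = (SOME v. L2_tendsto lborel
    (\<lambda>R p. complex_of_real ((2 * pi) powr (- real DIM('a) / 2)) *
            (LINT x : cball 0 R | lborel. cis (- (p \<bullet> x)) * u x)) v at_top)"

definition inv_fourier_L2 :: "('a::euclidean_space \<Rightarrow> complex) \<Rightarrow> ('a \<Rightarrow> complex)"
  where "inv_fourier_L2 u = (\<lambda>x. fourier_L2 u (- x))"

text \<open>
  Functional calculus $h(\Delta)$ of the self-adjoint Laplacian, which the Fourier transform
  diagonalizes as multiplication by $-|p|^2$.  The domain of $h(\Delta)$ consists of those $u$ in
  $L^2$ for which $p \mapsto h(-|p|^2)\,\hat u(p)$ is in $L^2$; other arguments give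
  no meaningful value.
\<close>

definition fun_laplacian :: "(real \<Rightarrow> real) \<Rightarrow> ('a::euclidean_space \<Rightarrow> complex) \<Rightarrow> ('a \<Rightarrow> complex)"
  where "fun_laplacian h u =
    inv_fourier_L2 (\<lambda>p. complex_of_real (h (- (norm p)\<^sup>2)) * fourier_L2 u p)"

text \<open>
  For $G = e^{\beta\Delta}$ the functional calculus gives $g(G) = (g \circ \exp(\beta\,\cdot))(\Delta)$;
  below this is used with $g(G) = (G(1-G)^{-1})^{1/2}$.  At $\lambda = 0$, i.e. $p = 0$, the
  symbol is $\sqrt{1/0} = 0$ by convention, which affects a null set only.
\<close>

definition fun_heat :: "real \<Rightarrow> (real \<Rightarrow> real) \<Rightarrow> ('a::euclidean_space \<Rightarrow> complex) \<Rightarrow> ('a \<Rightarrow> complex)"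
  where "fun_heat \<beta> g = fun_laplacian (g \<circ> (\<lambda>l. exp (\<beta> * l)))"

definition sqrt_weight :: "('a \<Rightarrow> real) \<Rightarrow> ('a \<Rightarrow> complex)"
  where "sqrt_weight f = (\<lambda>x. complex_of_real (sqrt (1 - exp (- f x))))"

definition W_op :: "real \<Rightarrow> ('a::euclidean_space \<Rightarrow> real) \<Rightarrow> ('a \<Rightarrow> complex) \<Rightarrow> ('a \<Rightarrow> complex)"
  where "W_op \<beta> f u = fun_heat \<beta> (\<lambda>g. sqrt (g * inverse (1 - g))) (\<lambda>x. sqrt_weight f x * u x)"

definition adjoint_L2 ::
    "(('a::euclidean_space \<Rightarrow> complex) \<Rightarrow> ('a \<Rightarrow> complex)) \<Rightarrow> ('a \<Rightarrow> complex) \<Rightarrow> ('a \<Rightarrow> complex)"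
  where "adjoint_L2 T = (SOME S. \<forall>u. L2 u \<longrightarrow>
    L2 (S u) \<and> (\<forall>v. L2 v \<longrightarrow> inner_L2 (S u) v = inner_L2 u (T v)))"

definition K_op :: "real \<Rightarrow> ('a::euclidean_space \<Rightarrow> real) \<Rightarrow> ('a \<Rightarrow> complex) \<Rightarrow> ('a \<Rightarrow> complex)"
  where "K_op \<beta> f u = adjoint_L2 (W_op \<beta> f) (W_op \<beta> f u)"

definition inv_one_plus ::
    "(('a::euclidean_space \<Rightarrow> complex) \<Rightarrow> ('a \<Rightarrow> complex)) \<Rightarrow> ('a \<Rightarrow> complex) \<Rightarrow> ('a \<Rightarrow> complex)"
  where "inv_one_plus T g = (SOME u. L2 u \<and> (AE x in lborel. u x + T u x = g x))"

definition orthonormal_basis_L2 :: "('a::euclidean_space \<Rightarrow> complex) set \<Rightarrow> bool"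
  where "orthonormal_basis_L2 B \<longleftrightarrow>
    (\<forall>e\<in>B. L2 e) \<and>
    (\<forall>e\<in>B. \<forall>e'\<in>B. inner_L2 e e' = (if e = e' then 1 else 0)) \<and>
    (\<forall>u. L2 u \<longrightarrow> (\<forall>e\<in>B. inner_L2 e u = 0) \<longrightarrow> (AE x in lborel. u x = 0))"

text \<open>
  The principal minor $\det(\langle e, T e'\rangle)_{e, e' \in S}$ for a finite set $S$, by the
  Leibniz formula.
\<close>

definition minor_L2 ::
    "(('a::euclidean_space \<Rightarrow> complex) \<Rightarrow> ('a \<Rightarrow> complex)) \<Rightarrow> ('a \<Rightarrow> complex) set \<Rightarrow> complex"
  where "minor_L2 T S = (\<Sum>\<pi> | \<pi> permutes S. of_int (sign \<pi>) * (\<Prod>e\<in>S. inner_L2 e (T (\<pi> e))))"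

text \<open>
  The Fredholm determinant $\mathrm{Det}[1+T] = \sum_n \mathrm{Tr}(\Lambda^n T)$ of a trace-class
  operator $T$.  Here $\mathrm{Tr}(\Lambda^n T)$ is evaluated in the basis $e_{i_1} \wedge \dots
  \wedge e_{i_n}$ of the $n$-th exterior power, in which the diagonal entries of $\Lambda^n T$ are
  the principal minors of size $n$.  For trace-class $T$ the sum converges absolutely and does not
  depend on the orthonormal basis.
\<close>

definition fredholm_det :: "(('a::euclidean_space \<Rightarrow> complex) \<Rightarrow> ('a \<Rightarrow> complex)) \<Rightarrow> complex"
  where "fredholm_det T = (\<Sum>\<^sub>\<infinity>S\<in>Fpow (SOME B. orthonormal_basis_L2 B). minor_L2 T S)"

definition point_measures :: "'a::euclidean_space measure set"
  where "point_measures = {\<xi>. sets \<xi> = sets borel \<and>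
    (\<forall>A\<in>sets borel. bounded A \<longrightarrow> (\<exists>k::nat. emeasure \<xi> A = of_nat k))}"

definition pairing :: "('a \<Rightarrow> real) \<Rightarrow> 'a measure \<Rightarrow> real"
  where "pairing f \<xi> = (\<integral>x. f x \<partial>\<xi>)"

definition compactly_supported :: "('a::euclidean_space \<Rightarrow> real) \<Rightarrow> bool"
  where "compactly_supported f \<longleftrightarrow> compact (closure {x. f x \<noteq> 0})"

text \<open>The Polish topology of the space of point measures is the vague topology.\<close>

definition vague_topology :: "'a::euclidean_space measure topology"
  where "vague_topology = topology_generated_by
    {{\<xi> \<in> point_measures. pairing g \<xi> \<in> U} | g U.
       continuous_on UNIV g \<and> compactly_supported g \<and> open U}"

definition point_measure_borel :: "'a::euclidean_space measure measure"
  where "point_measure_borel = sigma point_measures {V. openin vague_topology V}"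

definition critical_density :: "'a::euclidean_space itself \<Rightarrow> real \<Rightarrow> real"
  where "critical_density _ \<beta> =
    (\<integral>p. 1 / (exp (\<beta> * (norm (p::'a))\<^sup>2) - 1) / (2 * pi) ^ DIM('a) \<partial>lborel)"

definition test_function :: "('a::euclidean_space \<Rightarrow> real) \<Rightarrow> bool"
  where "test_function f \<longleftrightarrow>
    f \<in> borel_measurable borel \<and> (\<forall>x. 0 \<le> f x) \<and> bounded (range f) \<and> compactly_supported f"

definition boson_point_field :: "real \<Rightarrow> real \<Rightarrow> 'a::euclidean_space measure measure \<Rightarrow> bool"
  where "boson_point_field \<beta> \<rho> \<nu> \<longleftrightarrow>
    prob_space \<nu> \<and> sets \<nu> = sets point_measure_borel \<and>
    (\<forall>f. test_function f \<longrightarrow>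
      complex_of_real (\<integral>\<xi>. exp (- pairing f \<xi>) \<partial>\<nu>) =
        exp (- complex_of_real (\<rho> - critical_density TYPE('a) \<beta>) *
               inner_L2 (sqrt_weight f) (inv_one_plus (K_op \<beta> f) (sqrt_weight f)))
        / fredholm_det (K_op \<beta> f))"

end

theory Submission
  imports Defs "HOL-Real_Asymp.Real_Asymp"
begin

text \<open>
  Write $w = \sqrt{1 - e^{-sf}}$ and $\tau = \int w^2$.  The trace of $K_{sf}$ is exactly $\rho_c \tau$,
  and $\|K_{sf}\| \le s C$ for a constant $C$ obtained by cutting the Bose factor
  $1/(e^{\beta|p|^2}-1)$ at a level $M$.  Hence $\langle w, (1+K_{sf})^{-1} w\rangle$ lies between
  $(1 - sC)\tau$ and $\tau$, and, with $T = \rho_c\tau$, the determinant is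
  $1 + T + \frac12 (T^2 - \mathrm{Tr}\, K_{sf}^2) + O(T^3)$ with $0 \le \mathrm{Tr}\, K_{sf}^2 \le s C T$;
  the crude estimate of an $n \times n$ minor by $n!$ times the product of its diagonal is enough
  for the remainder.  As $s \downarrow 0$ this yields, for $Y = \langle f, \xi\rangle$, that
  $E Y \ge \rho \int f$ and
  $E Y^2 \le (\rho \int f)^2 + 2 \rho \int f^2 + (4\rho - 2\rho_c) C \int f$.  For $f(\cdot/\kappa)$ the
  constant $C$ is $M \sup f + \kappa^d \varepsilon_M \int f$, where $\varepsilon_M \to 0$ as $M \to \infty$, so that the variance
  of $\kappa^{-d} Y$ vanishes in the limit $\kappa \to \infty$.
\<close>

section \<open>The space $L^2$\<close>

text \<open>With m = \<rho> I the mean square deviation of Y from m is E Y^2 - 2 m E Y + m^2, so the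
  mean is wanted from below and the second moment from above. This is why each of the two moments is
  estimated on one side only. The obstacle is that the Bose factor is unbounded at p = 0, so that
  W_f is bounded only thanks to the weight w. Above the level M the transform of w u is bounded
  pointwise by the L1 norm of w u, that is by Cauchy-Schwarz through \<tau> and the norm of u. The
  price is a factor of order \<kappa>^d, which the small integral of the Bose factor over its large
  values pays for. Fourier transform, adjoint, inverse and basis are all given by choice, so
  existence has to be established before anything can be said about them. Every transform that
  occurs acts on a function that is both integrable and square integrable: w u is a product of two
  L2 functions, and the root of the Bose factor is integrable. There the chosen transforms are,
  almost everywhere, absolutely convergent integrals. Plancherel's theorem enters as an equality,
  since the first-order term of the determinant must be exactly \<rho>_c \<tau> for the mean to come
  out as \<rho> I.\<close>

lemma borel_measurable_cnj[measurable (raw)]: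
  "f \<in> borel_measurable M \<Longrightarrow> (\<lambda>x. cnj (f x)) \<in> borel_measurable M"
  by (rule measurable_compose[OF _ borel_measurable_continuous_onI]) (auto intro: continuous_intros)

definition sqnorm :: "('a::euclidean_space \<Rightarrow> complex) \<Rightarrow> real"
  where "sqnorm u = (\<integral>x. (norm (u x))\<^sup>2 \<partial>lborel)"

lemma L2_measurable[measurable_dest]: "L2 u \<Longrightarrow> u \<in> borel_measurable borel"
  by (simp add: square_integrable_def)

lemma L2_integrable: "L2 u \<Longrightarrow> integrable lborel (\<lambda>x. (norm (u x))\<^sup>2)"
  by (simp add: square_integrable_def)

lemma L2_I:
  assumes "u \<in> borel_measurable borel" "integrable lborel (\<lambda>x. (norm (u x))\<^sup>2)"
  shows "L2 u"
  using assms by (simp add: square_integrable_def)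

lemma L2_bound:
  assumes "u \<in> borel_measurable borel" "integrable lborel h" "AE x in lborel. (norm (u x))\<^sup>2 \<le> h x"
  shows "L2 u"
proof (rule L2_I)
  show "integrable lborel (\<lambda>x. (norm (u x))\<^sup>2)"
    by (rule Bochner_Integration.integrable_bound[OF assms(2)]) (use assms(1,3) in \<open>auto elim!: eventually_mono\<close>)
qed fact

lemma sqnorm_nonneg [simp]: "0 \<le> sqnorm u"
  by (simp add: sqnorm_def)

lemma norm_add_sq_le: "(norm (a + b :: complex))\<^sup>2 \<le> 2 * (norm a)\<^sup>2 + 2 * (norm b)\<^sup>2"
proof -
  have "(norm (a + b))\<^sup>2 \<le> (norm a + norm b)\<^sup>2"
    by (intro power_mono norm_triangle_ineq) auto
  also have "\<dots> \<le> 2 * (norm a)\<^sup>2 + 2 * (norm b)\<^sup>2"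
    using sum_squares_bound[of "norm a" "norm b"] by (simp add: power2_sum)
  finally show ?thesis .
qed

lemma L2_add: "L2 u \<Longrightarrow> L2 v \<Longrightarrow> L2 (\<lambda>x. u x + v x)"
  by (rule L2_bound[where h="\<lambda>x. 2 * (norm (u x))\<^sup>2 + 2 * (norm (v x))\<^sup>2"])
    (auto intro!: L2_integrable norm_add_sq_le)

lemma L2_cmult: "L2 u \<Longrightarrow> L2 (\<lambda>x. c * u x)"
  by (rule L2_bound[where h="\<lambda>x. (norm c)\<^sup>2 * (norm (u x))\<^sup>2"])
    (auto intro!: L2_integrable simp: norm_mult power_mult_distrib)

lemma L2_diff: "L2 u \<Longrightarrow> L2 v \<Longrightarrow> L2 (\<lambda>x. u x - v x)"
  using L2_add[of u "\<lambda>x. - 1 * v x"] L2_cmult[of v "- 1"] by simp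

lemma L2_zero [simp]: "L2 (\<lambda>x. 0)"
  by (simp add: square_integrable_def)

lemma L2_sum: "(\<And>i. i \<in> I \<Longrightarrow> L2 (u i)) \<Longrightarrow> L2 (\<lambda>x. \<Sum>i\<in>I. u i x)"
  by (induction I rule: infinite_finite_induct) (auto intro!: L2_add)

lemma L2_bounded_mult:
  assumes "L2 u" "w \<in> borel_measurable borel" "\<And>x. norm (w x) \<le> B"
  shows "L2 (\<lambda>x. w x * u x)"
proof (rule L2_bound[where h="\<lambda>x. B\<^sup>2 * (norm (u x))\<^sup>2"])
  show "(\<lambda>x. w x * u x) \<in> borel_measurable borel"
    using assms by measurable
  show "integrable lborel (\<lambda>x. B\<^sup>2 * (norm (u x))\<^sup>2)"
    using assms by (auto intro!: L2_integrable)
  show "AE x in lborel. (norm (w x * u x))\<^sup>2 \<le> B\<^sup>2 * (norm (u x))\<^sup>2"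
    using assms(3) by (auto simp: norm_mult power_mult_distrib intro!: mult_right_mono power_mono)
qed

lemma L2_cong_AE:
  assumes "L2 u" "v \<in> borel_measurable borel" "AE x in lborel. u x = v x"
  shows "L2 v"
proof (rule L2_bound[OF assms(2) L2_integrable[OF assms(1)]])
  show "AE x in lborel. (norm (v x))\<^sup>2 \<le> (norm (u x))\<^sup>2"
    using assms(3) by (auto elim!: eventually_mono)
qed

lemma mult_le_sum_sq: "2 * (norm (a::complex) * norm (b::complex)) \<le> (norm a)\<^sup>2 + (norm b)\<^sup>2"
  using sum_squares_bound[of "norm a" "norm b"] by simp

lemma integrable_L2_mult:
  assumes "L2 u" "L2 v"
  shows "integrable lborel (\<lambda>x. norm (u x) * norm (v x))"
proof (rule Bochner_Integration.integrable_bound)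
  show "integrable lborel (\<lambda>x. (norm (u x))\<^sup>2 + (norm (v x))\<^sup>2)"
    using assms by (auto intro!: L2_integrable)
  show "AE x in lborel. norm (norm (u x) * norm (v x)) \<le> norm ((norm (u x))\<^sup>2 + (norm (v x))\<^sup>2)"
  proof (rule AE_I2)
    fix x
    show "norm (norm (u x) * norm (v x)) \<le> norm ((norm (u x))\<^sup>2 + (norm (v x))\<^sup>2)"
      using mult_le_sum_sq[of "u x" "v x"] by (simp, smt (verit) mult_nonneg_nonneg norm_ge_zero)
  qed
  show "(\<lambda>x. norm (u x) * norm (v x)) \<in> borel_measurable lborel"
    using assms by measurable
qed

lemma integrable_inner_L2:
  assumes "L2 u" "L2 v"
  shows "integrable lborel (\<lambda>x. cnj (u x) * v x)"
proof -
  have [measurable]: "u \<in> borel_measurable borel" "v \<in> borel_measurable borel" using assms by auto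
  have "(\<lambda>x. cnj (u x) * v x) \<in> borel_measurable lborel" by measurable
  thus ?thesis
    by (subst integrable_norm_iff[symmetric])
      (auto simp: norm_mult intro!: integrable_L2_mult[OF assms])
qed

text \<open>Keeping the absolute values inside the integral lets the same inequality bound the L1
  norm of a product, and with it the supremum of its Fourier integral.\<close>

lemma integral_mult_le:
  assumes "L2 u" "L2 v"
  shows "(\<integral>x. norm (u x) * norm (v x) \<partial>lborel) \<le> sqrt (sqnorm u) * sqrt (sqnorm v)"
proof -
  define J where "J = (\<integral>x. norm (u x) * norm (v x) \<partial>lborel)"
  have [measurable]: "u \<in> borel_measurable borel" "v \<in> borel_measurable borel" using assms by auto
  have J0: "0 \<le> J" by (simp add: J_def)
  have "(\<integral>\<^sup>+x. ennreal (norm (u x)) * ennreal (norm (v x)) \<partial>lborel)\<^sup>2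
     \<le> (\<integral>\<^sup>+x. (ennreal (norm (u x)))\<^sup>2 \<partial>lborel) * (\<integral>\<^sup>+x. (ennreal (norm (v x)))\<^sup>2 \<partial>lborel)"
    by (rule Cauchy_Schwarz_nn_integral) measurable
  also have "(\<integral>\<^sup>+x. ennreal (norm (u x)) * ennreal (norm (v x)) \<partial>lborel) = ennreal J"
    unfolding J_def by (subst nn_integral_eq_integral[symmetric])
      (auto simp: ennreal_mult intro!: integrable_L2_mult assms)
  also have "(\<integral>\<^sup>+x. (ennreal (norm (u x)))\<^sup>2 \<partial>lborel) = ennreal (sqnorm u)"
    unfolding sqnorm_def by (subst nn_integral_eq_integral[symmetric])
      (auto simp: ennreal_power intro!: L2_integrable assms)
  also have "(\<integral>\<^sup>+x. (ennreal (norm (v x)))\<^sup>2 \<partial>lborel) = ennreal (sqnorm v)"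
    unfolding sqnorm_def by (subst nn_integral_eq_integral[symmetric])
      (auto simp: ennreal_power intro!: L2_integrable assms)
  finally have "J\<^sup>2 \<le> sqnorm u * sqnorm v"
    using J0 by (simp add: ennreal_power ennreal_mult[symmetric])
  hence "J \<le> sqrt (sqnorm u * sqnorm v)"
    using J0 real_le_rsqrt by blast
  thus ?thesis by (simp add: J_def real_sqrt_mult)
qed

lemma Cauchy_Schwarz_L2:
  assumes "L2 u" "L2 v"
  shows "norm (inner_L2 u v) \<le> sqrt (sqnorm u) * sqrt (sqnorm v)"
proof -
  have "norm (inner_L2 u v) \<le> (\<integral>x. norm (u x) * norm (v x) \<partial>lborel)"
    unfolding inner_L2_def using integral_norm_bound[of lborel "\<lambda>x. cnj (u x) * v x"]
    by (simp add: norm_mult)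
  thus ?thesis using integral_mult_le[OF assms] by linarith
qed

lemma Cauchy_Schwarz_L2_sq:
  assumes "L2 u" "L2 v"
  shows "(norm (inner_L2 u v))\<^sup>2 \<le> sqnorm u * sqnorm v"
proof -
  have "(norm (inner_L2 u v))\<^sup>2 \<le> (sqrt (sqnorm u) * sqrt (sqnorm v))\<^sup>2"
    by (intro power_mono Cauchy_Schwarz_L2 assms) auto
  thus ?thesis by (simp add: power_mult_distrib)
qed

lemma inner_L2_cong_AE:
  assumes "AE x in lborel. u x = u' x" "AE x in lborel. v x = v' x"
    "u \<in> borel_measurable borel" "u' \<in> borel_measurable borel"
    "v \<in> borel_measurable borel" "v' \<in> borel_measurable borel"
  shows "inner_L2 u v = inner_L2 u' v'"
  unfolding inner_L2_def
proof (rule integral_cong_AE)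
  show "AE x in lborel. cnj (u x) * v x = cnj (u' x) * v' x"
    using assms(1,2) by eventually_elim simp
qed (use assms in measurable)

lemma sqnorm_cong_AE:
  assumes "AE x in lborel. u x = u' x"
    "u \<in> borel_measurable borel" "u' \<in> borel_measurable borel"
  shows "sqnorm u = sqnorm u'"
  unfolding sqnorm_def
proof (rule integral_cong_AE)
  show "AE x in lborel. (norm (u x))\<^sup>2 = (norm (u' x))\<^sup>2"
    using assms(1) by eventually_elim simp
qed (use assms in measurable)

lemma inner_L2_add_right:
  "L2 u \<Longrightarrow> L2 v \<Longrightarrow> L2 v' \<Longrightarrow> inner_L2 u (\<lambda>x. v x + v' x) = inner_L2 u v + inner_L2 u v'"
  unfolding inner_L2_def
  by (subst Bochner_Integration.integral_add[symmetric])
    (auto simp: distrib_left intro!: integrable_inner_L2)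

lemma inner_L2_add_left:
  "L2 u \<Longrightarrow> L2 u' \<Longrightarrow> L2 v \<Longrightarrow> inner_L2 (\<lambda>x. u x + u' x) v = inner_L2 u v + inner_L2 u' v"
  unfolding inner_L2_def
  by (subst Bochner_Integration.integral_add[symmetric])
    (auto simp: distrib_right intro!: integrable_inner_L2)

lemma inner_L2_diff_right:
  "L2 u \<Longrightarrow> L2 v \<Longrightarrow> L2 v' \<Longrightarrow> inner_L2 u (\<lambda>x. v x - v' x) = inner_L2 u v - inner_L2 u v'"
  unfolding inner_L2_def
  by (subst Bochner_Integration.integral_diff[symmetric])
    (auto simp: right_diff_distrib intro!: integrable_inner_L2)

lemma inner_L2_diff_left:
  "L2 u \<Longrightarrow> L2 u' \<Longrightarrow> L2 v \<Longrightarrow> inner_L2 (\<lambda>x. u x - u' x) v = inner_L2 u v - inner_L2 u' v"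
  unfolding inner_L2_def
  by (subst Bochner_Integration.integral_diff[symmetric])
    (auto simp: left_diff_distrib intro!: integrable_inner_L2)

lemma inner_L2_cmult_right: "inner_L2 u (\<lambda>x. c * v x) = c * inner_L2 u v"
  unfolding inner_L2_def by (subst integral_mult_right_zero[symmetric]) (simp add: ac_simps)

lemma inner_L2_cmult_left: "inner_L2 (\<lambda>x. c * u x) v = cnj c * inner_L2 u v"
  unfolding inner_L2_def by (subst integral_mult_right_zero[symmetric]) (simp add: ac_simps)

lemma inner_L2_commute: "inner_L2 v u = cnj (inner_L2 u v)"
  unfolding inner_L2_def by (subst Bochner_Integration.integral_cnj[symmetric]) (simp add: mult.commute)

lemma inner_L2_zero_right [simp]: "inner_L2 u (\<lambda>x. 0) = 0"
  by (simp add: inner_L2_def)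

lemma inner_L2_sum_right:
  "L2 u \<Longrightarrow> (\<And>i. i \<in> I \<Longrightarrow> L2 (v i)) \<Longrightarrow> inner_L2 u (\<lambda>x. \<Sum>i\<in>I. v i x) = (\<Sum>i\<in>I. inner_L2 u (v i))"
  by (induction I rule: infinite_finite_induct) (auto simp: inner_L2_add_right L2_sum)

lemma inner_L2_self: "inner_L2 u u = of_real (sqnorm u)"
  unfolding inner_L2_def sqnorm_def integral_complex_of_real[symmetric]
  by (simp add: complex_norm_square[symmetric] mult.commute)

lemma sqnorm_eq_Re: "sqnorm u = Re (inner_L2 u u)"
  by (simp add: inner_L2_self)

lemma sqnorm_add:
  assumes "L2 u" "L2 v"
  shows "sqnorm (\<lambda>x. u x + v x) = sqnorm u + 2 * Re (inner_L2 u v) + sqnorm v"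
  using assms inner_L2_commute[of v u]
  by (simp add: sqnorm_eq_Re inner_L2_add_left inner_L2_add_right L2_add)

lemma sqnorm_diff:
  assumes "L2 u" "L2 v"
  shows "sqnorm (\<lambda>x. u x - v x) = sqnorm u - 2 * Re (inner_L2 u v) + sqnorm v"
  using assms inner_L2_commute[of v u]
  by (simp add: sqnorm_eq_Re inner_L2_diff_left inner_L2_diff_right L2_diff)

lemma sqnorm_cmult: "sqnorm (\<lambda>x. c * u x) = (norm c)\<^sup>2 * sqnorm u"
  by (simp add: sqnorm_def norm_mult power_mult_distrib)

lemma sqnorm_add_le:
  assumes "L2 u" "L2 v"
  shows "sqnorm (\<lambda>x. u x + v x) \<le> 2 * sqnorm u + 2 * sqnorm v"
proof -
  have "sqnorm (\<lambda>x. u x + v x) \<le> (\<integral>x. 2 * (norm (u x))\<^sup>2 + 2 * (norm (v x))\<^sup>2 \<partial>lborel)"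
    unfolding sqnorm_def using assms
    by (intro integral_mono L2_integrable norm_add_sq_le L2_add Bochner_Integration.integrable_add
        integrable_mult_right) auto
  thus ?thesis using assms by (simp add: sqnorm_def L2_integrable)
qed

lemma sqnorm_minus_commute: "sqnorm (\<lambda>x. u x - v x) = sqnorm (\<lambda>x. v x - u x)"
  by (simp add: sqnorm_def norm_minus_commute)

lemma sqnorm_triangle:
  assumes "L2 u" "L2 v" "L2 w"
  shows "sqnorm (\<lambda>x. u x - w x) \<le> 2 * sqnorm (\<lambda>x. u x - v x) + 2 * sqnorm (\<lambda>x. v x - w x)"
  using sqnorm_add_le[OF L2_diff[OF assms(1,2)] L2_diff[OF assms(2,3)]] by simp

lemma sqnorm_eq_0:
  assumes "L2 u" "sqnorm u = 0"
  shows "AE x in lborel. u x = 0"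
proof -
  have "AE x in lborel. (norm (u x))\<^sup>2 = 0"
    using integral_nonneg_eq_0_iff_AE[OF L2_integrable[OF assms(1)]] assms(2)
    by (simp add: sqnorm_def)
  thus ?thesis by eventually_elim simp
qed

text \<open>Fatou's lemma for the squared norms. Membership of the limit in \<open>L2\<close> is
  part of the conclusion, which is what both completeness and the removal of a Gaussian damping
  factor require.\<close>

lemma L2_Fatou:
  assumes v: "\<And>k. L2 (v k)" and h: "h \<in> borel_measurable borel"
    and lim: "AE x in lborel. (\<lambda>k. v k x) \<longlonglongrightarrow> h x"
    and bound: "\<forall>\<^sub>F k in sequentially. sqnorm (v k) \<le> c" and c: "0 \<le> c"
  shows "L2 h" "sqnorm h \<le> c"
proof -
  have [measurable]: "v k \<in> borel_measurable borel" for k using v by auto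
  note [measurable] = h
  have "(\<integral>\<^sup>+x. ennreal ((norm (h x))\<^sup>2) \<partial>lborel)
      = (\<integral>\<^sup>+x. liminf (\<lambda>k. ennreal ((norm (v k x))\<^sup>2)) \<partial>lborel)"
  proof (rule nn_integral_cong_AE)
    show "AE x in lborel. ennreal ((norm (h x))\<^sup>2) = liminf (\<lambda>k. ennreal ((norm (v k x))\<^sup>2))"
      using lim
    proof eventually_elim
      case (elim x)
      hence "(\<lambda>k. ennreal ((norm (v k x))\<^sup>2)) \<longlonglongrightarrow> ennreal ((norm (h x))\<^sup>2)"
        by (intro tendsto_ennrealI tendsto_intros)
      thus ?case by (intro lim_imp_Liminf[symmetric]) simp_all
    qed
  qed
  also have "\<dots> \<le> liminf (\<lambda>k. \<integral>\<^sup>+x. ennreal ((norm (v k x))\<^sup>2) \<partial>lborel)"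
    by (rule nn_integral_liminf) measurable
  also have "\<dots> \<le> liminf (\<lambda>k::nat. ennreal c)"
  proof (rule Liminf_mono)
    show "\<forall>\<^sub>F k in sequentially. (\<integral>\<^sup>+x. ennreal ((norm (v k x))\<^sup>2) \<partial>lborel) \<le> ennreal c"
      using bound
    proof eventually_elim
      case (elim k)
      thus ?case using L2_integrable[OF v[of k]]
        by (simp add: nn_integral_eq_integral sqnorm_def ennreal_leI)
    qed
  qed
  also have "\<dots> = ennreal c" by (simp add: Liminf_const)
  finally have *: "(\<integral>\<^sup>+x. ennreal ((norm (h x))\<^sup>2) \<partial>lborel) \<le> ennreal c" .
  hence I: "integrable lborel (\<lambda>x. (norm (h x))\<^sup>2)"
    by (intro integrableI_bounded) (auto simp: le_less_trans)
  thus "L2 h" by (intro L2_I h)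
  show "sqnorm h \<le> c"
    using * c I by (simp add: nn_integral_eq_integral sqnorm_def)
qed

text \<open>Riesz--Fischer: along a fast subsequence the weighted sums
  $\sum_k 2^k |v_{k+1} - v_k|^2$ are finite almost everywhere.\<close>

lemma L2_complete:
  fixes u :: "nat \<Rightarrow> 'a::euclidean_space \<Rightarrow> complex"
  assumes u: "\<And>n. L2 (u n)"
    and Cauchy: "\<And>\<epsilon>. 0 < \<epsilon> \<Longrightarrow> \<exists>N. \<forall>m\<ge>N. \<forall>n\<ge>N. sqnorm (\<lambda>x. u m x - u n x) \<le> \<epsilon>"
  shows "\<exists>v. L2 v \<and> (\<lambda>n. sqnorm (\<lambda>x. u n x - v x)) \<longlonglongrightarrow> 0"
proof -
  have [measurable]: "u n \<in> borel_measurable borel" for n using u by auto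
  have "\<forall>k. \<exists>N. \<forall>m\<ge>N. \<forall>n\<ge>N. sqnorm (\<lambda>x. u m x - u n x) \<le> (1/4)^k"
    using Cauchy by simp
  then obtain N where N: "\<And>k m n. m \<ge> N k \<Longrightarrow> n \<ge> N k \<Longrightarrow> sqnorm (\<lambda>x. u m x - u n x) \<le> (1/4)^k"
    by metis
  \<comment> \<open>The sum makes \<open>r\<close> monotone and at least \<open>N k\<close>; the
    summand \<open>k\<close> makes it tend to infinity.\<close>
  define r where "r k = k + (\<Sum>i\<le>k. N i)" for k
  have rN: "N k \<le> r k" for k
    unfolding r_def using member_le_sum[of k "{..k}" N] by simp
  have rSuc: "r k \<le> r (Suc k)" for k by (simp add: r_def)
  have rk: "k \<le> r k" for k by (simp add: r_def)
  define d where "d k x = u (r (Suc k)) x - u (r k) x" for k x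
  have L2d: "L2 (d k)" for k unfolding d_def by (intro L2_diff u)
  have [measurable]: "d k \<in> borel_measurable borel" for k using L2d by auto
  have dk: "sqnorm (d k) \<le> (1/4)^k" for k
    unfolding d_def using rN[of k] rSuc[of k] by (intro N) auto
  have "(\<integral>\<^sup>+x. (\<Sum>k. ennreal (2^k * (norm (d k x))\<^sup>2)) \<partial>lborel)
      = (\<Sum>k. \<integral>\<^sup>+x. ennreal (2^k * (norm (d k x))\<^sup>2) \<partial>lborel)"
    by (rule nn_integral_suminf) measurable
  also have "\<dots> \<le> (\<Sum>k. ennreal ((1/2)^k))"
  proof (intro suminf_le)
    fix k
    have "(\<integral>\<^sup>+x. ennreal (2^k * (norm (d k x))\<^sup>2) \<partial>lborel) = ennreal (2^k * sqnorm (d k))"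
      using L2_integrable[OF L2d[of k]] by (subst nn_integral_eq_integral) (auto simp: sqnorm_def)
    also have "\<dots> \<le> ennreal (2^k * (1/4)^k)" by (intro ennreal_leI mult_left_mono dk) auto
    also have "(2::real)^k * (1/4)^k = (1/2)^k" by (simp flip: power_mult_distrib)
    finally show "(\<integral>\<^sup>+x. ennreal (2^k * (norm (d k x))\<^sup>2) \<partial>lborel) \<le> ennreal ((1/2)^k)" .
  qed auto
  also have "\<dots> = ennreal (\<Sum>k. (1/2)^k)"
    by (rule suminf_ennreal2) (auto intro: summable_geometric)
  also have "\<dots> < \<infinity>" by simp
  finally have "AE x in lborel. (\<Sum>k. ennreal (2^k * (norm (d k x))\<^sup>2)) \<noteq> \<infinity>"
    by (intro nn_integral_noteq_infinite) auto
  hence conv: "AE x in lborel. convergent (\<lambda>k. u (r k) x)"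
  proof eventually_elim
    case (elim x)
    hence S: "summable (\<lambda>k. 2^k * (norm (d k x))\<^sup>2)"
      by (intro summable_suminf_not_top) auto
    have "summable (\<lambda>k. norm (d k x))"
    proof (rule summable_comparison_test_ev)
      show "summable (\<lambda>k. (1/2)^k + 2^k * (norm (d k x))\<^sup>2)"
        by (intro summable_add S summable_geometric) auto
      show "\<forall>\<^sub>F k in sequentially. norm (norm (d k x)) \<le> (1/2)^k + 2^k * (norm (d k x))\<^sup>2"
      proof (rule always_eventually, rule allI)
        fix k
        \<comment> \<open>Weighted arithmetic-geometric mean: 2 |d| is at most 2^k |d|^2 + 2^(-k),
          so summability of the weighted squares gives absolute summability.\<close>
        have "0 \<le> 2^k * (norm (d k x) - (1/2)^k)\<^sup>2" by simp
        also have "\<dots> = 2^k * (norm (d k x))\<^sup>2 + (1/2)^k - 2 * norm (d k x)"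
          by (simp add: power2_diff algebra_simps power2_eq_square power_one_over)
        finally show "norm (norm (d k x)) \<le> (1/2)^k + 2^k * (norm (d k x))\<^sup>2"
          by (simp, smt (verit) norm_ge_zero)
      qed
    qed
    hence "summable (\<lambda>k. d k x)" by (rule summable_norm_cancel)
    hence "convergent (\<lambda>n. \<Sum>k<n. d k x)" by (simp add: summable_iff_convergent)
    hence "convergent (\<lambda>n. (\<Sum>k<n. d k x) + u (r 0) x)"
      by (intro convergent_add convergent_const)
    thus ?case unfolding d_def by (subst (asm) sum_lessThan_telescope) simp
  qed
  define v where "v x = lim (\<lambda>k. u (r k) x)" for x
  have vm [measurable]: "v \<in> borel_measurable borel"
    unfolding v_def by (rule borel_measurable_lim_metric) simp
  have lim: "AE x in lborel. (\<lambda>k. u (r k) x) \<longlonglongrightarrow> v x"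
    using conv by eventually_elim (simp add: v_def convergent_LIMSEQ_iff)
  \<comment> \<open>For fixed \<open>n\<close>, Fatou's lemma along the subsequence \<open>r\<close>
    carries the Cauchy bound over to the limit \<open>v\<close>, for the whole sequence
    \<open>u\<close>.\<close>
  have tail: "L2 (\<lambda>x. u n x - v x) \<and> sqnorm (\<lambda>x. u n x - v x) \<le> \<epsilon>"
    if e: "0 < \<epsilon>" and M: "\<forall>m\<ge>M. \<forall>n\<ge>M. sqnorm (\<lambda>x. u m x - u n x) \<le> \<epsilon>" and n: "n \<ge> M" for \<epsilon> M n
  proof -
    have 1: "L2 (\<lambda>x. u n x - u (r k) x)" for k by (intro L2_diff u)
    have 2: "AE x in lborel. (\<lambda>k. u n x - u (r k) x) \<longlonglongrightarrow> u n x - v x"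
      using lim by eventually_elim (intro tendsto_intros)
    have 3: "\<forall>\<^sub>F k in sequentially. sqnorm (\<lambda>x. u n x - u (r k) x) \<le> \<epsilon>"
      using eventually_ge_at_top[of M] by eventually_elim (use M n rk order_trans in blast)
    show ?thesis
      using L2_Fatou[of "\<lambda>k x. u n x - u (r k) x" "\<lambda>x. u n x - v x" \<epsilon>, OF 1 _ 2 3] e by simp
  qed
  obtain M where "\<forall>m\<ge>M. \<forall>n\<ge>M. sqnorm (\<lambda>x. u m x - u n x) \<le> 1" using Cauchy[of 1] by auto
  from tail[OF _ this, of M] have "L2 (\<lambda>x. u M x - v x)" by simp
  hence "L2 v" using L2_diff[OF u[of M]] by fastforce
  moreover have "(\<lambda>n. sqnorm (\<lambda>x. u n x - v x)) \<longlonglongrightarrow> 0"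
  proof (rule LIMSEQ_I)
    fix e :: real assume e: "0 < e"
    obtain M where M: "\<forall>m\<ge>M. \<forall>n\<ge>M. sqnorm (\<lambda>x. u m x - u n x) \<le> e/2" using Cauchy[of "e/2"] e by auto
    show "\<exists>n0. \<forall>n\<ge>n0. norm (sqnorm (\<lambda>x. u n x - v x) - 0) < e"
      using tail[OF _ M] e by (intro exI[of _ M]) force
  qed
  ultimately show ?thesis by blast
qed

lemma inner_L2_tendsto:
  assumes "L2 w" "\<And>n. L2 (u n)" "L2 v" "(\<lambda>n. sqnorm (\<lambda>x. u n x - v x)) \<longlonglongrightarrow> 0"
  shows "(\<lambda>n. inner_L2 w (u n)) \<longlonglongrightarrow> inner_L2 w v"
proof (rule LIM_zero_cancel, rule tendsto_norm_zero_cancel, rule tendsto_sandwich[OF _ _ tendsto_const])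
  show "(\<lambda>n. sqrt (sqnorm w) * sqrt (sqnorm (\<lambda>x. u n x - v x))) \<longlonglongrightarrow> 0"
    using tendsto_mult[OF tendsto_const[of "sqrt (sqnorm w)"] tendsto_real_sqrt[OF assms(4)]] by simp
  show "\<forall>\<^sub>F n in sequentially. norm (inner_L2 w (u n) - inner_L2 w v)
      \<le> sqrt (sqnorm w) * sqrt (sqnorm (\<lambda>x. u n x - v x))"
    using Cauchy_Schwarz_L2[OF assms(1) L2_diff[OF assms(2,3)]]
    by (simp add: inner_L2_diff_right assms)
qed auto

section \<open>Orthonormal families: Bessel, Parseval and existence of a basis\<close>

definition orthonormal_L2 :: "('a::euclidean_space \<Rightarrow> complex) set \<Rightarrow> bool"
  where "orthonormal_L2 B \<longleftrightarrow> (\<forall>e\<in>B. L2 e) \<and>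
    (\<forall>e\<in>B. \<forall>e'\<in>B. inner_L2 e e' = (if e = e' then 1 else 0))"

lemma orthonormal_L2_subset: "orthonormal_L2 B \<Longrightarrow> A \<subseteq> B \<Longrightarrow> orthonormal_L2 A"
  unfolding orthonormal_L2_def by blast

lemma sqnorm_orthonormal_sum:
  assumes B: "orthonormal_L2 B" "finite B"
  shows "sqnorm (\<lambda>x. \<Sum>e\<in>B. c e * e x) = (\<Sum>e\<in>B. (norm (c e))\<^sup>2)"
  using B(2,1)
proof (induction B rule: finite_induct)
  case empty
  show ?case by (simp add: sqnorm_def)
next
  case (insert a B)
  have B: "orthonormal_L2 B" using insert.prems by (rule orthonormal_L2_subset) auto
  have L: "L2 a" "\<And>e. e \<in> B \<Longrightarrow> L2 e" "sqnorm a = 1"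
    using insert.prems unfolding orthonormal_L2_def by (auto simp: sqnorm_eq_Re)
  have "inner_L2 (\<lambda>x. c a * a x) (\<lambda>x. \<Sum>e\<in>B. c e * e x) = (\<Sum>e\<in>B. cnj (c a) * (c e * inner_L2 a e))"
    using L by (simp add: inner_L2_sum_right L2_cmult inner_L2_cmult_left inner_L2_cmult_right sum_distrib_left)
  also have "\<dots> = 0"
    using insert unfolding orthonormal_L2_def by (intro sum.neutral) auto
  finally have 0: "inner_L2 (\<lambda>x. c a * a x) (\<lambda>x. \<Sum>e\<in>B. c e * e x) = 0" .
  have "sqnorm (\<lambda>x. \<Sum>e\<in>insert a B. c e * e x) = sqnorm (\<lambda>x. c a * a x + (\<Sum>e\<in>B. c e * e x))"
    using insert by simp
  also have "\<dots> = (norm (c a))\<^sup>2 + (\<Sum>e\<in>B. (norm (c e))\<^sup>2)"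
    using L by (simp add: sqnorm_add L2_cmult L2_sum 0 insert.IH[OF B] sqnorm_cmult)
  finally show ?case using insert by simp
qed

lemma inner_L2_orthonormal_sum:
  assumes B: "orthonormal_L2 B" "finite B" "L2 u"
  shows "inner_L2 u (\<lambda>x. \<Sum>e\<in>B. inner_L2 e u * e x) = of_real (\<Sum>e\<in>B. (norm (inner_L2 e u))\<^sup>2)"
proof -
  have "inner_L2 u (\<lambda>x. \<Sum>e\<in>B. inner_L2 e u * e x) = (\<Sum>e\<in>B. inner_L2 e u * inner_L2 u e)"
    using B unfolding orthonormal_L2_def
    by (subst inner_L2_sum_right) (auto simp: L2_cmult inner_L2_cmult_right)
  also have "\<dots> = (\<Sum>e\<in>B. of_real ((norm (inner_L2 e u))\<^sup>2))"
    by (intro sum.cong refl) (simp add: complex_norm_square inner_L2_commute[of u] mult.commute del: of_real_power)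
  finally show ?thesis by simp
qed

lemma Bessel_L2:
  assumes B: "orthonormal_L2 B" "finite B" "L2 u"
  shows "(\<Sum>e\<in>B. (norm (inner_L2 e u))\<^sup>2) \<le> sqnorm u"
proof -
  let ?p = "\<lambda>x. \<Sum>e\<in>B. inner_L2 e u * e x"
  have p: "L2 ?p" using B unfolding orthonormal_L2_def by (intro L2_sum L2_cmult) auto
  have "0 \<le> sqnorm (\<lambda>x. u x - ?p x)" by simp
  also have "\<dots> = sqnorm u - (\<Sum>e\<in>B. (norm (inner_L2 e u))\<^sup>2)"
    by (subst sqnorm_diff[OF B(3) p]) (simp add: inner_L2_orthonormal_sum B sqnorm_orthonormal_sum)
  finally show ?thesis by simp
qed

lemma Bessel_summable:
  assumes B: "orthonormal_L2 B" "L2 u"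
  shows "(\<lambda>e. (norm (inner_L2 e u))\<^sup>2) summable_on B"
    "infsum (\<lambda>e. (norm (inner_L2 e u))\<^sup>2) B \<le> sqnorm u"
proof -
  have *: "(\<Sum>e\<in>F. (norm (inner_L2 e u))\<^sup>2) \<le> sqnorm u" if "finite F" "F \<subseteq> B" for F
    using Bessel_L2[OF orthonormal_L2_subset[OF B(1) that(2)] that(1) B(2)] .
  show S: "(\<lambda>e. (norm (inner_L2 e u))\<^sup>2) summable_on B"
    by (rule nonneg_bdd_above_summable_on) (auto intro!: bdd_aboveI2 *)
  show "infsum (\<lambda>e. (norm (inner_L2 e u))\<^sup>2) B \<le> sqnorm u"
    by (rule infsum_le_finite_sums[OF S *])
qed

lemma orthonormal_basis_L2_orthonormal: "orthonormal_basis_L2 B \<Longrightarrow> orthonormal_L2 B"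
  unfolding orthonormal_basis_L2_def orthonormal_L2_def by blast

text \<open>Completeness enters because \<open>orthonormal_basis_L2\<close> only demands maximality.\<close>

lemma Parseval_L2:
  assumes B: "orthonormal_basis_L2 B" and u: "L2 u"
  shows "((\<lambda>e. (norm (inner_L2 e u))\<^sup>2) has_sum sqnorm u) B"
proof -
  note O = orthonormal_basis_L2_orthonormal[OF B]
  let ?a = "\<lambda>e. (norm (inner_L2 e u))\<^sup>2"
  have L2B: "\<And>e. e \<in> B \<Longrightarrow> L2 e" using O by (simp add: orthonormal_L2_def)
  define s where "s = infsum ?a B"
  have S: "(?a has_sum s) B" unfolding s_def using Bessel_summable(1)[OF O u] by simp
  have approx: "\<exists>F. finite F \<and> F \<subseteq> B \<and> (\<forall>G. finite G \<longrightarrow> F \<subseteq> G \<longrightarrow> G \<subseteq> B \<longrightarrow> s - sum ?a G < \<epsilon>)"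
    if "0 < \<epsilon>" for \<epsilon>
  proof -
    have "\<forall>\<^sub>F G in finite_subsets_at_top B. s - \<epsilon> < sum ?a G"
      using S that unfolding has_sum_def by (intro order_tendstoD(1)) auto
    thus ?thesis unfolding eventually_finite_subsets_at_top by (simp add: algebra_simps) meson
  qed
  have sum_le: "sum ?a G \<le> s" if "finite G" "G \<subseteq> B" for G
    unfolding s_def using that Bessel_summable(1)[OF O u] by (intro finite_sum_le_infsum) auto
  have "\<forall>n. \<exists>F. finite F \<and> F \<subseteq> B \<and> (\<forall>G. finite G \<longrightarrow> F \<subseteq> G \<longrightarrow> G \<subseteq> B \<longrightarrow> s - sum ?a G < inverse (real (Suc n)))"
    by (intro allI approx) simp
  then obtain F where F: "\<And>n. finite (F n)" "\<And>n. F n \<subseteq> B"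
    "\<And>n G. finite G \<Longrightarrow> F n \<subseteq> G \<Longrightarrow> G \<subseteq> B \<Longrightarrow> s - sum ?a G < inverse (real (Suc n))"
    by metis
  \<comment> \<open>The unions make the chosen finite sets increasing, so that the partial
    expansions \<open>p n\<close> over \<open>H n\<close> form a Cauchy sequence.\<close>
  define H where "H n = (\<Union>k\<le>n. F k)" for n
  have H: "finite (H n)" "H n \<subseteq> B" "m \<le> n \<Longrightarrow> H m \<subseteq> H n" "F n \<subseteq> H n" for m n
    unfolding H_def using F(1,2) by (auto, use order_trans in blast)
  have HB: "orthonormal_L2 (H n)" for n using orthonormal_L2_subset[OF O H(2)] .
  define p where "p n x = (\<Sum>e\<in>H n. inner_L2 e u * e x)" for n x
  have p: "L2 (p n)" for n unfolding p_def using H(2) L2B by (intro L2_sum L2_cmult) auto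
  have diff: "sqnorm (\<lambda>x. p n x - p m x) \<le> inverse (real (Suc m))" if "m \<le> n" for m n
  proof -
    have "(\<lambda>x. p n x - p m x) = (\<lambda>x. \<Sum>e\<in>H n - H m. inner_L2 e u * e x)"
      unfolding p_def using H(1) H(3)[OF that] by (simp add: sum_diff)
    hence "sqnorm (\<lambda>x. p n x - p m x) = sum ?a (H n - H m)"
      using sqnorm_orthonormal_sum[OF orthonormal_L2_subset[OF HB[of n]], of "H n - H m" "\<lambda>e. inner_L2 e u"] H(1)[of n] by simp
    also have "\<dots> = sum ?a (H n) - sum ?a (H m)" using H(1) H(3)[OF that] by (simp add: sum_diff)
    also have "\<dots> \<le> s - sum ?a (H m)" using sum_le[OF H(1,2)] by simp
    also have "\<dots> \<le> inverse (real (Suc m))" using F(3)[OF H(1) H(4) H(2)] by (simp add: less_imp_le)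
    finally show ?thesis .
  qed
  have "\<exists>v. L2 v \<and> (\<lambda>n. sqnorm (\<lambda>x. p n x - v x)) \<longlonglongrightarrow> 0"
  proof (rule L2_complete[OF p])
    fix \<epsilon> :: real assume e: "0 < \<epsilon>"
    obtain N where N: "inverse (real (Suc N)) < \<epsilon>" using reals_Archimedean[OF e] by auto
    have "sqnorm (\<lambda>x. p m x - p n x) \<le> \<epsilon>" if mn: "m \<ge> N" "n \<ge> N" for m n
    proof -
      have "sqnorm (\<lambda>x. p m x - p n x) \<le> inverse (real (Suc (min m n)))"
        using diff[of m n] diff[of n m] sqnorm_minus_commute[of "p m" "p n"] by (cases "m \<le> n") (auto simp: min_def)
      also have "\<dots> \<le> inverse (real (Suc N))" using mn by (intro le_imp_inverse_le) auto
      finally show ?thesis using N by simp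
    qed
    thus "\<exists>N. \<forall>m\<ge>N. \<forall>n\<ge>N. sqnorm (\<lambda>x. p m x - p n x) \<le> \<epsilon>" by blast
  qed
  then obtain v where v: "L2 v" "(\<lambda>n. sqnorm (\<lambda>x. p n x - v x)) \<longlonglongrightarrow> 0" by blast
  \<comment> \<open>A vector outside all \<open>H n\<close> could be added to \<open>H n\<close>
    without the sum exceeding \<open>s\<close>, while \<open>sum ?a (H n)\<close> is already within
    1/(n+1) of \<open>s\<close>.\<close>
  have zero: "inner_L2 e u = 0" if e: "e \<in> B" "\<forall>n. e \<notin> H n" for e
  proof -
    have "?a e \<le> inverse (real (Suc n))" for n
    proof -
      have "?a e + sum ?a (H n) = sum ?a (insert e (H n))" using e H(1) by simp
      also have "\<dots> \<le> s" using e H(1,2) by (intro sum_le) auto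
      finally show ?thesis using F(3)[OF H(1) H(4) H(2), of n] by simp
    qed
    hence "?a e \<le> 0" using LIMSEQ_inverse_real_of_nat by (intro LIMSEQ_le_const[of _ 0]) auto
    thus ?thesis by simp
  qed
  have "inner_L2 e (\<lambda>x. u x - v x) = 0" if e: "e \<in> B" for e
  proof -
    have "inner_L2 e (p n) = (if e \<in> H n then inner_L2 e u else 0)" for n
    proof -
      have "inner_L2 e (p n) = (\<Sum>e'\<in>H n. inner_L2 e' u * inner_L2 e e')"
        unfolding p_def using H(2)[of n] L2B e
        by (subst inner_L2_sum_right) (auto intro!: L2_cmult simp: inner_L2_cmult_right)
      also have "\<dots> = (\<Sum>e'\<in>H n. if e' = e then inner_L2 e u else 0)"
        using H(2)[of n] e O unfolding orthonormal_L2_def by (intro sum.cong) auto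
      finally show ?thesis using H(1) by simp
    qed
    moreover have "\<forall>\<^sub>F n in sequentially. (if e \<in> H n then inner_L2 e u else 0) = inner_L2 e u"
    proof (cases "\<exists>n. e \<in> H n")
      case True
      then obtain n where n: "e \<in> H n" by blast
      show ?thesis using eventually_ge_at_top[of n] by eventually_elim (use H(3) n in auto)
    qed (use zero e in auto)
    ultimately have "(\<lambda>n. inner_L2 e (p n)) \<longlonglongrightarrow> inner_L2 e u"
      using tendsto_eventually by fastforce
    moreover have "(\<lambda>n. inner_L2 e (p n)) \<longlonglongrightarrow> inner_L2 e v"
      by (intro inner_L2_tendsto L2B e p v)
    ultimately have "inner_L2 e u = inner_L2 e v" by (rule LIMSEQ_unique)
    thus ?thesis by (simp add: inner_L2_diff_right L2B e u v)
  qed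
  \<comment> \<open>The limit \<open>v\<close> has the same coefficients as \<open>u\<close> against
    every basis vector, so maximality of the basis identifies the two almost everywhere.\<close>
  hence ae: "AE x in lborel. u x - v x = 0"
    using B L2_diff[OF u v(1)] unfolding orthonormal_basis_L2_def by blast
  have "(\<lambda>n. inner_L2 u (p n)) \<longlonglongrightarrow> inner_L2 u v" by (intro inner_L2_tendsto u p v)
  also have "inner_L2 u v = inner_L2 u u"
    using ae u v by (intro inner_L2_cong_AE) (auto elim!: eventually_mono)
  also have "(\<lambda>n. inner_L2 u (p n)) = (\<lambda>n. of_real (sum ?a (H n)))"
    unfolding p_def using inner_L2_orthonormal_sum[OF HB H(1) u] by simp
  finally have "(\<lambda>n. sum ?a (H n)) \<longlonglongrightarrow> sqnorm u"
    by (simp only: inner_L2_self tendsto_of_real_iff)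
  hence "sqnorm u \<le> s" by (rule LIMSEQ_le_const2) (use sum_le[OF H(1,2)] in auto)
  moreover have "s \<le> sqnorm u" unfolding s_def by (rule Bessel_summable(2)[OF O u])
  ultimately show ?thesis using S by simp
qed

text \<open>\<open>fredholm_det\<close> picks its basis by \<open>SOME\<close>, so it has meaning
  only once a basis is known to exist. Zorn's lemma gives a maximal orthonormal set, and a nonzero
  vector orthogonal to it could be normalised and added. Working with functions instead of classes
  does no harm: two almost everywhere equal unit vectors have inner product 1 and cannot both belong
  to an orthonormal set.\<close>

lemma orthonormal_basis_L2_exists: "\<exists>B :: ('a::euclidean_space \<Rightarrow> complex) set. orthonormal_basis_L2 B"
proof -
  let ?A = "{B :: ('a \<Rightarrow> complex) set. orthonormal_L2 B}"
  have "\<exists>M\<in>?A. \<forall>X\<in>?A. M \<subseteq> X \<longrightarrow> X = M"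
  proof (rule subset_Zorn')
    fix C assume C: "subset.chain ?A C"
    have "\<exists>X\<in>C. e \<in> X \<and> e' \<in> X" if "e \<in> \<Union>C" "e' \<in> \<Union>C" for e e'
      using that C unfolding subset_chain_def by blast
    moreover have "\<And>X. X \<in> C \<Longrightarrow> orthonormal_L2 X" using C unfolding subset_chain_def by blast
    ultimately have "orthonormal_L2 (\<Union>C)" unfolding orthonormal_L2_def by meson
    thus "\<Union>C \<in> ?A" by simp
  qed
  then obtain M :: "('a \<Rightarrow> complex) set" where M: "orthonormal_L2 M" "\<And>X. orthonormal_L2 X \<Longrightarrow> M \<subseteq> X \<Longrightarrow> X = M"
    by auto
  have "AE x in lborel. u x = 0" if u: "L2 u" "\<forall>e\<in>M. inner_L2 e u = 0" for u
  proof (rule ccontr)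
    assume n: "\<not> (AE x in lborel. u x = 0)"
    have "sqnorm u \<noteq> 0" using n sqnorm_eq_0[OF u(1)] by blast
    hence pos: "0 < sqnorm u" using sqnorm_nonneg[of u] by linarith
    define c where "c = complex_of_real (1 / sqrt (sqnorm u))"
    define w where "w = (\<lambda>x. c * u x)"
    have w: "L2 w" unfolding w_def by (intro L2_cmult u)
    have "sqnorm w = 1" unfolding w_def sqnorm_cmult c_def using pos by (simp add: power_divide del: of_real_divide)
    hence ww: "inner_L2 w w = 1" by (simp add: inner_L2_self)
    have ew: "inner_L2 e w = 0" "inner_L2 w e = 0" if "e \<in> M" for e
      using u(2) that inner_L2_commute[of u e] by (simp_all add: w_def inner_L2_cmult_right inner_L2_cmult_left)
    have "w \<notin> M" using ww ew by auto
    moreover have "orthonormal_L2 (insert w M)"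
      using M(1) w ww ew \<open>w \<notin> M\<close> unfolding orthonormal_L2_def by auto
    ultimately show False using M(2)[of "insert w M"] by blast
  qed
  with M(1) have "orthonormal_basis_L2 M" unfolding orthonormal_basis_L2_def orthonormal_L2_def by blast
  thus ?thesis ..
qed

section \<open>Sums of principal minors\<close>

text \<open>Stated for a bare matrix, because the estimates below use only that it is Hermitian with
  entries bounded by the geometric mean of the diagonal ones.\<close>

definition leibniz_det :: "('i \<Rightarrow> 'i \<Rightarrow> complex) \<Rightarrow> 'i set \<Rightarrow> complex"
  where "leibniz_det k S = (\<Sum>\<pi> | \<pi> permutes S. of_int (sign \<pi>) * (\<Prod>e\<in>S. k e (\<pi> e)))"

lemma minor_L2_eq_leibniz_det: "minor_L2 T = leibniz_det (\<lambda>e e'. inner_L2 e (T e'))"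
  by (simp add: minor_L2_def leibniz_det_def fun_eq_iff)

lemma leibniz_det_empty: "leibniz_det k {} = 1"
  by (simp add: leibniz_det_def)

lemma leibniz_det_singleton: "leibniz_det k {a} = k a a"
  by (simp add: leibniz_det_def)

lemma leibniz_det_doubleton:
  assumes "a \<noteq> b"
  shows "leibniz_det k {a, b} = k a a * k b b - k a b * k b a"
proof -
  have "{\<pi>. \<pi> permutes {a, b}} = {id, Transposition.transpose a b}"
    by (auto simp: permutes_doubleton_iff)
  moreover have "id \<noteq> Transposition.transpose a b"
    using assms by (metis id_apply transpose_apply_first)
  ultimately show ?thesis
    using assms by (simp add: leibniz_det_def sign_swap_id)
qed

text \<open>In the term of \<pi> each entry is at most
  \<open>sqrt (a e) * sqrt (a (\<pi> e))\<close>, and reindexing by \<pi> turns the product of these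
  bounds into the product of the diagonal. The factorial counts the permutations; it is cancelled
  exactly by the one in \<open>elementary_symmetric_le\<close>.\<close>

lemma norm_leibniz_det_le:
  assumes S: "finite S" and a: "\<And>e. 0 \<le> a e" and k: "\<And>e e'. e \<in> S \<Longrightarrow> e' \<in> S \<Longrightarrow> (norm (k e e'))\<^sup>2 \<le> a e * a e'"
  shows "norm (leibniz_det k S) \<le> fact (card S) * (\<Prod>e\<in>S. a e)"
proof -
  have "norm (of_int (sign \<pi>) * (\<Prod>e\<in>S. k e (\<pi> e))) \<le> (\<Prod>e\<in>S. a e)" if p: "\<pi> permutes S" for \<pi>
  proof -
    have "norm (of_int (sign \<pi>) * (\<Prod>e\<in>S. k e (\<pi> e))) = (\<Prod>e\<in>S. norm (k e (\<pi> e)))"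
      by (cases \<pi> rule: sign_cases) (simp_all add: prod_norm)
    also have "\<dots> \<le> (\<Prod>e\<in>S. sqrt (a e) * sqrt (a (\<pi> e)))"
    proof (intro prod_mono conjI)
      fix e assume e: "e \<in> S"
      have "\<pi> e \<in> S" using p e by (simp add: permutes_in_image)
      thus "norm (k e (\<pi> e)) \<le> sqrt (a e) * sqrt (a (\<pi> e))"
        using k[OF e] by (simp add: real_sqrt_mult[symmetric] real_le_rsqrt)
    qed simp
    also have "\<dots> = (\<Prod>e\<in>S. sqrt (a e)) * (\<Prod>e\<in>S. sqrt (a (\<pi> e)))"
      by (rule prod.distrib)
    also have "(\<Prod>e\<in>S. sqrt (a (\<pi> e))) = (\<Prod>e\<in>S. sqrt (a e))"
      using prod.permute[OF p, of "\<lambda>e. sqrt (a e)"] by (simp add: o_def)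
    also have "(\<Prod>e\<in>S. sqrt (a e)) * (\<Prod>e\<in>S. sqrt (a e)) = (\<Prod>e\<in>S. a e)"
      using a by (simp add: prod.distrib[symmetric])
    finally show ?thesis .
  qed
  hence "norm (leibniz_det k S) \<le> of_nat (card {\<pi>. \<pi> permutes S}) * (\<Prod>e\<in>S. a e)"
    unfolding leibniz_det_def by (intro sum_norm_bound) auto
  thus ?thesis using S by (simp add: card_permutations)
qed

lemma sum_subsets_card_0: "finite B \<Longrightarrow> (\<Sum>S | S \<subseteq> B \<and> card S = 0. F S) = F {}"
proof -
  assume "finite B"
  hence "{S. S \<subseteq> B \<and> card S = 0} = {{}}" by (auto dest: finite_subset)
  thus ?thesis by simp
qed

text \<open>Subsets are sorted by whether they contain \<open>b\<close>; this is the induction step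
  for all sums over subsets of fixed cardinality.\<close>

lemma sum_subsets_insert:
  assumes "finite B" "b \<notin> B"
  shows "(\<Sum>S | S \<subseteq> insert b B \<and> card S = Suc n. F S)
    = (\<Sum>S | S \<subseteq> B \<and> card S = Suc n. F S) + (\<Sum>S | S \<subseteq> B \<and> card S = n. F (insert b S))"
proof -
  let ?I = "insert b ` {S. S \<subseteq> B \<and> card S = n}"
  have fin: "finite S" if "S \<subseteq> B" for S using that assms(1) by (rule finite_subset)
  have eq: "{S. S \<subseteq> insert b B \<and> card S = Suc n} = {S. S \<subseteq> B \<and> card S = Suc n} \<union> ?I"
  proof (intro equalityI subsetI)
    fix S assume S: "S \<in> {S. S \<subseteq> insert b B \<and> card S = Suc n}"
    show "S \<in> {S. S \<subseteq> B \<and> card S = Suc n} \<union> ?I"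
    proof (cases "b \<in> S")
      case True
      have "S = insert b (S - {b})" "S - {b} \<subseteq> B" "card (S - {b}) = n"
        using S True by auto
      thus ?thesis by blast
    qed (use S in auto)
  next
    fix S assume "S \<in> {S. S \<subseteq> B \<and> card S = Suc n} \<union> ?I"
    moreover have "card (insert b S) = Suc (card S)" if "S \<subseteq> B" for S
      using that assms(2) fin[OF that] by (subst card_insert_disjoint) auto
    ultimately show "S \<in> {S. S \<subseteq> insert b B \<and> card S = Suc n}" by auto
  qed
  have inj: "inj_on (insert b) {S. S \<subseteq> B \<and> card S = n}"
    using assms(2) by (auto simp: inj_on_def insert_ident subset_iff)
  have "(\<Sum>S | S \<subseteq> insert b B \<and> card S = Suc n. F S)
      = (\<Sum>S | S \<subseteq> B \<and> card S = Suc n. F S) + sum F ?I"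
    unfolding eq using assms by (intro sum.union_disjoint) auto
  also have "sum F ?I = (\<Sum>S | S \<subseteq> B \<and> card S = n. F (insert b S))"
    by (subst sum.reindex[OF inj]) (simp add: o_def)
  finally show ?thesis .
qed

lemma sum_subsets_empty: "(\<Sum>S | S \<subseteq> {} \<and> card S = Suc n. F S) = 0"
  by (rule sum.neutral) auto

lemma sum_subsets_card_1:
  assumes "finite B"
  shows "(\<Sum>S | S \<subseteq> B \<and> card S = 1. F S) = (\<Sum>e\<in>B. F {e})"
  using assms
proof (induction B rule: finite_induct)
  case empty
  show ?case by (simp only: One_nat_def sum_subsets_empty sum.empty)
next
  case (insert b B)
  thus ?case using sum_subsets_insert[OF insert(1,2), of F 0] by (simp add: sum_subsets_card_0 add.commute)
qed

lemma power_add_ge: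
  assumes "0 \<le> (t::real)" "0 \<le> s"
  shows "t ^ Suc n + real (Suc n) * s * t ^ n \<le> (t + s) ^ Suc n"
proof (induction n)
  case (Suc n)
  have "t ^ Suc (Suc n) + real (Suc (Suc n)) * s * t ^ Suc n
     \<le> (t + s) * (t ^ Suc n + real (Suc n) * s * t ^ n)"
    using assms by (simp add: algebra_simps)
  also have "\<dots> \<le> (t + s) * (t + s) ^ Suc n"
    using Suc assms by (intro mult_left_mono) auto
  finally show ?case by simp
qed simp

text \<open>Every product over n distinct indices occurs n! times when the n-th power of the sum is
  multiplied out. In the induction the new index contributes the second term of a binomial
  expansion, as in \<open>power_add_ge\<close>.\<close>

lemma elementary_symmetric_le:
  fixes a :: "'i \<Rightarrow> real"
  assumes B: "finite B" and a: "\<And>e. 0 \<le> a e"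
  shows "fact n * (\<Sum>S | S \<subseteq> B \<and> card S = n. \<Prod>e\<in>S. a e) \<le> (\<Sum>e\<in>B. a e) ^ n"
  using B
proof (induction B arbitrary: n rule: finite_induct)
  case empty
  show ?case
  proof (cases n)
    case (Suc m)
    show ?thesis unfolding Suc sum_subsets_empty by simp
  qed (simp add: sum_subsets_card_0 del: subset_empty)
next
  case (insert b B)
  show ?case
  proof (cases n)
    case 0
    thus ?thesis using insert by (simp add: sum_subsets_card_0)
  next
    case (Suc m)
    let ?E = "\<lambda>n. \<Sum>S | S \<subseteq> B \<and> card S = n. \<Prod>e\<in>S. a e"
    let ?t = "\<Sum>e\<in>B. a e"
    have "(\<Sum>S | S \<subseteq> B \<and> card S = m. \<Prod>e\<in>insert b S. a e)
        = (\<Sum>S | S \<subseteq> B \<and> card S = m. a b * (\<Prod>e\<in>S. a e))"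
      using insert(1,2) by (intro sum.cong refl prod.insert) (auto dest: finite_subset)
    hence "fact n * (\<Sum>S | S \<subseteq> insert b B \<and> card S = n. \<Prod>e\<in>S. a e)
       = fact (Suc m) * ?E (Suc m) + real (Suc m) * a b * (fact m * ?E m)"
      unfolding Suc sum_subsets_insert[OF insert(1,2)]
      by (simp add: sum_distrib_left algebra_simps)
    also have "\<dots> \<le> ?t ^ Suc m + real (Suc m) * a b * ?t ^ m"
      by (intro add_mono mult_left_mono insert.IH) (use a in auto)
    also have "\<dots> \<le> (?t + a b) ^ Suc m" by (intro power_add_ge sum_nonneg a)
    finally show ?thesis using insert(1,2) Suc by (simp add: add.commute)
  qed
qed

text \<open>The identity Tr \<Lambda>^2 K = ((Tr K)^2 - Tr K^2) / 2. The diagonal terms cancel, so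
  the double sum may run over all pairs and becomes the squared Hilbert-Schmidt norm.\<close>

lemma sum_leibniz_det_card_2:
  assumes B: "finite B" and k: "\<And>e. k e e = of_real (a e)" and herm: "\<And>e e'. k e' e = cnj (k e e')"
  shows "(\<Sum>S | S \<subseteq> B \<and> card S = 2. leibniz_det k S)
    = of_real (((\<Sum>e\<in>B. a e)\<^sup>2 - (\<Sum>e\<in>B. \<Sum>e'\<in>B. (norm (k e e'))\<^sup>2)) / 2)"
  using B
proof (induction B rule: finite_induct)
  case empty
  show ?case by (simp only: numeral_2_eq_2 sum_subsets_empty sum.empty) simp
next
  case (insert b B)
  have n: "(\<Sum>e\<in>B. (norm (k e b))\<^sup>2) = (\<Sum>e\<in>B. (norm (k b e))\<^sup>2)"
  proof (intro sum.cong refl)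
    show "(norm (k e b))\<^sup>2 = (norm (k b e))\<^sup>2" for e by (subst herm) simp
  qed
  have kb: "(norm (k b b))\<^sup>2 = (a b)\<^sup>2" by (simp add: k)
  have "(\<Sum>S | S \<subseteq> insert b B \<and> card S = 2. leibniz_det k S)
     = (\<Sum>S | S \<subseteq> B \<and> card S = 2. leibniz_det k S) + (\<Sum>S | S \<subseteq> B \<and> card S = 1. leibniz_det k (insert b S))"
    using sum_subsets_insert[OF insert(1,2), of "leibniz_det k" 1] by (simp add: numeral_2_eq_2)
  also have "(\<Sum>S | S \<subseteq> B \<and> card S = 1. leibniz_det k (insert b S)) = (\<Sum>e\<in>B. leibniz_det k {b, e})"
    by (rule sum_subsets_card_1[OF insert(1)])
  also have "\<dots> = (\<Sum>e\<in>B. of_real (a b * a e - (norm (k b e))\<^sup>2))"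
  proof (intro sum.cong refl)
    fix e assume "e \<in> B"
    hence "b \<noteq> e" using insert(2) by auto
    moreover have "k b e * k e b = of_real ((norm (k b e))\<^sup>2)"
      unfolding complex_norm_square herm[of b e] by simp
    ultimately show "leibniz_det k {b, e} = of_real (a b * a e - (norm (k b e))\<^sup>2)"
      by (simp add: leibniz_det_doubleton k)
  qed
  also have "\<dots> = of_real (a b * (\<Sum>e\<in>B. a e) - (\<Sum>e\<in>B. (norm (k b e))\<^sup>2))"
    by (simp add: sum_subtractf sum_distrib_left)
  finally show ?case
    unfolding insert.IH of_real_add[symmetric] of_real_eq_iff sum.insert[OF insert(1,2)] sum.distrib n kb power2_sum
    by (simp add: diff_divide_distrib add_divide_distrib)
qed

text \<open>Subsets are graded by cardinality: levels 0, 1 and 2 are explicit, level n is at most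
  \<open>T ^ n\<close>, and the levels from 3 on form a geometric tail. The second bound does not
  depend on the size of \<open>B\<close> and yields absolute summability over infinite index
  sets.\<close>

lemma sum_leibniz_det_approx:
  assumes B: "finite B" and k: "\<And>e. k e e = of_real (a e)" and herm: "\<And>e e'. k e' e = cnj (k e e')"
    and CS: "\<And>e e'. (norm (k e e'))\<^sup>2 \<le> a e * a e'" and a: "\<And>e. 0 \<le> a e"
    and T: "(\<Sum>e\<in>B. a e) = T" "T < 1"
  shows "norm ((\<Sum>S\<in>Pow B. leibniz_det k S)
      - of_real (1 + T + (T\<^sup>2 - (\<Sum>e\<in>B. \<Sum>e'\<in>B. (norm (k e e'))\<^sup>2)) / 2)) \<le> T ^ 3 / (1 - T)"
    and "(\<Sum>S\<in>Pow B. norm (leibniz_det k S)) \<le> 1 / (1 - T)"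
proof -
  have T0: "0 \<le> T" using sum_nonneg[of B a] a T(1) by simp
  define D where "D n = (\<Sum>S | S \<subseteq> B \<and> card S = n. leibniz_det k S)" for n
  have D': "(\<Sum>S | S \<subseteq> B \<and> card S = n. norm (leibniz_det k S)) \<le> T ^ n" for n
  proof -
    have "(\<Sum>S | S \<subseteq> B \<and> card S = n. norm (leibniz_det k S))
        \<le> (\<Sum>S | S \<subseteq> B \<and> card S = n. fact n * (\<Prod>e\<in>S. a e))"
    proof (rule sum_mono)
      fix S assume S: "S \<in> {S. S \<subseteq> B \<and> card S = n}"
      hence "finite S" using B finite_subset by blast
      from norm_leibniz_det_le[of S a k, OF this a CS]
      show "norm (leibniz_det k S) \<le> fact n * (\<Prod>e\<in>S. a e)" using S by simp
    qed
    also have "\<dots> \<le> T ^ n"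
      using elementary_symmetric_le[of B a n, OF B a] unfolding T(1) by (simp only: sum_distrib_left)
    finally show ?thesis .
  qed
  have D: "norm (D n) \<le> T ^ n" for n
    unfolding D_def by (rule order_trans[OF norm_sum D'])
  \<comment> \<open>Levels above \<open>card B\<close> are empty. Going up to
    \<open>card B + 2\<close> allows the levels 0, 1, 2 to be split off even when \<open>B\<close>
    has fewer than two elements.\<close>
  have Pow: "(\<Sum>S\<in>Pow B. F S) = (\<Sum>n\<le>card B + 2. \<Sum>S | S \<subseteq> B \<and> card S = n. F S)" for F :: "_ \<Rightarrow> 'b::comm_monoid_add"
  proof -
    have "card ` Pow B \<subseteq> {..card B + 2}" by (meson B PowD atMost_iff card_mono image_subsetI le_add1 order_trans)
    from sum.group[OF _ _ this, of F] show ?thesis using B by (simp add: Pow_def)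
  qed
  have geo: "(\<Sum>n\<le>m. T ^ (n + j)) \<le> T ^ j / (1 - T)" for m j
  proof -
    have "(\<Sum>n\<le>m. T ^ (n + j)) = T ^ j * (\<Sum>n\<le>m. T ^ n)"
      by (simp add: power_add sum_distrib_left mult.commute)
    also have "\<dots> \<le> T ^ j * (1 / (1 - T))"
      using T0 T(2) by (intro mult_left_mono) (auto simp: sum_gp0 divide_right_mono)
    finally show ?thesis by simp
  qed
  have split: "{..card B + 2} = {0, 1, 2} \<union> {3..card B + 2}" by auto
  have "(\<Sum>S\<in>Pow B. leibniz_det k S) = D 0 + D 1 + D 2 + (\<Sum>n\<in>{3..card B + 2}. D n)"
    unfolding Pow D_def[symmetric] by (subst split, subst sum.union_disjoint) (auto simp: ac_simps)
  moreover have "D 0 + D 1 + D 2 = of_real (1 + T + (T\<^sup>2 - (\<Sum>e\<in>B. \<Sum>e'\<in>B. (norm (k e e'))\<^sup>2)) / 2)"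
    unfolding D_def sum_leibniz_det_card_2[OF B k herm] sum_subsets_card_1[OF B] sum_subsets_card_0[OF B]
    by (simp add: leibniz_det_empty leibniz_det_singleton k T(1)[symmetric])
  ultimately have "norm ((\<Sum>S\<in>Pow B. leibniz_det k S)
      - of_real (1 + T + (T\<^sup>2 - (\<Sum>e\<in>B. \<Sum>e'\<in>B. (norm (k e e'))\<^sup>2)) / 2)) = norm (\<Sum>n\<in>{3..card B + 2}. D n)"
    by simp
  also have "\<dots> \<le> (\<Sum>n\<in>{3..card B + 2}. T ^ n)" by (intro sum_norm_le D)
  also have "\<dots> \<le> (\<Sum>n\<in>{3..card B + 3}. T ^ n)" using T0 by (intro sum_mono2) auto
  also have "\<dots> = (\<Sum>n\<le>card B. T ^ (n + 3))" 
    by (rule sum.reindex_bij_witness[of _ "\<lambda>n. n + 3" "\<lambda>n. n - 3"]) auto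
  also have "\<dots> \<le> T ^ 3 / (1 - T)" by (rule geo)
  finally show "norm ((\<Sum>S\<in>Pow B. leibniz_det k S)
      - of_real (1 + T + (T\<^sup>2 - (\<Sum>e\<in>B. \<Sum>e'\<in>B. (norm (k e e'))\<^sup>2)) / 2)) \<le> T ^ 3 / (1 - T)" .
  have "(\<Sum>S\<in>Pow B. norm (leibniz_det k S)) \<le> (\<Sum>n\<le>card B + 2. T ^ n)"
    unfolding Pow by (intro sum_mono D')
  also have "\<dots> \<le> 1 / (1 - T)" using geo[of 0 "card B + 2"] by (simp only: power_0 add_0_right)
  finally show "(\<Sum>S\<in>Pow B. norm (leibniz_det k S)) \<le> 1 / (1 - T)" .
qed

text \<open>A finite set \<open>X\<close> of finite subsets of \<open>B\<close> lies in
  \<open>Pow Y\<close> as soon as \<open>Y\<close> contains its union. Hence an infinite sum over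
  \<open>Fpow B\<close> may be computed along the power sets of finite \<open>Y\<close>, where the
  finite-dimensional estimates apply.\<close>

lemma filterlim_Pow_finite_subsets:
  "filterlim Pow (finite_subsets_at_top (Fpow B)) (finite_subsets_at_top B)"
  unfolding filterlim_def le_filter_def eventually_filtermap
proof (intro allI impI)
  fix P assume "eventually P (finite_subsets_at_top (Fpow B))"
  then obtain X where X: "finite X" "X \<subseteq> Fpow B" "\<And>Y. finite Y \<Longrightarrow> X \<subseteq> Y \<Longrightarrow> Y \<subseteq> Fpow B \<Longrightarrow> P Y"
    by (auto simp: eventually_finite_subsets_at_top)
  have "P (Pow Y)" if "finite Y" "\<Union>X \<subseteq> Y" "Y \<subseteq> B" for Y
  proof (rule X(3))
    show "X \<subseteq> Pow Y" using that(2) by blast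
    show "Pow Y \<subseteq> Fpow B"
    proof
      fix S assume "S \<in> Pow Y"
      thus "S \<in> Fpow B" using that(3) finite_subset[OF _ that(1), of S] by (auto simp: Fpow_def)
    qed
  qed (use that(1) in simp)
  moreover have "finite (\<Union>X)" "\<Union>X \<subseteq> B" using X(1,2) by (auto simp: Fpow_def)
  ultimately show "eventually (\<lambda>x. P (Pow x)) (finite_subsets_at_top B)"
    unfolding eventually_finite_subsets_at_top by blast
qed

text \<open>The estimates for finite \<open>F\<close> pass to the limit. The upper bound discards
  the nonnegative Tr K^2, the lower bound replaces it by its bound \<open>c\<close>.\<close>

lemma infsum_leibniz_det_bounds:
  assumes k: "\<And>e. k e e = of_real (a e)" and herm: "\<And>e e'. k e' e = cnj (k e e')"
    and CS: "\<And>e e'. (norm (k e e'))\<^sup>2 \<le> a e * a e'" and a: "\<And>e. 0 \<le> a e"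
    and T: "(a has_sum T) B" "T < 1"
    and Q: "\<And>F. finite F \<Longrightarrow> F \<subseteq> B \<Longrightarrow> (\<Sum>e\<in>F. \<Sum>e'\<in>F. (norm (k e e'))\<^sup>2) \<le> c"
  shows "norm (\<Sum>\<^sub>\<infinity>S\<in>Fpow B. leibniz_det k S) \<le> 1 + T + T\<^sup>2 / 2 + T ^ 3 / (1 - T)" (is ?upper)
    and "1 + T + (T\<^sup>2 - c) / 2 - T ^ 3 / (1 - T) \<le> norm (\<Sum>\<^sub>\<infinity>S\<in>Fpow B. leibniz_det k S)" (is ?lower)
proof -
  let ?F = "finite_subsets_at_top B"
  let ?D = "\<lambda>F. \<Sum>S\<in>Pow F. leibniz_det k S"
  have le_T: "sum a F \<le> T" if "finite F" "F \<subseteq> B" for F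
    by (rule finite_sum_le_has_sum[OF T(1) that a])
  have "(\<lambda>S. norm (leibniz_det k S)) summable_on Fpow B"
  proof (rule nonneg_bdd_above_summable_on)
    show "bdd_above (sum (\<lambda>x. norm (leibniz_det k x)) ` {F. F \<subseteq> Fpow B \<and> finite F})"
    proof (rule bdd_aboveI2)
      fix F assume F: "F \<in> {F. F \<subseteq> Fpow B \<and> finite F}"
      \<comment> \<open>Any finite family of index sets is contained in the power set of its union,
        so the uniform bound for power sets also bounds its sum.\<close>
      have fin: "finite (\<Union>F)" "\<Union>F \<subseteq> B" using F by (auto simp: Fpow_def)
      have "(\<Sum>x\<in>F. norm (leibniz_det k x)) \<le> (\<Sum>x\<in>Pow (\<Union>F). norm (leibniz_det k x))"
        using fin by (intro sum_mono2) auto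
      also have "\<dots> \<le> 1 / (1 - sum a (\<Union>F))"
        using le_T[OF fin] T(2) by (intro sum_leibniz_det_approx(2)[of "\<Union>F" k a "sum a (\<Union>F)", OF fin(1) k herm CS a refl]) auto
      also have "\<dots> \<le> 1 / (1 - T)" using le_T[OF fin] T(2) by (simp add: field_simps)
      finally show "(\<Sum>x\<in>F. norm (leibniz_det k x)) \<le> 1 / (1 - T)" .
    qed
  qed auto
  hence "leibniz_det k summable_on Fpow B" by (rule abs_summable_summable)
  hence "(sum (leibniz_det k) \<longlongrightarrow> (\<Sum>\<^sub>\<infinity>S\<in>Fpow B. leibniz_det k S)) (finite_subsets_at_top (Fpow B))"
    by (simp only: summable_iff_has_sum_infsum has_sum_def)
  hence D: "(?D \<longlongrightarrow> (\<Sum>\<^sub>\<infinity>S\<in>Fpow B. leibniz_det k S)) ?F"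
    by (rule filterlim_compose[OF _ filterlim_Pow_finite_subsets])
  have Tl: "(sum a \<longlongrightarrow> T) ?F" using T(1) by (simp add: has_sum_def)
  have ev: "\<forall>\<^sub>F F in ?F. finite F \<and> F \<subseteq> B" by (rule eventually_finite_subsets_at_top_weakI) simp
  show ?upper
  proof (rule tendsto_le[OF _ _ tendsto_norm[OF D]])
    let ?r = "\<lambda>F. 1 + sum a F + (sum a F)\<^sup>2 / 2 + sum a F ^ 3 / (1 - sum a F)"
    show "(?r \<longlongrightarrow> 1 + T + T\<^sup>2 / 2 + T ^ 3 / (1 - T)) ?F" 
      by (rule isCont_tendsto_compose[OF _ Tl, of "\<lambda>t. 1 + t + t\<^sup>2 / 2 + t ^ 3 / (1 - t)"])
        (use T(2) in \<open>auto intro!: continuous_intros\<close>)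
    show "\<forall>\<^sub>F F in ?F. norm (?D F) \<le> ?r F"
      using ev
    proof eventually_elim
      case (elim F)
      let ?t = "sum a F" and ?q = "\<Sum>e\<in>F. \<Sum>e'\<in>F. (norm (k e e'))\<^sup>2"
      have t: "0 \<le> ?t" "?t < 1" using le_T[of F] elim T(2) a by (auto intro!: sum_nonneg)
      have "?q \<le> (\<Sum>e\<in>F. \<Sum>e'\<in>F. a e * a e')" by (intro sum_mono CS)
      hence q: "0 \<le> ?q" "?q \<le> ?t\<^sup>2" by (auto intro!: sum_nonneg simp: power2_eq_square sum_product)
      have "norm (?D F) \<le> norm (of_real (1 + ?t + (?t\<^sup>2 - ?q) / 2) :: complex) + ?t ^ 3 / (1 - ?t)"
        using norm_triangle_sub[of "?D F" "of_real (1 + ?t + (?t\<^sup>2 - ?q) / 2)"]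
          sum_leibniz_det_approx(1)[of F k a ?t, OF _ k herm CS a refl t(2)] elim by simp
      thus ?case using q t unfolding norm_of_real by (simp add: diff_divide_distrib)
    qed
  qed simp
  show ?lower
  proof (rule tendsto_le[OF _ tendsto_norm[OF D]])
    let ?r = "\<lambda>F. 1 + sum a F + ((sum a F)\<^sup>2 - c) / 2 - sum a F ^ 3 / (1 - sum a F)"
    show "(?r \<longlongrightarrow> 1 + T + (T\<^sup>2 - c) / 2 - T ^ 3 / (1 - T)) ?F" 
      by (rule isCont_tendsto_compose[OF _ Tl, of "\<lambda>t. 1 + t + (t\<^sup>2 - c) / 2 - t ^ 3 / (1 - t)"])
        (use T(2) in \<open>auto intro!: continuous_intros\<close>)
    show "\<forall>\<^sub>F F in ?F. ?r F \<le> norm (?D F)"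
      using ev
    proof eventually_elim
      case (elim F)
      let ?t = "sum a F" and ?q = "\<Sum>e\<in>F. \<Sum>e'\<in>F. (norm (k e e'))\<^sup>2"
      have t: "?t < 1" using le_T[of F] elim T(2) by simp
      have "norm (of_real (1 + ?t + (?t\<^sup>2 - ?q) / 2) :: complex) \<le> norm (?D F) + ?t ^ 3 / (1 - ?t)"
        using norm_triangle_sub[of "of_real (1 + ?t + (?t\<^sup>2 - ?q) / 2)" "?D F"]
          sum_leibniz_det_approx(1)[of F k a ?t, OF _ k herm CS a refl t] elim
        by (simp add: norm_minus_commute)
      hence "1 + ?t + (?t\<^sup>2 - ?q) / 2 \<le> norm (?D F) + ?t ^ 3 / (1 - ?t)"
        unfolding norm_of_real by (rule order_trans[OF abs_ge_self])
      moreover have "?q \<le> c" using Q elim by simp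
      ultimately show ?case by (simp add: diff_divide_distrib)
    qed
  qed simp
qed

section \<open>Gaussian integrals and Plancherel's theorem\<close>

lemma nn_integral_lborel_affine:
  fixes t :: "'a::euclidean_space"
  assumes [measurable]: "f \<in> borel_measurable borel" and c: "c \<noteq> 0"
  shows "(\<integral>\<^sup>+x. f x \<partial>lborel) = ennreal (\<bar>c\<bar> ^ DIM('a)) * (\<integral>\<^sup>+x. f (t + c *\<^sub>R x) \<partial>lborel)"
  by (subst lborel_affine[OF c, of t])
    (simp add: nn_integral_density nn_integral_distr nn_integral_cmult ennreal_power)

lemma integrable_lborel_affine:
  fixes f :: "'a::euclidean_space \<Rightarrow> 'b::{banach, second_countable_topology}"
  assumes f: "integrable lborel f" and c: "c \<noteq> 0"
  shows "integrable lborel (\<lambda>x. f (t + c *\<^sub>R x))"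
proof -
  have [measurable]: "f \<in> borel_measurable borel" using f by simp
  show ?thesis
    using f c unfolding integrable_iff_bounded
    by (subst (asm) nn_integral_lborel_affine[OF _ c, where t=t]) (auto simp: ennreal_mult_less_top)
qed

lemma integral_lborel_affine:
  fixes f :: "'a::euclidean_space \<Rightarrow> 'b::{banach, second_countable_topology}"
  assumes [measurable]: "f \<in> borel_measurable borel" and c: "c \<noteq> 0"
  shows "(\<integral>x. f x \<partial>lborel) = \<bar>c\<bar> ^ DIM('a) *\<^sub>R (\<integral>x. f (t + c *\<^sub>R x) \<partial>lborel)"
  using c by (subst lborel_affine[OF c, of t])
    (simp add: integral_density integral_distr)

lemma AE_lborel_affine:
  fixes P :: "'a::euclidean_space \<Rightarrow> bool"
  assumes P: "AE x in lborel. P x" and c: "c \<noteq> 0"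
  shows "AE x in lborel. P (t + c *\<^sub>R x)"
proof -
  obtain N where N': "{x \<in> space lborel. \<not> P x} \<subseteq> N" "emeasure lborel N = 0" "N \<in> sets lborel"
    using AE_E[OF P] .
  hence N: "{x. \<not> P x} \<subseteq> N" "N \<in> sets borel" "emeasure lborel N = 0" by simp_all
  note [measurable] = N(2)
  have "(\<integral>\<^sup>+x. indicator N x \<partial>lborel)
      = ennreal (\<bar>c\<bar> ^ DIM('a)) * (\<integral>\<^sup>+x. indicator N (t + c *\<^sub>R x) \<partial>lborel)"
    by (rule nn_integral_lborel_affine[OF _ c]) measurable
  hence "(\<integral>\<^sup>+x. indicator N (t + c *\<^sub>R x) \<partial>lborel) = (0::ennreal)"
    using N(3) c by simp
  hence "AE x in lborel. indicator N (t + c *\<^sub>R x) = (0::ennreal)"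
    by (subst (asm) nn_integral_0_iff_AE) auto
  thus ?thesis
    by eventually_elim (use N(1) in \<open>auto simp: indicator_def split: if_splits\<close>)
qed

text \<open>Up to the factor \<open>sqrt (2 * pi)\<close> the integrand is the standard normal
  density, so the value is read off from its characteristic function.\<close>

lemma gaussian_fourier_1d:
  fixes t :: real
  shows "integrable lborel (\<lambda>x. of_real (exp (- x\<^sup>2 / 2)) * cis (t * x))" (is ?int)
    and "(\<integral>x. of_real (exp (- x\<^sup>2 / 2)) * cis (t * x) \<partial>lborel) = of_real (sqrt (2 * pi) * exp (- t\<^sup>2 / 2))"
proof -
  have *: "of_real (exp (- x\<^sup>2 / 2)) * cis (t * x) = sqrt (2 * pi) *\<^sub>R (std_normal_density x *\<^sub>R iexp (t * x))" for x
    by (simp add: std_normal_density_def scaleR_conv_of_real cis_conv_exp)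
  have [measurable]: "(\<lambda>x. iexp (t * x)) \<in> borel_measurable borel"
    by (intro borel_measurable_continuous_onI continuous_intros)
  have "integrable lborel (\<lambda>x. std_normal_density x *\<^sub>R iexp (t * x))"
  proof (rule Bochner_Integration.integrable_bound)
    show "integrable lborel std_normal_density" by (rule integrable_normal_density) simp
  qed (auto simp: norm_mult)
  thus ?int unfolding * by (intro integrable_scaleR_right)
  have "(\<integral>x. std_normal_density x *\<^sub>R iexp (t * x) \<partial>lborel) = char std_normal_distribution t"
    unfolding char_def by (rule integral_density[symmetric]) auto
  also have "\<dots> = of_real (exp (- t\<^sup>2 / 2))"
    by (simp add: char_std_normal_distribution)
  finally show "(\<integral>x. of_real (exp (- x\<^sup>2 / 2)) * cis (t * x) \<partial>lborel) = of_real (sqrt (2 * pi) * exp (- t\<^sup>2 / 2))"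
    unfolding * by (simp add: scaleR_conv_of_real)
qed

lemma cis_sum: "finite A \<Longrightarrow> cis (\<Sum>i\<in>A. f i) = (\<Prod>i\<in>A. cis (f i))"
  by (induction A rule: finite_induct) (auto simp: cis_mult[symmetric])

text \<open>Both the Gaussian and the character factor over coordinates, and Lebesgue measure is the
  image of a product measure over \<open>Basis\<close>.\<close>

lemma gaussian_fourier:
  fixes z :: "'a::euclidean_space"
  shows "integrable lborel (\<lambda>p. of_real (exp (- (norm p)\<^sup>2 / 2)) * cis (p \<bullet> z))" (is ?int)
    and "(\<integral>p. of_real (exp (- (norm p)\<^sup>2 / 2)) * cis (p \<bullet> z) \<partial>lborel)
      = of_real (sqrt (2 * pi) ^ DIM('a) * exp (- (norm z)\<^sup>2 / 2))"
proof -
  interpret product_sigma_finite "\<lambda>_::'a. lborel :: real measure" by standard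
  let ?f = "\<lambda>p::'a. complex_of_real (exp (- (norm p)\<^sup>2 / 2)) * cis (p \<bullet> z)"
  let ?h = "\<lambda>b x. complex_of_real (exp (- x\<^sup>2 / 2)) * cis ((z \<bullet> b) * x)"
  have norm: "exp (- (norm p)\<^sup>2 / 2) = (\<Prod>b\<in>Basis. exp (- (p \<bullet> b)\<^sup>2 / 2))" for p :: 'a
  proof -
    have "(norm p)\<^sup>2 = (\<Sum>b\<in>Basis. (p \<bullet> b)\<^sup>2)"
      by (subst euclidean_inner[of p p, folded power2_norm_eq_inner]) (simp add: power2_eq_square)
    thus ?thesis by (simp add: exp_sum[symmetric] sum_negf sum_divide_distrib)
  qed
  have f: "?f p = (\<Prod>b\<in>Basis. ?h b (p \<bullet> b))" for p
    unfolding norm prod.distrib of_real_prod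
    by (subst euclidean_inner[of p z]) (simp add: cis_sum mult.commute)
  have m: "(\<lambda>f. \<Sum>b\<in>Basis. f b *\<^sub>R b) \<in> Pi\<^sub>M Basis (\<lambda>_. lborel) \<rightarrow>\<^sub>M (borel :: 'a measure)"
    by measurable
  have fm: "?f \<in> borel_measurable borel"
    by (intro borel_measurable_continuous_onI continuous_intros) auto
  have comp: "?f (\<Sum>b\<in>Basis. g b *\<^sub>R b) = (\<Prod>b\<in>Basis. ?h b (g b))" for g :: "'a \<Rightarrow> real"
    unfolding f by (intro prod.cong refl) (simp add: inner_sum_left inner_Basis if_distrib[of "\<lambda>x. _ * x"] cong: if_cong)
  have "integrable (Pi\<^sub>M Basis (\<lambda>_. lborel)) (\<lambda>g. \<Prod>b\<in>Basis. ?h b (g b))"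
    by (intro product_integrable_prod gaussian_fourier_1d) auto
  thus ?int by (subst lborel_eq) (simp only: integrable_distr_eq[OF m fm] comp)
  have "(\<integral>p. ?f p \<partial>lborel) = (\<integral>g. (\<Prod>b\<in>Basis. ?h b (g b)) \<partial>Pi\<^sub>M Basis (\<lambda>_. lborel))"
    by (subst lborel_eq) (simp only: integral_distr[OF m fm] comp)
  also have "\<dots> = (\<Prod>b\<in>Basis. \<integral>x. ?h b x \<partial>lborel)"
    by (intro product_integral_prod gaussian_fourier_1d) auto
  also have "\<dots> = (\<Prod>b\<in>Basis. of_real (sqrt (2 * pi) * exp (- (z \<bullet> b)\<^sup>2 / 2)))"
    by (simp only: gaussian_fourier_1d)
  also have "\<dots> = of_real (sqrt (2 * pi) ^ DIM('a) * exp (- (norm z)\<^sup>2 / 2))"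
    unfolding norm of_real_prod[symmetric] prod.distrib by simp
  finally show "(\<integral>p. ?f p \<partial>lborel) = of_real (sqrt (2 * pi) ^ DIM('a) * exp (- (norm z)\<^sup>2 / 2))" .
qed

lemma gaussian_integral:
  fixes \<sigma> :: real
  assumes \<sigma>: "0 < \<sigma>"
  shows "integrable lborel (\<lambda>p::'a::euclidean_space. exp (- (\<sigma> * norm p)\<^sup>2 / 2))" (is ?int)
    and "(\<integral>p. exp (- (\<sigma> * norm (p::'a))\<^sup>2 / 2) \<partial>lborel) = (sqrt (2 * pi) / \<sigma>) ^ DIM('a)"
proof -
  have r: "cis (p \<bullet> 0) = 1" for p :: 'a by simp
  have i1: "integrable lborel (\<lambda>p::'a. exp (- (norm p)\<^sup>2 / 2))"
    using gaussian_fourier(1)[of "0::'a"] unfolding r by (simp only: mult_1_right complex_of_real_integrable_eq)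
  from integrable_lborel_affine[OF this, of \<sigma> 0] show ?int
    using \<sigma> by simp
  have "complex_of_real (\<integral>p. exp (- (norm (p::'a))\<^sup>2 / 2) \<partial>lborel) = of_real (sqrt (2 * pi) ^ DIM('a))"
    using gaussian_fourier(2)[of "0::'a"] unfolding r by (simp only: mult_1_right integral_complex_of_real) simp
  hence "(\<integral>p. exp (- (norm (p::'a))\<^sup>2 / 2) \<partial>lborel) = sqrt (2 * pi) ^ DIM('a)"
    by (simp only: of_real_eq_iff)
  also have "(\<integral>p. exp (- (norm (p::'a))\<^sup>2 / 2) \<partial>lborel)
      = \<bar>\<sigma>\<bar> ^ DIM('a) *\<^sub>R (\<integral>p. exp (- (norm (0 + \<sigma> *\<^sub>R p :: 'a))\<^sup>2 / 2) \<partial>lborel)"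
    using \<sigma> by (intro integral_lborel_affine) auto
  finally show "(\<integral>p. exp (- (\<sigma> * norm (p::'a))\<^sup>2 / 2) \<partial>lborel) = (sqrt (2 * pi) / \<sigma>) ^ DIM('a)"
    using \<sigma> by (simp add: power_divide field_simps)
qed

lemma gaussian_fourier_scaled:
  fixes x :: "'a::euclidean_space"
  assumes \<sigma>: "0 < \<sigma>"
  shows "(\<integral>p. cis (p \<bullet> x) * of_real (exp (- (\<sigma> * norm p)\<^sup>2 / 2)) \<partial>lborel)
    = of_real ((sqrt (2 * pi) / \<sigma>) ^ DIM('a) * exp (- (norm x / \<sigma>)\<^sup>2 / 2))"
proof -
  let ?f = "\<lambda>p::'a. complex_of_real (exp (- (norm p)\<^sup>2 / 2)) * cis (p \<bullet> (x /\<^sub>R \<sigma>))"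
  have m: "?f \<in> borel_measurable borel" by (intro borel_measurable_continuous_onI continuous_intros) auto
  have eq: "?f (0 + \<sigma> *\<^sub>R p) = cis (p \<bullet> x) * of_real (exp (- (\<sigma> * norm p)\<^sup>2 / 2))" for p
    using \<sigma> by (simp add: field_simps)
  have "of_real (sqrt (2 * pi) ^ DIM('a) * exp (- (norm (x /\<^sub>R \<sigma>))\<^sup>2 / 2))
     = \<sigma> ^ DIM('a) *\<^sub>R (\<integral>p. ?f (0 + \<sigma> *\<^sub>R p) \<partial>lborel)"
    using \<sigma> integral_lborel_affine[OF m, of \<sigma> 0] unfolding gaussian_fourier by simp
  hence "(\<integral>p. cis (p \<bullet> x) * of_real (exp (- (\<sigma> * norm p)\<^sup>2 / 2)) \<partial>lborel)
     = of_real (sqrt (2 * pi) ^ DIM('a) * exp (- (norm (x /\<^sub>R \<sigma>))\<^sup>2 / 2)) / of_real (\<sigma> ^ DIM('a))"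
    unfolding eq using \<sigma> by (simp add: scaleR_conv_of_real)
  moreover have "norm (x /\<^sub>R \<sigma>) = norm x / \<sigma>" using \<sigma> by (simp add: divide_inverse mult.commute)
  ultimately show ?thesis by (simp add: power_divide)
qed

text \<open>The Fourier integral without its norming constant. The forward transform is
  \<open>s = - 1\<close> and the inverse one \<open>s = 1\<close>, so that each estimate is proved
  once for both signs.\<close>

definition ft :: "real \<Rightarrow> ('a::euclidean_space \<Rightarrow> complex) \<Rightarrow> 'a \<Rightarrow> complex"
  where "ft s h p = (\<integral>x. cis (s * (p \<bullet> x)) * h x \<partial>lborel)"

lemma cis_measurable[measurable]: "cis \<in> borel_measurable borel"
  by (intro borel_measurable_continuous_onI continuous_intros)

lemma integrable_cis_mult:
  assumes "integrable M h" "f \<in> borel_measurable M"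
  shows "integrable M (\<lambda>x. cis (f x) * h x)"
proof (rule Bochner_Integration.integrable_bound[OF assms(1)])
  show "(\<lambda>x. cis (f x) * h x) \<in> borel_measurable M"
    using assms borel_measurable_integrable[OF assms(1)] by measurable
qed (simp add: norm_mult)

lemma ft_integrable: "integrable lborel h \<Longrightarrow> integrable lborel (\<lambda>x. cis (s * (p \<bullet> x)) * h x)"
  by (rule integrable_cis_mult) auto

lemma norm_ft_le: "integrable lborel h \<Longrightarrow> norm (ft s h p) \<le> (\<integral>x. norm (h x) \<partial>lborel)"
  unfolding ft_def using integral_norm_bound[of lborel "\<lambda>x. cis (s * (p \<bullet> x)) * h x"]
  by (simp add: norm_mult)

lemma isCont_ft:
  assumes h: "integrable lborel h"
  shows "isCont (ft s h) p"
  unfolding continuous_at_sequentially comp_def ft_def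
proof (intro allI impI)
  fix X :: "nat \<Rightarrow> 'a" assume X: "X \<longlonglongrightarrow> p"
  note [measurable] = borel_measurable_integrable[OF h]
  show "(\<lambda>n. \<integral>x. cis (s * (X n \<bullet> x)) * h x \<partial>lborel) \<longlonglongrightarrow> (\<integral>x. cis (s * (p \<bullet> x)) * h x \<partial>lborel)"
  proof (rule integral_dominated_convergence[where w="\<lambda>x. norm (h x)"])
    show "AE x in lborel. (\<lambda>n. cis (s * (X n \<bullet> x)) * h x) \<longlonglongrightarrow> cis (s * (p \<bullet> x)) * h x"
      by (intro AE_I2 tendsto_intros X)
  qed (use h in \<open>auto simp: norm_mult\<close>)
qed

lemma borel_measurable_ft[measurable]: "integrable lborel h \<Longrightarrow> ft s h \<in> borel_measurable borel"
  by (intro borel_measurable_continuous_onI continuous_at_imp_continuous_on ballI isCont_ft)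

lemma integrable_mult_ft:
  assumes "integrable lborel k" "integrable lborel h"
  shows "integrable lborel (\<lambda>p. k p * ft s h p)"
proof (rule Bochner_Integration.integrable_bound)
  show "integrable lborel (\<lambda>p. (\<integral>x. norm (h x) \<partial>lborel) * norm (k p))"
    using assms by simp
  show "(\<lambda>p. k p * ft s h p) \<in> borel_measurable lborel"
    using assms borel_measurable_integrable[OF assms(1)] by measurable
  show "AE p in lborel. norm (k p * ft s h p) \<le> norm ((\<integral>x. norm (h x) \<partial>lborel) * norm (k p))"
    using norm_ft_le[OF assms(2), of s]
    by (intro AE_I2) (simp add: norm_mult mult.commute mult_left_mono)
qed

lemma integrable_product:
  fixes k h :: "'a::euclidean_space \<Rightarrow> 'b::{real_normed_field, banach, second_countable_topology}"
  assumes k: "integrable lborel k" and h: "integrable lborel h"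
  shows "integrable (lborel \<Otimes>\<^sub>M lborel) (\<lambda>(x, y). k x * h y)"
proof (rule lborel_pair.Fubini_integrable)
  note [measurable] = borel_measurable_integrable[OF h] borel_measurable_integrable[OF k]
  show "(\<lambda>(x, y). k x * h y) \<in> borel_measurable (lborel \<Otimes>\<^sub>M lborel)" by measurable
  show "integrable lborel (\<lambda>x. \<integral>y. norm (case (x, y) of (x, y) \<Rightarrow> k x * h y) \<partial>lborel)"
    using k h by (simp add: norm_mult)
  show "AE x in lborel. integrable lborel (\<lambda>y. case (x, y) of (x, y) \<Rightarrow> k x * h y)"
    using h by simp
qed

text \<open>Fubini, because the kernel is symmetric in its two variables. The formula moves a
  transform from one factor to the other; the damped norm, the convolution form of \<open>W\<close>
  and thereby its adjoint all rest on it.\<close>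

lemma ft_multiplication:
  fixes k h :: "'a::euclidean_space \<Rightarrow> complex"
  assumes k: "integrable lborel k" and h: "integrable lborel h"
  shows "(\<integral>p. k p * ft s h p \<partial>lborel) = (\<integral>x. h x * ft s k x \<partial>lborel)"
proof -
  note [measurable] = borel_measurable_integrable[OF h] borel_measurable_integrable[OF k]
  have "integrable (lborel \<Otimes>\<^sub>M lborel) (\<lambda>z. cis (s * (fst z \<bullet> snd z)) * (case z of (x, y) \<Rightarrow> k x * h y))"
    by (intro integrable_cis_mult integrable_product k h) measurable
  hence I: "integrable (lborel \<Otimes>\<^sub>M lborel) (\<lambda>(p, x). cis (s * (p \<bullet> x)) * (k p * h x))"
    by (simp add: case_prod_beta case_prod_beta')
  have "(\<integral>p. k p * ft s h p \<partial>lborel) = (\<integral>p. \<integral>x. cis (s * (p \<bullet> x)) * (k p * h x) \<partial>lborel \<partial>lborel)"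
    unfolding ft_def by (subst integral_mult_right_zero[symmetric]) (simp add: ac_simps)
  also have "\<dots> = (\<integral>x. \<integral>p. cis (s * (p \<bullet> x)) * (k p * h x) \<partial>lborel \<partial>lborel)"
    by (rule lborel_pair.Fubini_integral[OF I, symmetric])
  also have "\<dots> = (\<integral>x. h x * ft s k x \<partial>lborel)"
    unfolding ft_def by (subst integral_mult_right_zero[symmetric]) (simp add: ac_simps inner_commute)
  finally show ?thesis .
qed

lemma cnj_ft: "cnj (ft s q p) = ft (- s) (\<lambda>x. cnj (q x)) p"
  unfolding ft_def by (subst Bochner_Integration.integral_cnj[symmetric]) (simp add: cis_cnj)

definition gauss_weight :: "real \<Rightarrow> 'a::euclidean_space \<Rightarrow> real"
  where "gauss_weight \<sigma> p = exp (- (\<sigma> * norm p)\<^sup>2 / 2)"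

lemma gauss_weight_pos [simp]: "0 < gauss_weight \<sigma> p" "0 \<le> gauss_weight \<sigma> p" "gauss_weight \<sigma> p \<le> 1"
  by (simp_all add: gauss_weight_def)

lemma gauss_weight_measurable[measurable]: "gauss_weight \<sigma> \<in> borel_measurable borel"
  unfolding gauss_weight_def by measurable

text \<open>This is the Fourier integral of \<open>gauss_weight 1\<close>; its total mass (2
  \<pi>)^d becomes the Plancherel constant.\<close>

definition gauss_kernel :: "'a::euclidean_space \<Rightarrow> real"
  where "gauss_kernel z = sqrt (2 * pi) ^ DIM('a) * gauss_weight 1 z"

lemma gauss_kernel_nonneg [simp]: "0 \<le> gauss_kernel z"
  by (simp add: gauss_kernel_def)

lemma gauss_kernel_measurable[measurable]: "gauss_kernel \<in> borel_measurable borel"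
  unfolding gauss_kernel_def by measurable

lemma gauss_kernel_integral:
  "integrable lborel (gauss_kernel :: 'a::euclidean_space \<Rightarrow> real)"
  "integral\<^sup>L lborel (gauss_kernel :: 'a \<Rightarrow> real) = (2 * pi) ^ DIM('a)"
proof -
  have i: "integrable lborel (gauss_weight 1 :: 'a \<Rightarrow> real)"
    and I: "integral\<^sup>L lborel (gauss_weight 1 :: 'a \<Rightarrow> real) = sqrt (2 * pi) ^ DIM('a)"
    unfolding gauss_weight_def[abs_def] using gaussian_integral[of 1, where 'a='a] by auto
  show "integrable lborel (gauss_kernel :: 'a \<Rightarrow> real)"
    unfolding gauss_kernel_def[abs_def] by (intro integrable_mult_right i)
  have "sqrt (2 * pi) ^ DIM('a) * sqrt (2 * pi) ^ DIM('a) = (2 * pi) ^ DIM('a)"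
    by (simp only: power_mult_distrib[symmetric]) simp
  thus "integral\<^sup>L lborel (gauss_kernel :: 'a \<Rightarrow> real) = (2 * pi) ^ DIM('a)"
    by (simp add: gauss_kernel_def[abs_def] I)
qed

text \<open>Plancherel's theorem is obtained by damping with a Gaussian; after the substitution
  $y = x + \sigma z$ the damped norm becomes a Gaussian average of the autocorrelation of \<open>q\<close>.\<close>

lemma ft_damped_norm:
  fixes q :: "'a::euclidean_space \<Rightarrow> complex"
  assumes q: "integrable lborel q" and s: "\<bar>s\<bar> = 1" and \<sigma>: "0 < \<sigma>"
  shows "integrable lborel (\<lambda>p. gauss_weight \<sigma> p * (norm (ft s q p))\<^sup>2)" (is ?int)
    and "complex_of_real (\<integral>p. gauss_weight \<sigma> p * (norm (ft s q p))\<^sup>2 \<partial>lborel)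
      = (\<integral>x. \<integral>z. cnj (q x) * q (x + \<sigma> *\<^sub>R z) * of_real (gauss_kernel z) \<partial>lborel \<partial>lborel)"
proof -
  note [measurable] = borel_measurable_integrable[OF q]
  let ?\<gamma> = "\<lambda>p::'a. complex_of_real (gauss_weight \<sigma> p)"
  have \<gamma>: "integrable lborel ?\<gamma>"
    using gaussian_integral(1)[OF \<sigma>] by (simp add: gauss_weight_def complex_of_real_integrable_eq)
  have cq: "integrable lborel (\<lambda>x. cnj (q x))" using q by simp
  have i1: "integrable lborel (\<lambda>p. ?\<gamma> p * ft s q p)" by (rule integrable_mult_ft[OF \<gamma> q])
  have eq: "(?\<gamma> p * ft s q p) * ft (- s) (\<lambda>x. cnj (q x)) p = of_real (gauss_weight \<sigma> p * (norm (ft s q p))\<^sup>2)" for p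
    unfolding cnj_ft[symmetric] by (simp add: complex_norm_square mult.assoc del: of_real_power)
  have "integrable lborel (\<lambda>p. (?\<gamma> p * ft s q p) * ft (- s) (\<lambda>x. cnj (q x)) p)"
    by (rule integrable_mult_ft[OF i1 cq])
  thus ?int unfolding eq by (simp only: complex_of_real_integrable_eq)
  have inner: "ft (- s) (\<lambda>p. ?\<gamma> p * ft s q p) x
     = (\<integral>z. q (x + \<sigma> *\<^sub>R z) * of_real (gauss_kernel z) \<partial>lborel)" for x
  proof -
    let ?k = "\<lambda>p. cis (- s * (x \<bullet> p)) * ?\<gamma> p"
    have k: "integrable lborel ?k" by (rule ft_integrable[OF \<gamma>])
    have kf: "ft s ?k y = of_real ((sqrt (2 * pi) / \<sigma>) ^ DIM('a) * gauss_weight (1 / \<sigma>) (y - x))" for y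
    proof -
      have "cis (s * (y \<bullet> p)) * ?k p = cis (p \<bullet> (s *\<^sub>R (y - x))) * of_real (exp (- (\<sigma> * norm p)\<^sup>2 / 2))" for p
        by (simp add: gauss_weight_def mult.assoc[symmetric] cis_mult inner_commute inner_diff_right algebra_simps)
      hence "ft s ?k y = (\<integral>p. cis (p \<bullet> (s *\<^sub>R (y - x))) * of_real (exp (- (\<sigma> * norm p)\<^sup>2 / 2)) \<partial>lborel)"
        unfolding ft_def by (simp only:)
      thus ?thesis unfolding gaussian_fourier_scaled[OF \<sigma>] using s by (simp add: gauss_weight_def)
    qed
    have "ft (- s) (\<lambda>p. ?\<gamma> p * ft s q p) x = (\<integral>p. ?k p * ft s q p \<partial>lborel)"
      unfolding ft_def[of "- s"] by (simp add: mult.assoc)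
    also have "\<dots> = (\<integral>y. q y * ft s ?k y \<partial>lborel)" by (rule ft_multiplication[OF k q])
    also have "\<dots> = \<bar>\<sigma>\<bar> ^ DIM('a) *\<^sub>R (\<integral>z. q (x + \<sigma> *\<^sub>R z) * ft s ?k (x + \<sigma> *\<^sub>R z) \<partial>lborel)"
      using \<sigma> by (intro integral_lborel_affine borel_measurable_times borel_measurable_ft k) auto
    also have "\<dots> = (\<integral>z. q (x + \<sigma> *\<^sub>R z) * of_real (gauss_kernel z) \<partial>lborel)"
      unfolding integral_scaleR_right[symmetric] kf using \<sigma>
      by (intro Bochner_Integration.integral_cong refl)
        (simp add: gauss_weight_def gauss_kernel_def scaleR_conv_of_real power_divide)
    finally show ?thesis .
  qed
  have "complex_of_real (\<integral>p. gauss_weight \<sigma> p * (norm (ft s q p))\<^sup>2 \<partial>lborel)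
      = (\<integral>p. (?\<gamma> p * ft s q p) * ft (- s) (\<lambda>x. cnj (q x)) p \<partial>lborel)"
    unfolding eq by (simp only: integral_complex_of_real)
  also have "\<dots> = (\<integral>x. cnj (q x) * ft (- s) (\<lambda>p. ?\<gamma> p * ft s q p) x \<partial>lborel)"
    by (rule ft_multiplication[OF i1 cq])
  finally show "complex_of_real (\<integral>p. gauss_weight \<sigma> p * (norm (ft s q p))\<^sup>2 \<partial>lborel)
      = (\<integral>x. \<integral>z. cnj (q x) * q (x + \<sigma> *\<^sub>R z) * of_real (gauss_kernel z) \<partial>lborel \<partial>lborel)"
    unfolding inner by (subst (asm) integral_mult_right_zero[symmetric]) (simp add: mult.assoc)
qed

lemma norm_sq_pm:
  fixes a b :: complex
  assumes "e = 1 \<or> e = -1"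
  shows "(norm (a + of_real e * b))\<^sup>2 = (norm a)\<^sup>2 + (norm b)\<^sup>2 + 2 * e * Re (cnj a * b)"
  using assms unfolding cmod_power2 by (auto simp: power2_eq_square algebra_simps)

text \<open>The two signs \<open>e\<close> give the two inequalities in Plancherel's theorem.\<close>

lemma ft_damped_identity:
  fixes q :: "'a::euclidean_space \<Rightarrow> complex"
  assumes q: "integrable lborel q" "L2 q" and s: "\<bar>s\<bar> = 1" and \<sigma>: "0 < \<sigma>" and e: "e = 1 \<or> e = -1"
  shows "(\<integral>\<^sup>+x. \<integral>\<^sup>+z. ennreal ((norm (q x + of_real e * q (x + \<sigma> *\<^sub>R z)))\<^sup>2 / 2
            * gauss_kernel z) \<partial>lborel \<partial>lborel)
    = ennreal ((2 * pi) ^ DIM('a) * sqnorm q + e * (\<integral>p. gauss_weight \<sigma> p * (norm (ft s q p))\<^sup>2 \<partial>lborel))" (is ?identity)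
    and "0 \<le> (2 * pi) ^ DIM('a) * sqnorm q + e * (\<integral>p. gauss_weight \<sigma> p * (norm (ft s q p))\<^sup>2 \<partial>lborel)" (is ?nonneg)
proof -
  note [measurable] = borel_measurable_integrable[OF q(1)]
  note g0 = gauss_kernel_nonneg[where 'a='a] and gi = gauss_kernel_integral(1)[where 'a='a]
    and gI = gauss_kernel_integral(2)[where 'a='a]
  let ?P = "lborel \<Otimes>\<^sub>M lborel :: ('a \<times> 'a) measure"
  let ?A = "\<lambda>x z. (norm (q x))\<^sup>2 * gauss_kernel (z::'a)"
  let ?B = "\<lambda>x z. (norm (q (x + \<sigma> *\<^sub>R z)))\<^sup>2 * gauss_kernel z"
  let ?C = "\<lambda>x z. cnj (q x) * q (x + \<sigma> *\<^sub>R z) * of_real (gauss_kernel z)"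
  let ?D = "\<lambda>x z. (norm (q x + of_real e * q (x + \<sigma> *\<^sub>R z)))\<^sup>2 / 2 * gauss_kernel z"
  have A: "integrable ?P (\<lambda>(x, z). ?A x z)"
    by (rule integrable_product[OF L2_integrable[OF q(2)] gi])
  have "(\<integral>\<^sup>+w. ennreal (case w of (x, z) \<Rightarrow> ?B x z) \<partial>?P) = (\<integral>\<^sup>+z. \<integral>\<^sup>+x. ennreal (?B x z) \<partial>lborel \<partial>lborel)"
    by (subst lborel_pair.nn_integral_snd[symmetric]) auto
  also have "\<dots> = (\<integral>\<^sup>+z. \<integral>\<^sup>+x. ennreal (?A x z) \<partial>lborel \<partial>lborel)"
  proof (rule nn_integral_cong)
    fix z
    show "(\<integral>\<^sup>+x. ennreal (?B x z) \<partial>lborel) = (\<integral>\<^sup>+x. ennreal (?A x z) \<partial>lborel)"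
      by (subst nn_integral_lborel_affine[of "\<lambda>x. ennreal (?A x z)" 1 "\<sigma> *\<^sub>R z"]) (auto simp: add.commute)
  qed
  also have "\<dots> = (\<integral>\<^sup>+w. ennreal (case w of (x, z) \<Rightarrow> ?A x z) \<partial>?P)"
    by (subst lborel_pair.nn_integral_snd[symmetric]) auto
  \<comment> \<open>For each fixed \<open>z\<close> the translation by
    \<open>\<sigma> *\<^sub>R z\<close> leaves the integral over \<open>x\<close> unchanged, so only
    the cross term \<open>?C\<close> depends on \<sigma>.\<close>
  finally have BA: "(\<integral>\<^sup>+w. ennreal (case w of (x, z) \<Rightarrow> ?B x z) \<partial>?P) = (\<integral>\<^sup>+w. ennreal (case w of (x, z) \<Rightarrow> ?A x z) \<partial>?P)" .
  have nnA: "(\<integral>\<^sup>+w. ennreal (case w of (x, z) \<Rightarrow> ?A x z) \<partial>?P) = ennreal (\<integral>w. (case w of (x, z) \<Rightarrow> ?A x z) \<partial>?P)"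
    using A g0 by (intro nn_integral_eq_integral) (auto simp: case_prod_beta case_prod_beta')
  have B: "integrable ?P (\<lambda>(x, z). ?B x z)"
  proof (rule integrableI_bounded)
    have "(\<integral>\<^sup>+w. ennreal (norm (case w of (x, z) \<Rightarrow> ?B x z)) \<partial>?P) = (\<integral>\<^sup>+w. ennreal (case w of (x, z) \<Rightarrow> ?B x z) \<partial>?P)"
      using g0 by (intro nn_integral_cong) (auto simp: case_prod_beta case_prod_beta')
    thus "(\<integral>\<^sup>+w. ennreal (norm (case w of (x, z) \<Rightarrow> ?B x z)) \<partial>?P) < \<infinity>"
      unfolding BA nnA by simp
  qed measurable
  have "ennreal (\<integral>w. (case w of (x, z) \<Rightarrow> ?B x z) \<partial>?P) = ennreal (\<integral>w. (case w of (x, z) \<Rightarrow> ?A x z) \<partial>?P)"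
    using B g0 BA nnA by (subst nn_integral_eq_integral[symmetric]) (auto simp: case_prod_beta case_prod_beta')
  hence IB: "(\<integral>w. (case w of (x, z) \<Rightarrow> ?B x z) \<partial>?P) = (\<integral>w. (case w of (x, z) \<Rightarrow> ?A x z) \<partial>?P)"
    using g0 by (subst (asm) ennreal_inj) (auto intro!: Bochner_Integration.integral_nonneg simp: case_prod_beta case_prod_beta')
  have "(\<integral>w. (case w of (x, z) \<Rightarrow> ?A x z) \<partial>?P) = (\<integral>x. \<integral>z. ?A x z \<partial>lborel \<partial>lborel)"
    by (rule lborel_pair.integral_fst[OF A, symmetric])
  hence IA: "(\<integral>w. (case w of (x, z) \<Rightarrow> ?A x z) \<partial>?P) = (2 * pi) ^ DIM('a) * sqnorm q"
    by (simp add: gI sqnorm_def)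
  have C: "integrable ?P (\<lambda>(x, z). ?C x z)"
  proof (rule Bochner_Integration.integrable_bound)
    show "integrable ?P (\<lambda>w. (case w of (x, z) \<Rightarrow> ?A x z) + (case w of (x, z) \<Rightarrow> ?B x z))"
      by (intro Bochner_Integration.integrable_add A B)
    show "AE w in ?P. norm (case w of (x, z) \<Rightarrow> ?C x z) \<le> norm ((case w of (x, z) \<Rightarrow> ?A x z) + (case w of (x, z) \<Rightarrow> ?B x z))"
    proof (rule AE_I2)
      fix w :: "'a \<times> 'a"
      obtain x z where w: "w = (x, z)" by fastforce
      have "norm (q x) * norm (q (x + \<sigma> *\<^sub>R z)) \<le> (norm (q x))\<^sup>2 + (norm (q (x + \<sigma> *\<^sub>R z)))\<^sup>2"
        using mult_le_sum_sq[of "q x" "q (x + \<sigma> *\<^sub>R z)"] by (smt (verit) mult_nonneg_nonneg norm_ge_zero)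
      from mult_right_mono[OF this g0[of z]] g0[of z]
      show "norm (case w of (x, z) \<Rightarrow> ?C x z) \<le> norm ((case w of (x, z) \<Rightarrow> ?A x z) + (case w of (x, z) \<Rightarrow> ?B x z))"
        by (simp add: w norm_mult distrib_right)
    qed
  qed measurable
  have IC: "(\<integral>w. (case w of (x, z) \<Rightarrow> ?C x z) \<partial>?P) = of_real (\<integral>p. gauss_weight \<sigma> p * (norm (ft s q p))\<^sup>2 \<partial>lborel)"
    unfolding ft_damped_norm(2)[OF q(1) s \<sigma>]
    by (rule lborel_pair.integral_fst[OF C, symmetric])
  have D: "(case w of (x, z) \<Rightarrow> ?D x z)
     = (case w of (x, z) \<Rightarrow> ?A x z) / 2 + (case w of (x, z) \<Rightarrow> ?B x z) / 2 + e * Re (case w of (x, z) \<Rightarrow> ?C x z)" for w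
    by (cases w) (simp add: norm_sq_pm[OF e] field_simps)
  have Di: "integrable ?P (\<lambda>(x, z). ?D x z)"
    unfolding D using A B C by (auto intro!: Bochner_Integration.integrable_add)
  have ID: "(\<integral>w. (case w of (x, z) \<Rightarrow> ?D x z) \<partial>?P)
     = (2 * pi) ^ DIM('a) * sqnorm q + e * (\<integral>p. gauss_weight \<sigma> p * (norm (ft s q p))\<^sup>2 \<partial>lborel)"
    unfolding D using A B C by (simp add: IA IB IC)
  have "0 \<le> (\<integral>w. (case w of (x, z) \<Rightarrow> ?D x z) \<partial>?P)"
    using g0 by (intro Bochner_Integration.integral_nonneg) (auto simp: case_prod_beta case_prod_beta')
  thus ?nonneg unfolding ID .
  have "(\<integral>\<^sup>+x. \<integral>\<^sup>+z. ennreal (?D x z) \<partial>lborel \<partial>lborel) = (\<integral>\<^sup>+w. ennreal (case w of (x, z) \<Rightarrow> ?D x z) \<partial>?P)"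
    by (subst lborel.nn_integral_fst[symmetric]) auto
  also have "\<dots> = ennreal (\<integral>w. (case w of (x, z) \<Rightarrow> ?D x z) \<partial>?P)"
    using Di g0 by (intro nn_integral_eq_integral) (auto simp: case_prod_beta case_prod_beta')
  also note ID
  finally show ?identity .
qed

text \<open>The sign \<open>e = - 1\<close> of the damped identity bounds the damped norm uniformly
  in \<sigma>, and Fatou's lemma removes the damping as \<sigma> tends to 0.\<close>

lemma ft_L2:
  fixes q :: "'a::euclidean_space \<Rightarrow> complex"
  assumes q: "integrable lborel q" "L2 q" and s: "\<bar>s\<bar> = 1"
  shows "L2 (ft s q)" "sqnorm (ft s q) \<le> (2 * pi) ^ DIM('a) * sqnorm q"
proof -
  \<comment> \<open>The exponent is halved, so that squaring the norm of \<open>v n p\<close>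
    produces exactly \<open>gauss_weight\<close>.\<close>
  define v where "v n p = complex_of_real (exp (- (inverse (real (Suc n)) * norm p)\<^sup>2 / 4)) * ft s q p" for n p
  have vm [measurable]: "v n \<in> borel_measurable borel" for n
    unfolding v_def using q(1) by measurable
  have v2: "(norm (v n p))\<^sup>2 = gauss_weight (inverse (real (Suc n))) p * (norm (ft s q p))\<^sup>2" for n p
    by (simp add: v_def norm_mult power_mult_distrib gauss_weight_def exp_double[symmetric])
  have v: "L2 (v n)" for n
    using ft_damped_norm(1)[OF q(1) s, of "inverse (real (Suc n))"] by (intro L2_I vm) (simp add: v2)
  have vs: "sqnorm (v n) \<le> (2 * pi) ^ DIM('a) * sqnorm q" for n
    unfolding sqnorm_def[of "v n"] v2
    using ft_damped_identity(2)[OF q s, of "inverse (real (Suc n))" "-1"] by simp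
  have lim: "AE p in lborel. (\<lambda>n. v n p) \<longlonglongrightarrow> ft s q p"
  proof (rule AE_I2)
    fix p
    have "(\<lambda>n. complex_of_real (exp (- (inverse (real (Suc n)) * norm p)\<^sup>2 / 4)) * ft s q p)
        \<longlonglongrightarrow> of_real (exp (- (0 * norm p)\<^sup>2 / 4)) * ft s q p"
      by (intro tendsto_intros LIMSEQ_inverse_real_of_nat) auto
    thus "(\<lambda>n. v n p) \<longlonglongrightarrow> ft s q p" by (simp add: v_def)
  qed
  show "L2 (ft s q)" "sqnorm (ft s q) \<le> (2 * pi) ^ DIM('a) * sqnorm q"
    using L2_Fatou[OF v _ lim, of "(2 * pi) ^ DIM('a) * sqnorm q"] vs q(1) by auto
qed

text \<open>The missing inequality comes from the sign \<open>e = 1\<close>: the average of |q(x) +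
  q(x + \<sigma> z)|^2 / 2 is at most the sum of the two sides, and as \<sigma> tends to 0 Fatou's
  lemma gives twice the right-hand side. Continuity almost everywhere supplies the pointwise limit;
  the functions to which the result is applied are continuous off the origin.\<close>

lemma Plancherel_ft:
  fixes q :: "'a::euclidean_space \<Rightarrow> complex"
  assumes q: "integrable lborel q" "L2 q" and s: "\<bar>s\<bar> = 1" and cont: "AE x in lborel. isCont q x"
  shows "sqnorm (ft s q) = (2 * pi) ^ DIM('a) * sqnorm q"
proof (rule antisym)
  show "sqnorm (ft s q) \<le> (2 * pi) ^ DIM('a) * sqnorm q" by (rule ft_L2(2)[OF q s])
  note [measurable] = borel_measurable_integrable[OF q(1)]
  define c where "c = (2 * pi) ^ DIM('a) * sqnorm q"
  have c0: "0 \<le> c" by (simp add: c_def)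
  note g0 = gauss_kernel_nonneg[where 'a='a] and gi = gauss_kernel_integral(1)[where 'a='a]
    and gI = gauss_kernel_integral(2)[where 'a='a]
  define r where "r n = inverse (real (Suc n))" for n
  define D where "D n x z = (norm (q x + of_real 1 * q (x + r n *\<^sub>R z)))\<^sup>2 / 2 * gauss_kernel z" for n x z
  have Dm [measurable]: "(\<lambda>(x, z). D n x z) \<in> borel_measurable (lborel \<Otimes>\<^sub>M lborel)" for n
    unfolding D_def by measurable
  have bound: "(\<integral>\<^sup>+x. \<integral>\<^sup>+z. ennreal (D n x z) \<partial>lborel \<partial>lborel) \<le> ennreal (c + sqnorm (ft s q))" for n
  proof -
    have "(\<integral>p. gauss_weight (r n) p * (norm (ft s q p))\<^sup>2 \<partial>lborel) \<le> sqnorm (ft s q)"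
      unfolding sqnorm_def using ft_damped_norm(1)[OF q(1) s, of "r n"] L2_integrable[OF ft_L2(1)[OF q s]]
      by (intro integral_mono mult_left_le_one_le) (auto simp: r_def)
    thus ?thesis
      using ft_damped_identity(1)[OF q s, of "r n" 1]
      unfolding D_def c_def[symmetric] by (simp add: r_def ennreal_leI)
  qed
  have lim: "(\<lambda>n. D n x z) \<longlonglongrightarrow> 2 * (norm (q x))\<^sup>2 * gauss_kernel (z::'a)" if "isCont q x" for x z
  proof -
    have "(\<lambda>n. x + r n *\<^sub>R z) \<longlonglongrightarrow> x + 0 *\<^sub>R z"
      unfolding r_def by (intro tendsto_intros LIMSEQ_inverse_real_of_nat)
    hence "(\<lambda>n. q (x + r n *\<^sub>R z)) \<longlonglongrightarrow> q x"
      using isCont_tendsto_compose[OF that] by simp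
    hence "(\<lambda>n. D n x z) \<longlonglongrightarrow> (norm (q x + of_real 1 * q x))\<^sup>2 / 2 * gauss_kernel z"
      unfolding D_def by (intro tendsto_intros) auto
    also have "(norm (q x + of_real 1 * q x))\<^sup>2 / 2 * gauss_kernel z = 2 * (norm (q x))\<^sup>2 * gauss_kernel (z::'a)"
      by (simp add: mult_2[symmetric] norm_mult power_mult_distrib)
    finally show ?thesis .
  qed
  have "ennreal (2 * c) = (\<integral>\<^sup>+x. ennreal (2 * (norm (q x))\<^sup>2 * (2 * pi) ^ DIM('a)) \<partial>lborel)"
    using L2_integrable[OF q(2)] by (subst nn_integral_eq_integral) (auto simp: c_def sqnorm_def)
  also have "\<dots> \<le> (\<integral>\<^sup>+x. liminf (\<lambda>n. \<integral>\<^sup>+z. ennreal (D n x z) \<partial>lborel) \<partial>lborel)"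
  proof (rule nn_integral_mono_AE)
    show "AE x in lborel. ennreal (2 * (norm (q x))\<^sup>2 * (2 * pi) ^ DIM('a)) \<le> liminf (\<lambda>n. \<integral>\<^sup>+z. ennreal (D n x z) \<partial>lborel)"
      using cont
    proof eventually_elim
      case (elim x)
      have "ennreal (2 * (norm (q x))\<^sup>2 * (2 * pi) ^ DIM('a)) = (\<integral>\<^sup>+z. ennreal (2 * (norm (q x))\<^sup>2 * gauss_kernel (z::'a)) \<partial>lborel)"
        using gi g0 by (subst nn_integral_eq_integral) (auto simp: gI)
      also have "\<dots> = (\<integral>\<^sup>+z. liminf (\<lambda>n. ennreal (D n x z)) \<partial>lborel)"
      proof (rule nn_integral_cong)
        fix z
        have "(\<lambda>n. ennreal (D n x z)) \<longlonglongrightarrow> ennreal (2 * (norm (q x))\<^sup>2 * gauss_kernel (z::'a))"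
          using lim[OF elim] by (intro tendsto_ennrealI)
        thus "ennreal (2 * (norm (q x))\<^sup>2 * gauss_kernel (z::'a)) = liminf (\<lambda>n. ennreal (D n x z))"
          by (intro lim_imp_Liminf[symmetric]) simp_all
      qed
      also have "\<dots> \<le> liminf (\<lambda>n. \<integral>\<^sup>+z. ennreal (D n x z) \<partial>lborel)"
        by (rule nn_integral_liminf) (unfold D_def, measurable)
      finally show ?case .
    qed
  qed
  also have "\<dots> \<le> liminf (\<lambda>n. \<integral>\<^sup>+x. \<integral>\<^sup>+z. ennreal (D n x z) \<partial>lborel \<partial>lborel)"
    by (rule nn_integral_liminf) measurable
  also have "\<dots> \<le> liminf (\<lambda>n::nat. ennreal (c + sqnorm (ft s q)))"
    by (intro Liminf_mono always_eventually allI bound)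
  finally have "ennreal (2 * c) \<le> ennreal (c + sqnorm (ft s q))"
    by (simp add: Liminf_const del: ennreal_plus)
  hence "2 * c \<le> c + sqnorm (ft s q)"
    using c0 by (subst (asm) ennreal_le_iff) auto
  thus "(2 * pi) ^ DIM('a) * sqnorm q \<le> sqnorm (ft s q)" unfolding c_def by linarith
qed

section \<open>The operators $W_f$ and $K_f$\<close>

definition fourier_const :: "'a::euclidean_space itself \<Rightarrow> real"
  where "fourier_const _ = (2 * pi) powr (- real DIM('a) / 2)"

lemma fourier_const_sq: "(fourier_const TYPE('a::euclidean_space))\<^sup>2 = 1 / (2 * pi) ^ DIM('a)"
proof -
  have "(fourier_const TYPE('a))\<^sup>2 = (2 * pi) powr (- real DIM('a))"
    unfolding fourier_const_def power2_eq_square by (subst powr_add[symmetric]) simp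
  thus ?thesis by (simp add: powr_minus powr_realpow divide_inverse)
qed

lemma sqnorm_fourier_const:
  "sqnorm (\<lambda>x. complex_of_real (fourier_const TYPE('a::euclidean_space)) * u x) = sqnorm u / (2 * pi) ^ DIM('a)"
  by (simp add: sqnorm_cmult fourier_const_sq)

lemma ft_diff:
  assumes "integrable lborel u" "integrable lborel v"
  shows "ft s (\<lambda>x. u x - v x) p = ft s u p - ft s v p"
  unfolding ft_def using ft_integrable[OF assms(1)] ft_integrable[OF assms(2)]
  by (subst Bochner_Integration.integral_diff[symmetric]) (auto simp: right_diff_distrib)

text \<open>Identifies the limit picked by \<open>SOME\<close> in \<open>fourier_L2\<close> with any
  explicit limit, up to a null set.\<close>

lemma L2_tendsto_unique:
  fixes v v' :: "'a::euclidean_space \<Rightarrow> complex"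
  assumes "L2_tendsto lborel X v F" "L2_tendsto lborel X v' F" "F \<noteq> bot"
  shows "AE x in lborel. v x = v' x"
proof -
  have v: "L2 v" "L2 v'" and X: "\<forall>\<^sub>F k in F. L2 (X k)"
    and lim: "((\<lambda>k. sqnorm (\<lambda>x. X k x - v x)) \<longlongrightarrow> 0) F" "((\<lambda>k. sqnorm (\<lambda>x. X k x - v' x)) \<longlongrightarrow> 0) F"
    using assms(1,2) tendsto_power[of "\<lambda>k. sqrt (sqnorm (\<lambda>x. X k x - v x))" 0 F 2]
      tendsto_power[of "\<lambda>k. sqrt (sqnorm (\<lambda>x. X k x - v' x))" 0 F 2]
    unfolding L2_tendsto_def sqnorm_def[symmetric] by auto
  have "sqnorm (\<lambda>x. v x - v' x) \<le> 0"
  proof (rule tendsto_le[OF assms(3) _ tendsto_const])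
    show "((\<lambda>k. 2 * sqnorm (\<lambda>x. X k x - v x) + 2 * sqnorm (\<lambda>x. X k x - v' x)) \<longlongrightarrow> 0) F"
      using tendsto_add[OF tendsto_mult[OF tendsto_const[of 2] lim(1)] tendsto_mult[OF tendsto_const[of 2] lim(2)]] by simp
    show "\<forall>\<^sub>F k in F. sqnorm (\<lambda>x. v x - v' x) \<le> 2 * sqnorm (\<lambda>x. X k x - v x) + 2 * sqnorm (\<lambda>x. X k x - v' x)"
      using X
    proof eventually_elim
      case (elim k)
      show ?case using sqnorm_triangle[OF v(1) elim v(2)] sqnorm_minus_commute[of v "X k"] by simp
    qed
  qed
  hence "sqnorm (\<lambda>x. v x - v' x) = 0" by (simp add: antisym)
  from sqnorm_eq_0[OF L2_diff[OF v] this] show ?thesis by eventually_elim simp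
qed

text \<open>The truncated integrals are the transforms of \<open>q\<close> cut off outside a ball.
  These cut-offs converge to \<open>q\<close> in L2 by dominated convergence, and
  \<open>ft_L2\<close> carries the convergence over to the transforms.\<close>

lemma fourier_L2_eq_ft:
  fixes q :: "'a::euclidean_space \<Rightarrow> complex"
  assumes q: "L2 q" "integrable lborel q"
  shows "L2 (fourier_L2 q)"
    and "AE p in lborel. fourier_L2 q p = of_real (fourier_const TYPE('a)) * ft (- 1) q p"
proof -
  let ?c = "complex_of_real (fourier_const TYPE('a))"
  define qR where "qR R x = indicator (cball 0 R) x *\<^sub>R q x" for R x
  note [measurable] = borel_measurable_integrable[OF q(2)]
  have qRi: "integrable lborel (qR R)" for R
    unfolding qR_def by (rule integrable_mult_indicator) (use q in auto)
  have qR2: "L2 (qR R)" for R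
  proof (rule L2_bound[OF _ L2_integrable[OF q(1)]])
    show "qR R \<in> borel_measurable borel" using qRi[of R] by auto
  qed (auto simp: qR_def indicator_def)
  define X where "X R p = complex_of_real ((2 * pi) powr (- real DIM('a) / 2)) *
            (LINT x : cball 0 R | lborel. cis (- (p \<bullet> x)) * q x)" for R p
  have X: "X R = (\<lambda>p. ?c * ft (- 1) (qR R) p)" for R
    by (simp add: X_def fourier_const_def ft_def qR_def set_lebesgue_integral_def fun_eq_iff mult_ac)
  have lim0: "((\<lambda>R. sqnorm (\<lambda>x. qR R x - q x)) \<longlongrightarrow> (\<integral>x. 0 \<partial>(lborel :: 'a measure))) at_top"
    unfolding sqnorm_def
  proof (rule integral_dominated_convergence_at_top[where w="\<lambda>x. (norm (q x))\<^sup>2"])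
    show "(\<lambda>x. (norm (qR R x - q x))\<^sup>2) \<in> borel_measurable lborel" for R
      using qRi[of R] by measurable
    show "AE x in lborel. ((\<lambda>R. (norm (qR R x - q x))\<^sup>2) \<longlongrightarrow> 0) at_top"
    proof (rule AE_I2, rule tendsto_eventually)
      fix x :: 'a
      show "\<forall>\<^sub>F R in at_top. (norm (qR R x - q x))\<^sup>2 = 0"
        using eventually_ge_at_top[of "norm x"] by eventually_elim (simp add: qR_def)
    qed
    show "\<forall>\<^sub>F R in at_top. AE x in lborel. norm ((norm (qR R x - q x))\<^sup>2) \<le> (norm (q x))\<^sup>2"
      by (intro always_eventually allI AE_I2) (auto simp: qR_def indicator_def)
  qed (use L2_integrable[OF q(1)] in auto)
  have Fq: "L2 (\<lambda>p. ?c * ft (- 1) q p)" by (intro L2_cmult ft_L2 q) simp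
  have T: "L2_tendsto lborel X (\<lambda>p. ?c * ft (- 1) q p) at_top"
    unfolding L2_tendsto_def
  proof (intro conjI Fq)
    show "\<forall>\<^sub>F R in at_top. L2 (X R)"
      unfolding X by (intro always_eventually allI L2_cmult ft_L2 qRi qR2) simp
    have le: "sqnorm (\<lambda>p. X R p - ?c * ft (- 1) q p) \<le> sqnorm (\<lambda>x. qR R x - q x)" for R
    proof -
      have "sqnorm (\<lambda>p. X R p - ?c * ft (- 1) q p) = sqnorm (\<lambda>p. ?c * ft (- 1) (\<lambda>x. qR R x - q x) p)"
        unfolding X by (simp add: ft_diff qRi q right_diff_distrib)
      also have "\<dots> = sqnorm (ft (- 1) (\<lambda>x. qR R x - q x)) / (2 * pi) ^ DIM('a)"
        by (rule sqnorm_fourier_const)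
      also have "\<dots> \<le> sqnorm (\<lambda>x. qR R x - q x)"
        using ft_L2(2)[of "\<lambda>x. qR R x - q x" "- 1"] qRi[of R] qR2[of R] q
        by (simp add: L2_diff divide_le_eq mult.commute)
      finally show ?thesis .
    qed
    have "((\<lambda>R. sqnorm (\<lambda>p. X R p - ?c * ft (- 1) q p)) \<longlongrightarrow> 0) at_top"
      by (rule tendsto_sandwich[OF _ _ tendsto_const lim0[simplified]]) (auto intro: always_eventually le)
    from tendsto_real_sqrt[OF this]
    show "((\<lambda>R. sqrt (\<integral>p. (norm (X R p - ?c * ft (- 1) q p))\<^sup>2 \<partial>lborel)) \<longlongrightarrow> 0) at_top"
      by (simp add: sqnorm_def)
  qed
  have F: "fourier_L2 q = (SOME v. L2_tendsto lborel X v at_top)"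
    unfolding fourier_L2_def X_def ..
  have T': "L2_tendsto lborel X (fourier_L2 q) at_top"
    unfolding F by (rule someI[where P="\<lambda>v. L2_tendsto lborel X v at_top", OF T])
  thus "L2 (fourier_L2 q)" by (simp add: L2_tendsto_def)
  show "AE p in lborel. fourier_L2 q p = ?c * ft (- 1) q p"
    by (rule L2_tendsto_unique[OF T' T]) simp
qed

lemma inv_fourier_L2_eq_ft:
  fixes q :: "'a::euclidean_space \<Rightarrow> complex"
  assumes q: "L2 q" "integrable lborel q"
  shows "L2 (inv_fourier_L2 q)"
    and "AE p in lborel. inv_fourier_L2 q p = of_real (fourier_const TYPE('a)) * ft 1 q p"
proof -
  have "AE p in lborel. fourier_L2 q (0 + (-1) *\<^sub>R p) = of_real (fourier_const TYPE('a)) * ft (- 1) q (0 + (-1) *\<^sub>R p)"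
    by (rule AE_lborel_affine[OF fourier_L2_eq_ft(2)[OF q]]) simp
  thus ae: "AE p in lborel. inv_fourier_L2 q p = of_real (fourier_const TYPE('a)) * ft 1 q p"
    by (simp add: inv_fourier_L2_def ft_def)
  have [measurable]: "fourier_L2 q \<in> borel_measurable borel" using fourier_L2_eq_ft(1)[OF q] by auto
  show "L2 (inv_fourier_L2 q)"
  proof (rule L2_cong_AE)
    show "L2 (\<lambda>p. of_real (fourier_const TYPE('a)) * ft 1 q p)" by (intro L2_cmult ft_L2 q) simp
    show "inv_fourier_L2 q \<in> borel_measurable borel" unfolding inv_fourier_L2_def by measurable
  qed (use ae in \<open>auto elim!: eventually_mono\<close>)
qed

section \<open>The Bose factor and the integrability of it and of its root\<close>

definition bose :: "real \<Rightarrow> 'a::euclidean_space \<Rightarrow> real"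
  where "bose \<beta> p = 1 / (exp (\<beta> * (norm p)\<^sup>2) - 1)"

lemma bose_measurable[measurable]: "bose \<beta> \<in> borel_measurable borel"
  unfolding bose_def by measurable

lemma bose_nonneg: "0 < \<beta> \<Longrightarrow> 0 \<le> bose \<beta> p"
  by (simp add: bose_def)

lemma bose_pos: "0 < \<beta> \<Longrightarrow> p \<noteq> 0 \<Longrightarrow> 0 < bose \<beta> p"
  by (simp add: bose_def)

lemma isCont_bose: "0 < \<beta> \<Longrightarrow> p \<noteq> 0 \<Longrightarrow> isCont (bose \<beta>) p"
  unfolding bose_def by (intro continuous_intros) auto

text \<open>At p = 0 both sides are 0, by \<open>inverse 0 = 0\<close> and \<open>1 / 0 = 0\<close>;
  so the symbol in \<open>W_op\<close> can be rewritten literally and not only almost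
  everywhere.\<close>

lemma sqrt_heat_symbol:
  "sqrt (exp (\<beta> * - (norm p)\<^sup>2) * inverse (1 - exp (\<beta> * - (norm p)\<^sup>2))) = sqrt (bose \<beta> p)"
proof -
  have "exp (- a) * inverse (1 - exp (- a)) = 1 / (exp a - 1)" for a :: real
  proof (cases "a = 0")
    case False
    hence "exp a - 1 \<noteq> 0" "1 - exp (- a) \<noteq> 0" by auto
    thus ?thesis by (simp add: field_simps exp_minus)
  qed simp
  thus ?thesis by (simp add: bose_def)
qed

text \<open>Geometric series: $\frac{1}{e^{\beta|p|^2} - 1} = \sum_{n\ge1} e^{-n\beta|p|^2}$ for $p \ne 0$, and the
  integrals of the summands decay like $n^{-d/2}$.\<close>

lemma integrable_bose:
  assumes \<beta>: "0 < \<beta>" and d: "2 < DIM('a::euclidean_space)"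
  shows "integrable lborel (bose \<beta> :: 'a \<Rightarrow> real)"
proof (rule integrableI_bounded)
  \<comment> \<open>Chosen so that the Gaussian \<open>?h n\<close> is the term with exponent n + 1
    of the geometric series.\<close>
  define \<sigma> where "\<sigma> n = sqrt (2 * real (Suc n) * \<beta>)" for n
  have \<sigma>: "0 < \<sigma> n" for n using \<beta> by (simp add: \<sigma>_def del: of_nat_Suc)
  let ?h = "\<lambda>n (p::'a). exp (- (\<sigma> n * norm p)\<^sup>2 / 2)"
  let ?C = "(sqrt (pi / \<beta>)) ^ DIM('a)"
  have h: "?h n p = exp (- (\<beta> * (norm p)\<^sup>2)) ^ Suc n" for n and p :: 'a
    unfolding exp_of_nat_mult[symmetric] using \<beta> by (simp add: \<sigma>_def power_mult_distrib mult_ac del: of_nat_Suc)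
  have sum: "(\<Sum>n. ennreal (?h n p)) = ennreal (bose \<beta> p)" if "p \<noteq> 0" for p :: 'a
  proof -
    define a where "a = exp (- (\<beta> * (norm p)\<^sup>2))"
    have a: "0 < a" "a < 1" using \<beta> that by (auto simp: a_def)
    have "(\<lambda>n. a * a ^ n) sums (a * (1 / (1 - a)))"
      by (intro sums_mult geometric_sums) (use a in simp)
    moreover have "a * (1 / (1 - a)) = bose \<beta> p"
    proof -
      have "exp (\<beta> * (norm p)\<^sup>2) = 1 / a" by (simp add: a_def exp_minus field_simps)
      thus ?thesis unfolding bose_def using a by (simp only:) (simp add: field_simps)
    qed
    ultimately have "(\<lambda>n. ?h n p) sums bose \<beta> p" unfolding h a_def[symmetric] by simp
    thus ?thesis by (intro suminf_ennreal_eq) auto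
  qed
  have "(\<integral>\<^sup>+p. ennreal (norm (bose \<beta> (p::'a))) \<partial>lborel) = (\<integral>\<^sup>+p. (\<Sum>n. ennreal (?h n p)) \<partial>lborel)"
  proof (rule nn_integral_cong_AE)
    show "AE p in lborel. ennreal (norm (bose \<beta> (p::'a))) = (\<Sum>n. ennreal (?h n p))"
      using AE_lborel_singleton[of "0::'a"] 
    proof eventually_elim
      case (elim p)
      show ?case unfolding sum[OF elim] using bose_nonneg[OF \<beta>, of p] by simp
    qed
  qed
  also have "\<dots> = (\<Sum>n. \<integral>\<^sup>+p. ennreal (?h n p) \<partial>lborel)"
    by (rule nn_integral_suminf) measurable
  also have "\<dots> \<le> (\<Sum>n. ennreal (?C * real (Suc n) powr (- 3 / 2)))"
  proof (intro suminf_le)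
    fix n
    have r: "0 < real (Suc n)" by simp
    have "(\<integral>\<^sup>+p. ennreal (?h n p) \<partial>lborel) = ennreal ((sqrt (2 * pi) / \<sigma> n) ^ DIM('a))"
      using gaussian_integral[OF \<sigma>[of n], where 'a='a] by (subst nn_integral_eq_integral) auto
    also have "sqrt (2 * pi) / \<sigma> n = sqrt (pi / \<beta>) * real (Suc n) powr (- 1 / 2)"
    proof -
      have "x powr (- 1 / 2) = 1 / sqrt x" if "0 < x" for x :: real
        using powr_minus_divide[of x "1/2"] powr_half_sqrt[of x] that by simp
      from this[OF r] show ?thesis
        unfolding \<sigma>_def real_sqrt_mult real_sqrt_divide by simp
    qed
    also have "(sqrt (pi / \<beta>) * real (Suc n) powr (- 1 / 2)) ^ DIM('a) = ?C * (real (Suc n) powr (- 1 / 2)) ^ DIM('a)"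
      by (rule power_mult_distrib)
    \<comment> \<open>Here the dimension enters: the base is at most 1 and the exponent at least 3,
      which leaves the summable power -3/2.\<close>
    also have "\<dots> \<le> ?C * (real (Suc n) powr (- 1 / 2)) ^ 3"
    proof (rule mult_left_mono)
      have "real (Suc n) powr (- 1 / 2) \<le> real (Suc n) powr 0" by (rule powr_mono) auto
      thus "(real (Suc n) powr (- 1 / 2)) ^ DIM('a) \<le> (real (Suc n) powr (- 1 / 2)) ^ 3"
        using d by (intro power_decreasing) auto
    qed (use \<beta> in simp)
    also have "(real (Suc n) powr (- 1 / 2)) ^ 3 = real (Suc n) powr (- 3 / 2)"
      by (simp add: powr_powr powr_realpow[symmetric])
    finally show "(\<integral>\<^sup>+p. ennreal (?h n p) \<partial>lborel) \<le> ennreal (?C * real (Suc n) powr (- 3 / 2))"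
      by (simp add: ennreal_leI)
  qed auto
  also have "\<dots> = ennreal (\<Sum>n. ?C * real (Suc n) powr (- 3 / 2))"
  proof (rule suminf_ennreal2)
    have "summable (\<lambda>n. real n powr (- 3 / 2))" by (subst summable_real_powr_iff) simp
    thus "summable (\<lambda>n. ?C * real (Suc n) powr (- 3 / 2))"
      by (intro summable_mult) (subst summable_Suc_iff)
  qed (use \<beta> in simp)
  also have "\<dots> < \<infinity>" by simp
  finally show "(\<integral>\<^sup>+p. ennreal (norm (bose \<beta> (p::'a))) \<partial>lborel) < \<infinity>" .
qed measurable

text \<open>Where \<open>exp (\<beta> * (norm p)\<^sup>2) < 2\<close> and p is not 0 the Bose factor
  is at least 1 and dominates its own root; elsewhere it is at most 4 exp(-\<beta> |p|^2), whose
  root is a Gaussian. Integrability of the root follows.\<close>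

lemma sqrt_bose_le:
  assumes "0 < \<beta>"
  shows "sqrt (bose \<beta> p) \<le> bose \<beta> p + 2 * exp (- (sqrt \<beta> * norm p)\<^sup>2 / 2)"
proof (cases "exp (\<beta> * (norm p)\<^sup>2) < 2")
  case True
  show ?thesis
  proof (cases "p = 0")
    case False
    hence "1 < exp (\<beta> * (norm p)\<^sup>2)" using assms by simp
    hence "1 \<le> bose \<beta> p" using True by (simp add: bose_def)
    hence "sqrt (bose \<beta> p) \<le> bose \<beta> p" by (simp add: real_le_lsqrt power2_eq_square)
    thus ?thesis by (simp add: add_increasing2)
  qed (simp add: bose_def)
next
  case False
  define a where "a = exp (\<beta> * (norm p)\<^sup>2 / 2)"
  have a: "exp (\<beta> * (norm p)\<^sup>2) = a\<^sup>2" "0 < a" by (simp_all add: a_def exp_double[symmetric])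
  have "bose \<beta> p \<le> (2 / a)\<^sup>2"
    using False a unfolding bose_def by (simp add: power_divide field_simps)
  hence "sqrt (bose \<beta> p) \<le> 2 / a" using a by (intro real_le_lsqrt) auto
  also have "2 / a = 2 * exp (- (sqrt \<beta> * norm p)\<^sup>2 / 2)"
  proof -
    have "(sqrt \<beta> * norm p)\<^sup>2 = \<beta> * (norm p)\<^sup>2" using assms by (simp add: power_mult_distrib)
    moreover have "2 / a = 2 * exp (- (\<beta> * (norm p)\<^sup>2 / 2))" by (simp add: a_def exp_minus inverse_eq_divide)
    ultimately show ?thesis by (simp only: minus_divide_left)
  qed
  finally show ?thesis using bose_nonneg[OF assms, of p] by simp
qed

lemma integrable_sqrt_bose:
  assumes \<beta>: "0 < \<beta>" and d: "2 < DIM('a::euclidean_space)"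
  shows "integrable lborel (\<lambda>p::'a. sqrt (bose \<beta> p))"
proof (rule Bochner_Integration.integrable_bound)
  show "integrable lborel (\<lambda>p::'a. bose \<beta> p + 2 * exp (- (sqrt \<beta> * norm p)\<^sup>2 / 2))"
    using \<beta> by (intro Bochner_Integration.integrable_add integrable_bose assms integrable_mult_right gaussian_integral) auto
  show "AE p::'a in lborel. norm (sqrt (bose \<beta> p)) \<le> norm (bose \<beta> p + 2 * exp (- (sqrt \<beta> * norm p)\<^sup>2 / 2))"
  proof (rule AE_I2)
    fix p :: 'a
    have "0 \<le> sqrt (bose \<beta> p)" using bose_nonneg[OF \<beta>, of p] by simp
    thus "norm (sqrt (bose \<beta> p)) \<le> norm (bose \<beta> p + 2 * exp (- (sqrt \<beta> * norm p)\<^sup>2 / 2))"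
      using sqrt_bose_le[OF \<beta>, of p] unfolding real_norm_def by linarith
  qed
qed measurable

section \<open>The operator W for a fixed test function, in momentum space\<close>

locale bose_test =
  fixes \<beta> :: real and f :: "'a::euclidean_space \<Rightarrow> real"
  assumes \<beta>: "0 < \<beta>" and dim: "2 < DIM('a)" and f: "test_function f"
begin

abbreviation "w \<equiv> sqrt_weight f"
abbreviation "\<tau> \<equiv> sqnorm w"
abbreviation "W \<equiv> W_op \<beta> f"
abbreviation "K \<equiv> K_op \<beta> f"

lemma f_measurable[measurable]: "f \<in> borel_measurable borel" and f_nonneg: "0 \<le> f x"
  using f by (auto simp: test_function_def)

lemma w_measurable[measurable]: "w \<in> borel_measurable borel"
  unfolding sqrt_weight_def by measurable

lemma cnj_w [simp]: "cnj (w x) = w x"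
  by (simp add: sqrt_weight_def)

lemma norm_w_sq: "(norm (w x))\<^sup>2 = 1 - exp (- f x)"
  using f_nonneg[of x] by (simp add: sqrt_weight_def)

lemma norm_w_le: "norm (w x) \<le> 1"
proof -
  have "(norm (w x))\<^sup>2 \<le> 1" unfolding norm_w_sq by simp
  thus ?thesis using power2_le_imp_le[of "norm (w x)" 1] by simp
qed

lemma L2_w: "L2 w"
proof (rule L2_bound)
  let ?S = "closure {x. f x \<noteq> 0}"
  have "compact ?S" using f by (simp add: test_function_def compactly_supported_def)
  thus "integrable lborel (indicator ?S :: 'a \<Rightarrow> real)"
    by (intro integrable_real_indicator emeasure_compact_finite) auto
  have "(norm (w x))\<^sup>2 \<le> indicator ?S x" for x
    unfolding norm_w_sq using closure_subset[of "{x. f x \<noteq> 0}"] by (cases "f x = 0") (auto simp: indicator_def)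
  thus "AE x in lborel. (norm (w x))\<^sup>2 \<le> indicator ?S x" by simp
qed simp

lemma L2_w_mult: "L2 u \<Longrightarrow> L2 (\<lambda>x. w x * u x)"
  by (rule L2_bounded_mult[OF _ w_measurable norm_w_le])

lemma integrable_w_mult: "L2 u \<Longrightarrow> integrable lborel (\<lambda>x. w x * u x)"
  using integrable_inner_L2[OF L2_w, of u] by simp

lemma L1_w_mult_le: "L2 u \<Longrightarrow> (\<integral>x. norm (w x * u x) \<partial>lborel)\<^sup>2 \<le> \<tau> * sqnorm u"
proof -
  assume "L2 u"
  hence "(\<integral>x. norm (w x * u x) \<partial>lborel) \<le> sqrt \<tau> * sqrt (sqnorm u)"
    using integral_mult_le[OF L2_w] by (simp add: norm_mult)
  from power_mono[OF this, of 2] show ?thesis by (simp add: power_mult_distrib)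
qed

definition "sb p = complex_of_real (sqrt (bose \<beta> (p :: 'a)))"

lemma sb_integrable: "integrable lborel sb"
  using integrable_sqrt_bose[OF \<beta> dim] unfolding sb_def by simp

lemma norm_sb_sq: "(norm (sb p))\<^sup>2 = bose \<beta> p"
  using bose_nonneg[OF \<beta>, of p] by (simp add: sb_def)

lemma L2_sb: "L2 sb"
  using integrable_bose[OF \<beta> dim] borel_measurable_integrable[OF sb_integrable]
  by (intro L2_I) (auto simp: norm_sb_sq)

text \<open>The momentum-space form of \<open>W u\<close>, built from the explicit integral instead
  of \<open>fourier_L2\<close>; being defined pointwise, it can be continuous.\<close>

definition "q u p = sb p * (complex_of_real (fourier_const TYPE('a)) * ft (- 1) (\<lambda>x. w x * u x) p)"

lemma q_integrable: "L2 u \<Longrightarrow> integrable lborel (q u)"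
  using integrable_mult_right[OF integrable_mult_ft[OF sb_integrable integrable_w_mult], of "complex_of_real (fourier_const TYPE('a))" u "- 1"]
  unfolding q_def by (simp add: mult_ac)

lemma norm_q_sq: "(norm (q u p))\<^sup>2 = bose \<beta> p * (norm (ft (- 1) (\<lambda>x. w x * u x) p))\<^sup>2 / (2 * pi) ^ DIM('a)"
  using fourier_const_sq[where 'a='a] by (simp add: q_def norm_mult power_mult_distrib norm_sb_sq)

lemma integrable_bose_ft:
  assumes "integrable lborel h"
  shows "integrable lborel (\<lambda>p::'a. bose \<beta> p * (norm (ft s h p))\<^sup>2)"
proof (rule Bochner_Integration.integrable_bound)
  show "integrable lborel (\<lambda>p::'a. (\<integral>x. norm (h x) \<partial>lborel)\<^sup>2 * bose \<beta> p)"
    using integrable_bose[OF \<beta> dim] by simp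
  show "(\<lambda>p. bose \<beta> p * (norm (ft s h p))\<^sup>2) \<in> borel_measurable lborel"
    using assms by measurable
  show "AE p in lborel. norm (bose \<beta> p * (norm (ft s h p))\<^sup>2) \<le> norm ((\<integral>x. norm (h x) \<partial>lborel)\<^sup>2 * bose \<beta> p)"
    using bose_nonneg[OF \<beta>] norm_ft_le[OF assms, of s]
    by (intro AE_I2) (simp add: mult.commute abs_mult mult_left_mono power_mono)
qed

lemma L2_q: "L2 u \<Longrightarrow> L2 (q u)"
  using borel_measurable_integrable[OF q_integrable] integrable_bose_ft[OF integrable_w_mult]
  by (intro L2_I) (auto simp: norm_q_sq)

text \<open>Supplies the continuity hypothesis of \<open>Plancherel_ft\<close>. The only bad point
  is the origin, where the Bose factor is singular.\<close>

lemma AE_isCont_q: "L2 u \<Longrightarrow> AE p in lborel. isCont (q u) p"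
proof -
  assume u: "L2 u"
  show "AE p in lborel. isCont (q u) p"
    using AE_lborel_singleton[of "0::'a"]
  proof eventually_elim
    case (elim p)
    show ?case unfolding q_def sb_def
      by (intro continuous_intros isCont_bose[OF \<beta> elim] isCont_ft integrable_w_mult u isCont_o2[OF _ isCont_real_sqrt])
  qed
qed

lemma W_op_eq_inv_fourier:
  "W u = inv_fourier_L2 (\<lambda>p. sb p * fourier_L2 (\<lambda>x. w x * u x) p)"
  unfolding W_op_def fun_heat_def fun_laplacian_def comp_def sqrt_heat_symbol sb_def ..

lemma W_op_eq_ft:
  assumes u: "L2 u"
  shows "L2 (W u)" and "AE x in lborel. W u x = complex_of_real (fourier_const TYPE('a)) * ft 1 (q u) x"
proof -
  let ?q = "\<lambda>p. sb p * fourier_L2 (\<lambda>x. w x * u x) p"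
  note F = fourier_L2_eq_ft[OF L2_w_mult[OF u] integrable_w_mult[OF u]]
  have [measurable]: "sb \<in> borel_measurable borel" "fourier_L2 (\<lambda>x. w x * u x) \<in> borel_measurable borel"
      "q u \<in> borel_measurable borel"
    using sb_integrable F(1) L2_q[OF u] by auto
  have ae: "AE p in lborel. q u p = ?q p"
    using F(2) by eventually_elim (simp add: q_def)
  have q2: "L2 ?q" by (rule L2_cong_AE[OF L2_q[OF u] _ ae]) measurable
  have qi: "integrable lborel ?q"
    by (rule integrable_cong_AE_imp[OF q_integrable[OF u]]) (use ae in \<open>auto elim!: eventually_mono\<close>)
  show "L2 (W u)" unfolding W_op_eq_inv_fourier by (rule inv_fourier_L2_eq_ft(1)[OF q2 qi])
  have "ft 1 ?q x = ft 1 (q u) x" for x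
    unfolding ft_def by (rule integral_cong_AE) (use ae in \<open>auto elim!: eventually_mono\<close>)
  thus "AE x in lborel. W u x = complex_of_real (fourier_const TYPE('a)) * ft 1 (q u) x"
    using inv_fourier_L2_eq_ft(2)[OF q2 qi] unfolding W_op_eq_inv_fourier by simp
qed

lemma L2_fc_ft_q: "L2 u \<Longrightarrow> L2 (\<lambda>x. complex_of_real (fourier_const TYPE('a)) * ft 1 (q u) x)"
  by (intro L2_cmult ft_L2 q_integrable L2_q) auto

text \<open>This is the quadratic form of K_f as an integral against the Bose factor; both the trace
  and the norm of K_f are computed from it.\<close>

lemma sqnorm_W:
  assumes u: "L2 u"
  shows "sqnorm (W u) = (\<integral>p. bose \<beta> p * (norm (ft (- 1) (\<lambda>x. w x * u x) p))\<^sup>2 \<partial>lborel) / (2 * pi) ^ DIM('a)"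
proof -
  have "sqnorm (W u) = sqnorm (\<lambda>x. complex_of_real (fourier_const TYPE('a)) * ft 1 (q u) x)"
    by (rule sqnorm_cong_AE[OF W_op_eq_ft(2)[OF u]]) (use W_op_eq_ft(1)[OF u] L2_fc_ft_q[OF u] in auto)
  also have "\<dots> = sqnorm (q u)"
    by (simp add: sqnorm_fourier_const Plancherel_ft q_integrable L2_q u AE_isCont_q)
  finally show ?thesis by (simp add: sqnorm_def norm_q_sq)
qed

text \<open>Linearity holds only almost everywhere, because the transforms inside
  \<open>W_op\<close> are arbitrarily chosen representatives.\<close>

lemma W_diff:
  assumes u: "L2 u" and v: "L2 v"
  shows "AE x in lborel. W (\<lambda>x. u x - v x) x = W u x - W v x"
proof -
  have "(\<lambda>x. w x * (u x - v x)) = (\<lambda>x. w x * u x - w x * v x)" by (simp add: right_diff_distrib)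
  hence "q (\<lambda>x. u x - v x) = (\<lambda>p. q u p - q v p)"
    by (simp add: q_def[abs_def] ft_diff integrable_w_mult u v right_diff_distrib)
  hence *: "ft 1 (q (\<lambda>x. u x - v x)) x = ft 1 (q u) x - ft 1 (q v) x" for x
    by (simp add: ft_diff q_integrable u v)
  show ?thesis
    using W_op_eq_ft(2)[OF L2_diff[OF u v]] W_op_eq_ft(2)[OF u] W_op_eq_ft(2)[OF v]
    by eventually_elim (simp add: * right_diff_distrib)
qed

text \<open>The convolution kernel of $(G(1-G)^{-1})^{1/2}$.\<close>

definition "m x = (complex_of_real (fourier_const TYPE('a)))\<^sup>2 * ft 1 sb x"

lemma L2_m: "L2 m"
  unfolding m_def by (intro L2_cmult ft_L2 sb_integrable L2_sb) simp

lemma m_measurable[measurable]: "m \<in> borel_measurable borel"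
  using L2_m by auto

text \<open>The multiplication formula, applied to the symbol times a character, exhibits W_f as an
  integral operator with kernel m(x - y) w(y). This makes its adjoint explicit.\<close>

lemma ft_q_eq_convolution:
  assumes u: "L2 u"
  shows "complex_of_real (fourier_const TYPE('a)) * ft 1 (q u) x = (\<integral>y. m (x - y) * (w y * u y) \<partial>lborel)"
proof -
  let ?k = "\<lambda>p. cis (1 * (x \<bullet> p)) * sb p"
  have k: "integrable lborel ?k" by (rule ft_integrable[OF sb_integrable])
  have kf: "ft (- 1) ?k y = ft 1 sb (x - y)" for y
    unfolding ft_def by (simp add: mult.assoc[symmetric] cis_mult inner_diff_left)
  have "complex_of_real (fourier_const TYPE('a)) * ft 1 (q u) x = (complex_of_real (fourier_const TYPE('a)))\<^sup>2 * (\<integral>p. ?k p * ft (- 1) (\<lambda>y. w y * u y) p \<partial>lborel)"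
    unfolding ft_def[of 1] q_def integral_mult_right_zero[symmetric] by (simp add: power2_eq_square mult_ac)
  also have "(\<integral>p. ?k p * ft (- 1) (\<lambda>y. w y * u y) p \<partial>lborel) = (\<integral>y. (w y * u y) * ft (- 1) ?k y \<partial>lborel)"
    by (rule ft_multiplication[OF k integrable_w_mult[OF u]])
  finally show ?thesis
    unfolding kf m_def integral_mult_right_zero[symmetric] by (simp add: mult_ac)
qed

section \<open>The adjoint of W and the operator K\<close>

lemma L2_m_shift: "L2 (\<lambda>x. m (x - y))" "sqnorm (\<lambda>x. m (x - y)) = sqnorm m"
proof -
  have "integrable lborel (\<lambda>x. (norm (m (- y + 1 *\<^sub>R x)))\<^sup>2)"
    by (rule integrable_lborel_affine[OF L2_integrable[OF L2_m]]) simp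
  thus "L2 (\<lambda>x. m (x - y))" by (intro L2_I) auto
  show "sqnorm (\<lambda>x. m (x - y)) = sqnorm m"
    unfolding sqnorm_def
    by (subst integral_lborel_affine[of "\<lambda>x. (norm (m x))\<^sup>2" 1 "- y"]) auto
qed

text \<open>\<open>S\<close> is the integral operator with the conjugate transposed kernel, a
  witness for the choice in \<open>adjoint_L2\<close>. All translates of \<open>m\<close> have the
  same norm, so the inner product is bounded in \<open>y\<close> and multiplication by
  \<open>w\<close> brings it into L2. The same Cauchy-Schwarz bound justifies Fubini.\<close>

lemma adjoint_candidate:
  assumes u: "L2 u"
  defines "S \<equiv> \<lambda>y. w y * inner_L2 (\<lambda>x. m (x - y)) u"
  shows "L2 S" and "L2 v \<Longrightarrow> inner_L2 S v = inner_L2 u (W v)"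
proof -
  note [measurable] = L2_measurable[OF u]
  have bound: "norm (inner_L2 (\<lambda>x. m (x - y)) u) \<le> sqrt (sqnorm m) * sqrt (sqnorm u)" for y
    using Cauchy_Schwarz_L2[OF L2_m_shift(1) u, of y] by (simp add: L2_m_shift)
  have [measurable]: "(\<lambda>y. inner_L2 (\<lambda>x. m (x - y)) u) \<in> borel_measurable borel"
    unfolding inner_L2_def by measurable
  have "L2 (\<lambda>y. inner_L2 (\<lambda>x. m (x - y)) u * w y)"
    by (rule L2_bounded_mult[OF L2_w _ bound]) measurable
  thus "L2 S" by (simp add: S_def mult.commute)
  assume v: "L2 v"
  note [measurable] = L2_measurable[OF v]
  have "integrable (lborel \<Otimes>\<^sub>M lborel) (\<lambda>(y, x). (w y * v y) * (m (x - y) * cnj (u x)))"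
  proof (rule lborel_pair.Fubini_integrable)
    have i: "integrable lborel (\<lambda>x. norm (m (x - y)) * norm (u x))" for y
      by (rule integrable_L2_mult[OF L2_m_shift(1) u])
    have mm: "(\<lambda>x. m (x - y) * cnj (u x)) \<in> borel_measurable lborel" for y by measurable
    show "AE y in lborel. integrable lborel (\<lambda>x. case (y, x) of (y, x) \<Rightarrow> w y * v y * (m (x - y) * cnj (u x)))"
      by (intro AE_I2, simp only: prod.case, intro integrable_mult_right, subst integrable_norm_iff[symmetric])
        (use mm i in \<open>auto simp: norm_mult\<close>)
    show "integrable lborel (\<lambda>y. \<integral>x. norm (case (y, x) of (y, x) \<Rightarrow> w y * v y * (m (x - y) * cnj (u x))) \<partial>lborel)"
    proof (rule Bochner_Integration.integrable_bound)
      show "integrable lborel (\<lambda>y. norm (w y * v y) * (sqrt (sqnorm m) * sqrt (sqnorm u)))"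
        by (intro integrable_mult_left integrable_norm integrable_w_mult v)
      show "AE y in lborel. norm (\<integral>x. norm (case (y, x) of (y, x) \<Rightarrow> w y * v y * (m (x - y) * cnj (u x))) \<partial>lborel)
          \<le> norm (norm (w y * v y) * (sqrt (sqnorm m) * sqrt (sqnorm u)))"
      proof (rule AE_I2)
        fix y
        have "(\<integral>x. norm (case (y, x) of (y, x) \<Rightarrow> w y * v y * (m (x - y) * cnj (u x))) \<partial>lborel)
            = norm (w y * v y) * (\<integral>x. norm (m (x - y)) * norm (u x) \<partial>lborel)"
          by (simp add: norm_mult)
        also have "\<dots> \<le> norm (w y * v y) * (sqrt (sqnorm m) * sqrt (sqnorm u))"
          using integral_mult_le[OF L2_m_shift(1) u, of y] by (intro mult_left_mono) (auto simp: L2_m_shift)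
        finally show "norm (\<integral>x. norm (case (y, x) of (y, x) \<Rightarrow> w y * v y * (m (x - y) * cnj (u x))) \<partial>lborel)
          \<le> norm (norm (w y * v y) * (sqrt (sqnorm m) * sqrt (sqnorm u)))"
          by (simp add: Bochner_Integration.integral_nonneg)
      qed
    qed measurable
  qed measurable
  note Fub = lborel_pair.Fubini_integral[OF this]
  have "inner_L2 S v = (\<integral>y. \<integral>x. (w y * v y) * (m (x - y) * cnj (u x)) \<partial>lborel \<partial>lborel)"
    unfolding inner_L2_def S_def complex_cnj_mult Bochner_Integration.integral_cnj[symmetric]
    by (subst integral_mult_right_zero[symmetric] | subst integral_mult_left_zero[symmetric])+ (simp add: mult_ac)
  also have "\<dots> = (\<integral>x. \<integral>y. (w y * v y) * (m (x - y) * cnj (u x)) \<partial>lborel \<partial>lborel)"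
    by (rule Fub[symmetric])
  also have "\<dots> = (\<integral>x. cnj (u x) * (complex_of_real (fourier_const TYPE('a)) * ft 1 (q v) x) \<partial>lborel)"
    unfolding ft_q_eq_convolution[OF v] by (subst integral_mult_right_zero[symmetric]) (simp add: mult_ac)
  also have "\<dots> = inner_L2 u (\<lambda>x. complex_of_real (fourier_const TYPE('a)) * ft 1 (q v) x)" by (simp add: inner_L2_def)
  also have "\<dots> = inner_L2 u (W v)"
    by (rule inner_L2_cong_AE) (use W_op_eq_ft[OF v] L2_fc_ft_q[OF v] in \<open>auto elim!: eventually_mono\<close>)
  finally show "inner_L2 S v = inner_L2 u (W v)" .
qed

lemma adjoint_W:
  assumes u: "L2 u"
  shows "L2 (adjoint_L2 W u)" and "L2 v \<Longrightarrow> inner_L2 (adjoint_L2 W u) v = inner_L2 u (W v)"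
proof -
  let ?P = "\<lambda>S. \<forall>u. L2 u \<longrightarrow> L2 (S u) \<and> (\<forall>v. L2 v \<longrightarrow> inner_L2 (S u) v = inner_L2 u (W v))"
  have "?P (\<lambda>u y. w y * inner_L2 (\<lambda>x. m (x - y)) u)"
    using adjoint_candidate by blast
  hence "?P (adjoint_L2 W)" unfolding adjoint_L2_def by (rule someI[of ?P])
  thus "L2 (adjoint_L2 W u)" "L2 v \<Longrightarrow> inner_L2 (adjoint_L2 W u) v = inner_L2 u (W v)"
    using u by blast+
qed

lemma L2_K: "L2 u \<Longrightarrow> L2 (K u)"
  unfolding K_op_def by (intro adjoint_W W_op_eq_ft)

text \<open>Together with \<open>L2_K\<close> this is all that the later arguments use of
  \<open>K\<close>: matrix entries of \<open>K\<close> become inner products of images under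
  \<open>W\<close>.\<close>

lemma inner_K:
  assumes "L2 u" "L2 v"
  shows "inner_L2 v (K u) = inner_L2 (W v) (W u)"
  using adjoint_W(2)[OF W_op_eq_ft(1)[OF assms(1)] assms(2)]
    inner_L2_commute[of v "K u"] inner_L2_commute[of "W v" "W u"]
  by (simp add: K_op_def)

text \<open>The integral in \<open>sqnorm_W\<close> is split at the level \<open>M\<close> of the
  Bose factor. Below it the factor is replaced by \<open>M\<close>, and \<open>ft_L2\<close>
  together with the bound \<open>b\<close> for |w|^2 gives the first term. Above it the transform is
  bounded pointwise by the L1 norm of \<open>w u\<close>, whose square is at most
  \<open>\<tau> * sqnorm u\<close>.\<close>

lemma sqnorm_W_le:
  assumes u: "L2 u" and b: "\<And>x. 1 - exp (- f x) \<le> b" and M: "0 \<le> M"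
  shows "sqnorm (W u) \<le> (M * b + \<tau> * (\<integral>p. indicator {p. M < bose \<beta> p} p * bose \<beta> (p :: 'a) \<partial>lborel) / (2 * pi) ^ DIM('a)) * sqnorm u"
proof -
  let ?wu = "\<lambda>x. w x * u x" and ?I = "\<lambda>p::'a. indicator {p. M < bose \<beta> p} p * bose \<beta> p"
  let ?N = "(\<integral>x. norm (?wu x) \<partial>lborel)\<^sup>2"
  let ?c = "(2 * pi) ^ DIM('a)"
  have c: "0 < ?c" by simp
  have I: "integrable lborel ?I"
    using integrable_mult_indicator[OF _ integrable_bose[OF \<beta> dim], of "{p. M < bose \<beta> p}"] by simp
  have I0: "0 \<le> (\<integral>p. ?I p \<partial>lborel)"
    by (intro Bochner_Integration.integral_nonneg mult_nonneg_nonneg bose_nonneg[OF \<beta>]) simp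
  have F: "L2 (ft (- 1) ?wu)" by (intro ft_L2 integrable_w_mult L2_w_mult u) simp
  have "(\<integral>p. bose \<beta> p * (norm (ft (- 1) ?wu p))\<^sup>2 \<partial>lborel) \<le> (\<integral>p. M * (norm (ft (- 1) ?wu p))\<^sup>2 + ?I p * ?N \<partial>lborel)"
  proof (rule integral_mono)
    show "integrable lborel (\<lambda>p. bose \<beta> p * (norm (ft (- 1) ?wu p))\<^sup>2)"
      by (intro integrable_bose_ft integrable_w_mult u)
    show "integrable lborel (\<lambda>p. M * (norm (ft (- 1) ?wu p))\<^sup>2 + ?I p * ?N)"
      by (intro Bochner_Integration.integrable_add integrable_mult_right integrable_mult_left L2_integrable F I)
    fix p :: 'a
    have n: "(norm (ft (- 1) ?wu p))\<^sup>2 \<le> ?N" by (intro power_mono norm_ft_le integrable_w_mult u) auto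
    show "bose \<beta> p * (norm (ft (- 1) ?wu p))\<^sup>2 \<le> M * (norm (ft (- 1) ?wu p))\<^sup>2 + ?I p * ?N"
    proof (cases "M < bose \<beta> p")
      case True
      have "bose \<beta> p * (norm (ft (- 1) ?wu p))\<^sup>2 \<le> bose \<beta> p * ?N"
        by (intro mult_left_mono n bose_nonneg \<beta>)
      thus ?thesis using True M by (simp add: add_increasing)
    qed (auto intro: mult_right_mono)
  qed
  also have "\<dots> = M * sqnorm (ft (- 1) ?wu) + (\<integral>p. ?I p \<partial>lborel) * ?N"
    using L2_integrable[OF F] I by (subst Bochner_Integration.integral_add) (auto simp: sqnorm_def)
  also have "\<dots> \<le> M * (?c * (b * sqnorm u)) + (\<integral>p. ?I p \<partial>lborel) * (\<tau> * sqnorm u)"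
  proof (intro add_mono mult_left_mono M I0 L1_w_mult_le u)
    have "sqnorm ?wu \<le> b * sqnorm u"
      unfolding sqnorm_def integral_mult_right_zero[symmetric]
    proof (rule integral_mono)
      show "integrable lborel (\<lambda>x. (norm (?wu x))\<^sup>2)" by (intro L2_integrable L2_w_mult u)
      show "integrable lborel (\<lambda>x. b * (norm (u x))\<^sup>2)" by (intro integrable_mult_right L2_integrable u)
    qed (use b in \<open>simp add: norm_mult power_mult_distrib norm_w_sq mult_right_mono\<close>)
    thus "sqnorm (ft (- 1) ?wu) \<le> ?c * (b * sqnorm u)"
      using ft_L2(2)[OF integrable_w_mult[OF u] L2_w_mult[OF u], of "- 1"] c
      by (simp add: order_trans[OF _ mult_left_mono])
  qed
  finally show ?thesis
    unfolding sqnorm_W[OF u] using c by (simp add: field_simps)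
qed

end

text \<open>The zero set is closed and of full measure, hence everything.\<close>

lemma continuous_AE_zero:
  fixes h :: "'a::euclidean_space \<Rightarrow> complex"
  assumes "\<And>p. isCont h p" "AE p in lborel. h p = 0"
  shows "h p = 0"
proof -
  have "closed {p. h p = 0}"
    using assms(1) by (intro closed_Collect_eq continuous_at_imp_continuous_on continuous_on_const) auto
  moreover have "AE p in lebesgue. p \<in> {p. h p = 0}"
    using assms(2) by (intro AE_completion) simp
  ultimately show ?thesis using mem_closed_if_AE_lebesgue by fastforce
qed

context bose_test
begin

section \<open>The trace of K\<close>

lemma critical_density_eq: "critical_density TYPE('a) \<beta> = (\<integral>p. bose \<beta> (p :: 'a) \<partial>lborel) / (2 * pi) ^ DIM('a)"
  by (simp only: critical_density_def bose_def integral_divide_zero)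

lemma critical_density_nonneg: "0 \<le> critical_density TYPE('a) \<beta>"
  unfolding critical_density_eq
  by (intro divide_nonneg_pos Bochner_Integration.integral_nonneg bose_nonneg \<beta>) simp

text \<open>The weight makes the wave an L2 vector, with the same norm for every momentum. The
  transform of \<open>w u\<close> at \<open>p\<close> is then the coefficient of \<open>u\<close>
  along it, which is what Parseval sums.\<close>

definition "plane_wave p x = cis (p \<bullet> x) * w (x :: 'a)"

lemma ft_eq_inner_plane_wave: "ft (- 1) (\<lambda>x. w x * u x) p = inner_L2 (plane_wave p) u"
  by (simp add: ft_def inner_L2_def plane_wave_def cis_cnj mult.assoc)

lemma L2_plane_wave: "L2 (plane_wave p)" "sqnorm (plane_wave p) = \<tau>"
proof -
  have "plane_wave p \<in> borel_measurable borel" unfolding plane_wave_def by measurable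
  thus "L2 (plane_wave p)"
    using L2_integrable[OF L2_w] by (intro L2_I) (auto simp: plane_wave_def norm_mult)
qed (simp add: sqnorm_def plane_wave_def norm_mult)

text \<open>The Hilbert--Schmidt norm of $W_f$, by Parseval for each momentum \<open>p\<close>.  Only countably many
  basis vectors contribute: if $W_f e = 0$ then the continuous function $p \mapsto \widehat{w e}(p)$
  vanishes identically.\<close>

lemma has_sum_sqnorm_W:
  assumes B: "orthonormal_basis_L2 B"
  shows "((\<lambda>e. sqnorm (W e)) has_sum (critical_density TYPE('a) \<beta> * \<tau>)) B"
proof -
  note O = orthonormal_basis_L2_orthonormal[OF B]
  have L2B: "L2 e" if "e \<in> B" for e using O that by (simp add: orthonormal_L2_def)
  let ?c = "(2 * pi) ^ DIM('a)"
  let ?h = "\<lambda>p e. (norm (inner_L2 e (plane_wave p)))\<^sup>2"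
  have h: "(norm (ft (- 1) (\<lambda>x. w x * e x) p))\<^sup>2 = ?h p e" for p e
    unfolding ft_eq_inner_plane_wave by (subst inner_L2_commute) simp
  have hi: "integrable lborel (\<lambda>p. bose \<beta> p * ?h p e)" if "e \<in> B" for e
    using integrable_bose_ft[OF integrable_w_mult[OF L2B[OF that]], of "- 1"] by (simp only: h)
  have We: "sqnorm (W e) = (\<integral>p. bose \<beta> p * ?h p e \<partial>lborel) / ?c" if "e \<in> B" for e
    using sqnorm_W[OF L2B[OF that]] by (simp only: h)
  have hsum: "(?h p has_sum \<tau>) B" for p
    using Parseval_L2[OF B L2_plane_wave(1)[of p]] by (simp add: L2_plane_wave(2))
  have hle: "sum (?h p) F \<le> \<tau>" if "finite F" "F \<subseteq> B" for p F
    using Bessel_L2[OF orthonormal_L2_subset[OF O that(2)] that(1) L2_plane_wave(1)[of p]] by (simp add: L2_plane_wave(2))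
  have sumW: "(\<Sum>e\<in>F. sqnorm (W e)) = (\<integral>p. bose \<beta> p * sum (?h p) F \<partial>lborel) / ?c" if "finite F" "F \<subseteq> B" for F
  proof -
    have "(\<Sum>e\<in>F. sqnorm (W e)) = (\<Sum>e\<in>F. (\<integral>p. bose \<beta> p * ?h p e \<partial>lborel) / ?c)"
      using that by (intro sum.cong We refl) auto
    also have "\<dots> = (\<integral>p. (\<Sum>e\<in>F. bose \<beta> p * ?h p e) \<partial>lborel) / ?c"
      using that hi by (subst Bochner_Integration.integral_sum) (auto simp: sum_divide_distrib)
    finally show ?thesis by (simp only: sum_distrib_left)
  qed
  have sumi: "integrable lborel (\<lambda>p. bose \<beta> p * sum (?h p) F)" if "F \<subseteq> B" for F
    unfolding sum_distrib_left using hi that by (intro Bochner_Integration.integrable_sum) auto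
  \<comment> \<open>Bessel's inequality under the integral gives summability and one inequality; the
    reverse one comes from dominated convergence along \<open>H\<close>.\<close>
  have sumle: "(\<Sum>e\<in>F. sqnorm (W e)) \<le> critical_density TYPE('a) \<beta> * \<tau>" if "finite F" "F \<subseteq> B" for F
  proof -
    have "(\<integral>p. bose \<beta> p * sum (?h p) F \<partial>lborel) \<le> (\<integral>p. bose \<beta> (p::'a) * \<tau> \<partial>lborel)"
    proof (rule integral_mono)
      show "integrable lborel (\<lambda>p. bose \<beta> p * sum (?h p) F)" by (rule sumi[OF that(2)])
      show "integrable lborel (\<lambda>p::'a. bose \<beta> p * \<tau>)" by (intro integrable_mult_left integrable_bose \<beta> dim)
      show "bose \<beta> p * sum (?h p) F \<le> bose \<beta> p * \<tau>" for p
        by (intro mult_left_mono hle that bose_nonneg \<beta>)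
    qed
    thus ?thesis unfolding sumW[OF that] critical_density_eq by (simp add: divide_right_mono)
  qed
  define s where "s = infsum (\<lambda>e. sqnorm (W e)) B"
  have summ: "(\<lambda>e. sqnorm (W e)) summable_on B"
    by (rule nonneg_bdd_above_summable_on) (auto intro!: bdd_aboveI2 sumle)
  have s_le: "s \<le> critical_density TYPE('a) \<beta> * \<tau>" unfolding s_def by (rule infsum_le_finite_sums[OF summ sumle])
  define B' where "B' = {e\<in>B. sqnorm (W e) \<noteq> 0}"
  have cB: "countable B'" unfolding B'_def by (rule summable_countable_real[OF summ])
  have B'B: "B' \<subseteq> B" by (auto simp: B'_def)
  have zero: "?h p e = 0" if e: "e \<in> B - B'" for p e
  proof -
    have eB: "e \<in> B" using e by simp
    have "sqnorm (W e) = 0" using e by (simp add: B'_def)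
    hence "(\<integral>p. bose \<beta> p * ?h p e \<partial>lborel) = 0" using We[OF eB] by simp
    moreover have "AE p in lborel. 0 \<le> bose \<beta> p * ?h p e"
      by (intro AE_I2 mult_nonneg_nonneg bose_nonneg \<beta>) simp
    ultimately have "AE p in lborel. bose \<beta> p * ?h p e = 0"
      using integral_nonneg_eq_0_iff_AE[OF hi[OF eB]] by blast
    hence "AE p in lborel. ft (- 1) (\<lambda>x. w x * e x) p = 0"
      using AE_lborel_singleton[of "0::'a"]
    proof eventually_elim
      case (elim p)
      hence "?h p e = 0" using bose_pos[OF \<beta>, of p] by simp
      thus ?case by (simp only: h[symmetric]) simp
    qed
    hence "ft (- 1) (\<lambda>x. w x * e x) p = 0" for p
      by (intro continuous_AE_zero isCont_ft integrable_w_mult L2B eB)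
    thus ?thesis by (simp add: h[symmetric])
  qed
  \<comment> \<open>An enumeration of the contributing vectors turns the limit over finite sets into
    a limit over \<open>n\<close>, to which dominated convergence applies.\<close>
  define H where "H n = {e\<in>B'. to_nat_on B' e < n}" for n
  have H: "finite (H n)" "H n \<subseteq> B" for n
  proof -
    have "inj_on (to_nat_on B') (H n)" using inj_on_to_nat_on[OF cB] by (rule inj_on_subset) (auto simp: H_def)
    moreover have "to_nat_on B' ` H n \<subseteq> {..<n}" by (auto simp: H_def)
    ultimately show "finite (H n)" by (meson finite_lessThan finite_subset finite_imageD)
  qed (use B'B in \<open>auto simp: H_def\<close>)
  have filt: "filterlim H (finite_subsets_at_top B') sequentially"
    unfolding filterlim_def le_filter_def eventually_filtermap
  proof (intro allI impI)
    fix P assume "eventually P (finite_subsets_at_top B')"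
    then obtain X where X: "finite X" "X \<subseteq> B'" "\<And>Y. finite Y \<Longrightarrow> X \<subseteq> Y \<Longrightarrow> Y \<subseteq> B' \<Longrightarrow> P Y"
      by (auto simp: eventually_finite_subsets_at_top)
    define N where "N = (\<Sum>e\<in>X. Suc (to_nat_on B' e))"
    have "to_nat_on B' e < N" if "e \<in> X" for e
      using member_le_sum[of e X "\<lambda>e. Suc (to_nat_on B' e)"] X(1) that by (simp add: N_def)
    hence "P (H n)" if "n \<ge> N" for n
      using that X(2) H(1) by (intro X(3)) (auto simp: H_def intro: less_le_trans)
    thus "\<forall>\<^sub>F n in sequentially. P (H n)" by (auto simp: eventually_sequentially)
  qed
  have hlim: "(\<lambda>n. sum (?h p) (H n)) \<longlonglongrightarrow> \<tau>" for p
  proof -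
    have "(?h p has_sum \<tau>) B'"
      by (rule has_sum_cong_neutral[THEN iffD1, OF _ _ _ hsum[of p]]) (use zero B'B in auto)
    thus ?thesis unfolding has_sum_def by (rule filterlim_compose[OF _ filt])
  qed
  have "(\<lambda>n. \<integral>p. bose \<beta> p * sum (?h p) (H n) \<partial>lborel) \<longlonglongrightarrow> (\<integral>p. bose \<beta> (p::'a) * \<tau> \<partial>lborel)"
  proof (rule integral_dominated_convergence[where w="\<lambda>p. bose \<beta> p * \<tau>"])
    show "integrable lborel (\<lambda>p::'a. bose \<beta> p * \<tau>)" by (intro integrable_mult_left integrable_bose \<beta> dim)
    show "(\<lambda>p. bose \<beta> p * sum (?h p) (H n)) \<in> borel_measurable lborel" for n
      using sumi[OF H(2)] by (rule borel_measurable_integrable)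
    show "AE p in lborel. (\<lambda>n. bose \<beta> p * sum (?h p) (H n)) \<longlonglongrightarrow> bose \<beta> p * \<tau>"
      by (intro AE_I2 tendsto_mult tendsto_const hlim)
    show "AE p in lborel. norm (bose \<beta> p * sum (?h p) (H n)) \<le> bose \<beta> p * \<tau>" for n
    proof (rule AE_I2)
      fix p :: 'a
      have "0 \<le> bose \<beta> p * sum (?h p) (H n)" by (intro mult_nonneg_nonneg bose_nonneg \<beta> sum_nonneg) simp
      moreover have "bose \<beta> p * sum (?h p) (H n) \<le> bose \<beta> p * \<tau>" by (intro mult_left_mono hle H bose_nonneg \<beta>)
      ultimately show "norm (bose \<beta> p * sum (?h p) (H n)) \<le> bose \<beta> p * \<tau>" by simp
    qed
  qed simp
  hence "(\<lambda>n. \<Sum>e\<in>H n. sqnorm (W e)) \<longlonglongrightarrow> (\<integral>p. bose \<beta> (p::'a) * \<tau> \<partial>lborel) / ?c"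
    unfolding sumW[OF H] by (intro tendsto_divide tendsto_const) auto
  moreover have "(\<Sum>e\<in>H n. sqnorm (W e)) \<le> s" for n
    unfolding s_def using H by (intro finite_sum_le_infsum summ) auto
  ultimately have "(\<integral>p. bose \<beta> (p::'a) * \<tau> \<partial>lborel) / ?c \<le> s"
    by (intro LIMSEQ_le_const2) auto
  hence "critical_density TYPE('a) \<beta> * \<tau> \<le> s" by (simp add: critical_density_eq)
  thus ?thesis using s_le summ unfolding s_def by (metis antisym has_sum_infsum)
qed

end

text \<open>\<open>C\<close> bounds the squared norm of W_f, hence the norm of K_f. The limit 1/2
  makes the iteration for the inverse of 1 + K_f a contraction; for the test function s f the
  constant is \<open>s * C\<close>, so it is met for small s.\<close>

locale bose_test_bounded = bose_test +
  fixes C :: real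
  assumes sqnorm_W_le_C: "\<And>u. L2 u \<Longrightarrow> sqnorm (W_op \<beta> f u) \<le> C * sqnorm u"
    and C: "0 \<le> C" "C \<le> 1 / 2"
begin

text \<open>The hypothesis is what \<open>D\<close> = W* z gives, so this is the norm bound for the
  adjoint obtained by duality. Phrasing it through the inner product lets it apply both to
  \<open>K u\<close> and to a difference \<open>K u - K v\<close> of chosen representatives.\<close>

lemma sqnorm_le_of_inner_W:
  assumes D: "L2 D" and z: "L2 z" and inner: "inner_L2 D D = inner_L2 (W D) z"
  shows "sqnorm D \<le> C * sqnorm z"
proof -
  have "(sqnorm D)\<^sup>2 = (norm (inner_L2 (W D) z))\<^sup>2"
    using inner by (metis inner_L2_self norm_of_real power2_abs)
  also have "\<dots> \<le> sqnorm (W D) * sqnorm z"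
    by (intro Cauchy_Schwarz_L2_sq W_op_eq_ft D z)
  also have "\<dots> \<le> (C * sqnorm D) * sqnorm z"
    by (intro mult_right_mono sqnorm_W_le_C D) simp
  finally have *: "sqnorm D * sqnorm D \<le> sqnorm D * (C * sqnorm z)"
    by (simp add: power2_eq_square mult_ac)
  show ?thesis
  proof (cases "sqnorm D = 0")
    case True
    thus ?thesis using C by simp
  next
    case False
    hence "0 < sqnorm D" using sqnorm_nonneg[of D] by linarith
    thus ?thesis using * by (simp add: mult_le_cancel_left)
  qed
qed

lemma sqnorm_K_diff_le:
  assumes u: "L2 u" and v: "L2 v"
  shows "sqnorm (\<lambda>x. K u x - K v x) \<le> C * sqnorm (\<lambda>x. W u x - W v x)"
proof -
  define D where "D = (\<lambda>x. K u x - K v x)"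
  have D: "L2 D" unfolding D_def by (intro L2_diff L2_K u v)
  have "inner_L2 D D = inner_L2 D (K u) - inner_L2 D (K v)"
    by (subst (2) D_def) (intro inner_L2_diff_right D L2_K u v)
  also have "\<dots> = inner_L2 (W D) (\<lambda>x. W u x - W v x)"
    by (simp add: inner_K u v D inner_L2_diff_right W_op_eq_ft)
  finally show ?thesis
    unfolding D_def[symmetric] by (intro sqnorm_le_of_inner_W D L2_diff W_op_eq_ft u v)
qed

lemma sqnorm_K_le:
  assumes u: "L2 u"
  shows "sqnorm (K u) \<le> C * sqnorm (W u)"
  using u by (intro sqnorm_le_of_inner_W L2_K W_op_eq_ft inner_K)

lemma sqnorm_K_contraction:
  assumes u: "L2 u" and v: "L2 v"
  shows "sqnorm (\<lambda>x. K u x - K v x) \<le> 1 / 4 * sqnorm (\<lambda>x. u x - v x)"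
proof -
  have "sqnorm (\<lambda>x. W u x - W v x) = sqnorm (W (\<lambda>x. u x - v x))"
  proof (rule sqnorm_cong_AE)
    show "AE x in lborel. W u x - W v x = W (\<lambda>x. u x - v x) x"
      using W_diff[OF u v] by eventually_elim simp
  qed (use W_op_eq_ft(1)[OF L2_diff[OF u v]] W_op_eq_ft(1)[OF u] W_op_eq_ft(1)[OF v] in auto)
  also have "\<dots> \<le> C * sqnorm (\<lambda>x. u x - v x)" by (intro sqnorm_W_le_C L2_diff u v)
  finally have "sqnorm (\<lambda>x. K u x - K v x) \<le> C * (C * sqnorm (\<lambda>x. u x - v x))"
    using sqnorm_K_diff_le[OF u v] C(1) by (meson mult_left_mono order_trans)
  also have "\<dots> \<le> (1 / 2) * ((1 / 2) * sqnorm (\<lambda>x. u x - v x))"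
    using C by (intro mult_mono) auto
  finally show ?thesis by simp
qed

text \<open>$(1 + K_f)^{-1} w$ as the limit of the iteration $u \mapsto w - K_f u$.\<close>

lemma inv_one_plus_K:
  shows "L2 (inv_one_plus K w)" and "AE x in lborel. inv_one_plus K w x + K (inv_one_plus K w) x = w x"
proof -
  define u where "u = rec_nat (\<lambda>x. 0) (\<lambda>n v x. w x - K v x)"
  have u0: "u 0 = (\<lambda>x. 0)" and uS: "u (Suc n) = (\<lambda>x. w x - K (u n) x)" for n
    by (simp_all add: u_def)
  have L: "L2 (u n)" for n
    by (induction n) (auto simp: u0 uS intro!: L2_diff L2_w L2_K)
  \<comment> \<open>\<open>4 * \<tau>\<close> is the fixed point of b = 2 \<tau> + b / 2, the
    recursion that the next estimate yields.\<close>
  have bounded: "sqnorm (u n) \<le> 4 * \<tau>" for n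
  proof (induction n)
    case (Suc n)
    have "sqnorm (u (Suc n)) \<le> 2 * \<tau> + 2 * sqnorm (K (u n))"
      unfolding uS using sqnorm_add_le[OF L2_w, of "\<lambda>x. - 1 * K (u n) x"] L2_cmult[OF L2_K[OF L[of n]], of "- 1"]
        sqnorm_cmult[of "- 1" "K (u n)"] by simp
    also have "sqnorm (K (u n)) \<le> C * (C * sqnorm (u n))"
      using sqnorm_K_le[OF L] sqnorm_W_le_C[OF L] C(1) by (meson mult_left_mono order_trans)
    also have "\<dots> \<le> (1 / 2) * ((1 / 2) * sqnorm (u n))"
      using C by (intro mult_mono) auto
    finally show ?case using Suc by simp
  qed (simp add: u0 sqnorm_def)
  have contr: "sqnorm (\<lambda>x. u (n + k) x - u n x) \<le> (1 / 4) ^ n * (4 * \<tau>)" for n k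
  proof (induction n)
    case 0
    show ?case using bounded[of k] by (simp add: u0)
  next
    case (Suc n)
    have "sqnorm (\<lambda>x. u (Suc n + k) x - u (Suc n) x) = sqnorm (\<lambda>x. K (u (n + k)) x - K (u n) x)"
      by (subst sqnorm_minus_commute) (simp add: uS)
    also have "\<dots> \<le> 1 / 4 * sqnorm (\<lambda>x. u (n + k) x - u n x)" by (intro sqnorm_K_contraction L)
    finally show ?case using Suc by simp
  qed
  have "\<exists>v. L2 v \<and> (\<lambda>n. sqnorm (\<lambda>x. u n x - v x)) \<longlonglongrightarrow> 0"
  proof (rule L2_complete[OF L])
    fix \<epsilon> :: real assume e: "0 < \<epsilon>"
    have "(\<lambda>n. (1 / 4) ^ n * (4 * \<tau>)) \<longlonglongrightarrow> 0 * (4 * \<tau>)"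
      by (intro tendsto_mult LIMSEQ_power_zero tendsto_const) simp
    hence "\<forall>\<^sub>F n in sequentially. (1 / 4) ^ n * (4 * \<tau>) < \<epsilon>" using e by (intro order_tendstoD) auto
    then obtain N where N: "\<And>n. n \<ge> N \<Longrightarrow> (1 / 4) ^ n * (4 * \<tau>) < \<epsilon>" by (auto simp: eventually_sequentially)
    have *: "sqnorm (\<lambda>x. u m x - u n x) \<le> \<epsilon>" if "n \<ge> N" "m \<ge> n" for m n
      using contr[of n "m - n"] N[OF that(1)] that(2) by simp
    have "sqnorm (\<lambda>x. u m x - u n x) \<le> \<epsilon>" if "n \<ge> N" "m \<ge> N" for m n
      using *[of n m] *[of m n] that sqnorm_minus_commute[of "u m" "u n"] by (cases "m \<ge> n") auto
    thus "\<exists>N. \<forall>m\<ge>N. \<forall>n\<ge>N. sqnorm (\<lambda>x. u m x - u n x) \<le> \<epsilon>" by blast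
  qed
  then obtain v where v: "L2 v" and lim: "(\<lambda>n. sqnorm (\<lambda>x. u n x - v x)) \<longlonglongrightarrow> 0" by blast
  have "sqnorm (\<lambda>x. (v x + K v x) - w x) \<le> 0"
  proof (rule LIMSEQ_le[OF tendsto_const])
    show "(\<lambda>n. 2 * sqnorm (\<lambda>x. u (Suc n) x - v x) + 2 * (1 / 4 * sqnorm (\<lambda>x. u n x - v x))) \<longlonglongrightarrow> 0"
      using tendsto_add[OF tendsto_mult[OF tendsto_const[of 2] LIMSEQ_Suc[OF lim]]
          tendsto_mult[OF tendsto_const[of 2] tendsto_mult[OF tendsto_const[of "1/4"] lim]]] by simp
    have "sqnorm (\<lambda>x. (v x + K v x) - w x)
       \<le> 2 * sqnorm (\<lambda>x. u (Suc n) x - v x) + 2 * (1 / 4 * sqnorm (\<lambda>x. u n x - v x))" for n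
    proof -
      have "(\<lambda>x. (v x + K v x) - w x) = (\<lambda>x. (v x - u (Suc n) x) + (K v x - K (u n) x))"
        by (rule ext) (simp add: uS)
      hence "sqnorm (\<lambda>x. (v x + K v x) - w x)
          \<le> 2 * sqnorm (\<lambda>x. v x - u (Suc n) x) + 2 * sqnorm (\<lambda>x. K v x - K (u n) x)"
        using sqnorm_add_le[OF L2_diff[OF v L[of "Suc n"]] L2_diff[OF L2_K[OF v] L2_K[OF L[of n]]]] by (simp only:)
      thus ?thesis
        using sqnorm_K_contraction[OF v L[of n]] sqnorm_minus_commute[of v "u n"] sqnorm_minus_commute[of v "u (Suc n)"]
        by simp
    qed
    thus "\<exists>N. \<forall>n\<ge>N. sqnorm (\<lambda>x. (v x + K v x) - w x)
       \<le> 2 * sqnorm (\<lambda>x. u (Suc n) x - v x) + 2 * (1 / 4 * sqnorm (\<lambda>x. u n x - v x))" by blast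
  qed
  hence "sqnorm (\<lambda>x. (v x + K v x) - w x) = 0" by (simp add: antisym)
  from sqnorm_eq_0[OF _ this] have "AE x in lborel. v x + K v x = w x"
    using L2_diff[OF L2_add[OF v L2_K[OF v]] L2_w] by simp
  with v have "\<exists>v. L2 v \<and> (AE x in lborel. v x + K v x = w x)" by blast
  hence "L2 (inv_one_plus K w) \<and> (AE x in lborel. inv_one_plus K w x + K (inv_one_plus K w) x = w x)"
    unfolding inv_one_plus_def by (rule someI_ex)
  thus "L2 (inv_one_plus K w)" "AE x in lborel. inv_one_plus K w x + K (inv_one_plus K w) x = w x" by auto
qed

text \<open>For u = (1 + K)^(-1) w, pairing w = u + K u with u gives |u|^2 + |W u|^2, while \<tau> =
  |u|^2 + 2 |W u|^2 + |K u|^2. The difference |W u|^2 + |K u|^2 is nonnegative and at most C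
  \<tau>.\<close>

lemma inner_inv_one_plus_bounds:
  "\<exists>A. inner_L2 w (inv_one_plus K w) = of_real A \<and> (1 - C) * \<tau> \<le> A \<and> A \<le> \<tau>"
proof -
  define u where "u = inv_one_plus K w"
  have u: "L2 u" and uw: "AE x in lborel. u x + K u x = w x"
    using inv_one_plus_K by (simp_all add: u_def)
  have uK: "inner_L2 u (K u) = of_real (sqnorm (W u))" by (simp add: inner_K u inner_L2_self)
  have "inner_L2 w u = inner_L2 (\<lambda>x. u x + K u x) u"
    by (rule inner_L2_cong_AE) (use uw u L2_K[OF u] in \<open>auto elim!: eventually_mono\<close>)
  also have "\<dots> = inner_L2 u u + inner_L2 (K u) u" by (intro inner_L2_add_left u L2_K)
  also have "\<dots> = of_real (sqnorm u + sqnorm (W u))"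
    by (subst (2) inner_L2_commute) (simp add: uK inner_L2_self)
  finally have A: "inner_L2 w u = of_real (sqnorm u + sqnorm (W u))" .
  have "\<tau> = sqnorm (\<lambda>x. u x + K u x)"
    by (rule sqnorm_cong_AE) (use uw u L2_K[OF u] in \<open>auto elim!: eventually_mono\<close>)
  also have "\<dots> = sqnorm u + 2 * sqnorm (W u) + sqnorm (K u)"
    by (simp add: sqnorm_add u L2_K uK)
  finally have \<tau>: "\<tau> = sqnorm u + 2 * sqnorm (W u) + sqnorm (K u)" .
  have "sqnorm (W u) + sqnorm (K u) \<le> C * sqnorm u + C * sqnorm (W u)"
    by (intro add_mono sqnorm_W_le_C sqnorm_K_le u)
  also have "\<dots> \<le> C * \<tau>" unfolding distrib_left[symmetric] \<tau> using C by (intro mult_left_mono) auto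
  finally have "(1 - C) * \<tau> \<le> sqnorm u + sqnorm (W u)" using \<tau> by (simp add: algebra_simps)
  thus ?thesis using A \<tau> unfolding u_def[symmetric] by (intro exI[of _ "sqnorm u + sqnorm (W u)"]) simp
qed

lemma fredholm_det_bounds:
  assumes T: "critical_density TYPE('a) \<beta> * \<tau> = T" "T < 1"
  shows "norm (fredholm_det K) \<le> 1 + T + T\<^sup>2 / 2 + T ^ 3 / (1 - T)"
    and "1 + T + (T\<^sup>2 - C * T) / 2 - T ^ 3 / (1 - T) \<le> norm (fredholm_det K)"
proof -
  define B :: "('a \<Rightarrow> complex) set" where "B = (SOME B. orthonormal_basis_L2 B)"
  have B: "orthonormal_basis_L2 B" unfolding B_def by (rule someI_ex[OF orthonormal_basis_L2_exists])
  note O = orthonormal_basis_L2_orthonormal[OF B]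
  have L2B: "L2 e" if "e \<in> B" for e using O that by (simp add: orthonormal_L2_def)
  \<comment> \<open>Extension by zero outside the basis makes the Hermitian and Cauchy-Schwarz
    conditions hold for all indices, as the lemmas on minors ask.\<close>
  define k where "k e e' = (if e \<in> B \<and> e' \<in> B then inner_L2 (W e) (W e') else 0)" for e e'
  define a where "a e = (if e \<in> B then sqnorm (W e) else 0)" for e
  have kee: "k e e = of_real (a e)" for e by (simp add: k_def a_def inner_L2_self)
  have herm: "k e' e = cnj (k e e')" for e e' using inner_L2_commute[of "W e'" "W e"] by (simp add: k_def)
  have CS: "(norm (k e e'))\<^sup>2 \<le> a e * a e'" for e e'
    by (simp add: k_def a_def Cauchy_Schwarz_L2_sq W_op_eq_ft L2B)
  have a0: "0 \<le> a e" for e by (simp add: a_def)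
  have aT: "(a has_sum T) B"
    using has_sum_sqnorm_W[OF B] unfolding T by (subst has_sum_cong[of B _ "\<lambda>e. sqnorm (W e)"]) (auto simp: a_def)
  \<comment> \<open>Tr K^2 is at most C Tr K: for each e', Bessel bounds the column sum by |K e'|^2,
    which is at most C |W e'|^2.\<close>
  have Q: "(\<Sum>e\<in>F. \<Sum>e'\<in>F. (norm (k e e'))\<^sup>2) \<le> C * T" if F: "finite F" "F \<subseteq> B" for F
  proof -
    have "(\<Sum>e\<in>F. \<Sum>e'\<in>F. (norm (k e e'))\<^sup>2) = (\<Sum>e'\<in>F. \<Sum>e\<in>F. (norm (inner_L2 e (K e')))\<^sup>2)"
      using F by (subst sum.swap) (intro sum.cong refl, auto simp: k_def inner_K L2B subset_iff)
    also have "\<dots> \<le> (\<Sum>e'\<in>F. C * sqnorm (W e'))"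
    proof (rule sum_mono)
      fix e' assume "e' \<in> F"
      hence e': "L2 e'" using F L2B by blast
      have "(\<Sum>e\<in>F. (norm (inner_L2 e (K e')))\<^sup>2) \<le> sqnorm (K e')"
        by (rule Bessel_L2[OF orthonormal_L2_subset[OF O F(2)] F(1) L2_K[OF e']])
      thus "(\<Sum>e\<in>F. (norm (inner_L2 e (K e')))\<^sup>2) \<le> C * sqnorm (W e')"
        using sqnorm_K_le[OF e'] by simp
    qed
    also have "\<dots> = C * sum a F" using F by (auto simp: sum_distrib_left a_def intro!: sum.cong)
    also have "\<dots> \<le> C * T" using C finite_sum_le_has_sum[OF aT F] a0 by (intro mult_left_mono) auto
    finally show ?thesis .
  qed
  have "minor_L2 K S = leibniz_det k S" if "S \<in> Fpow B" for S
    unfolding minor_L2_eq_leibniz_det leibniz_det_def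
  proof (intro sum.cong refl arg_cong2[of _ _ _ _ "(*)"] prod.cong)
    fix \<pi> e assume "\<pi> \<in> {\<pi>. \<pi> permutes S}" "e \<in> S"
    hence "e \<in> B" "\<pi> e \<in> B" using that by (auto simp: Fpow_def permutes_in_image)
    thus "inner_L2 e (K (\<pi> e)) = k e (\<pi> e)" by (simp add: k_def inner_K L2B)
  qed
  hence det: "fredholm_det K = (\<Sum>\<^sub>\<infinity>S\<in>Fpow B. leibniz_det k S)"
    unfolding fredholm_det_def B_def[symmetric] by (intro infsum_cong)
  show "norm (fredholm_det K) \<le> 1 + T + T\<^sup>2 / 2 + T ^ 3 / (1 - T)"
    and "1 + T + (T\<^sup>2 - C * T) / 2 - T ^ 3 / (1 - T) \<le> norm (fredholm_det K)"
    unfolding det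
    using infsum_leibniz_det_bounds[of k a B T "C * T", OF kee herm CS a0 aT T(2) Q] by auto
qed

end

section \<open>Measurability of the pairing\<close>

lemma point_measuresD:
  assumes "\<xi> \<in> point_measures"
  shows "sets \<xi> = sets borel" "space \<xi> = UNIV" "A \<in> sets borel \<Longrightarrow> bounded A \<Longrightarrow> emeasure \<xi> A < \<infinity>"
proof -
  show s: "sets \<xi> = sets borel" using assms by (simp add: point_measures_def)
  show "space \<xi> = UNIV" using sets_eq_imp_space_eq[OF s] by simp
  show "emeasure \<xi> A < \<infinity>" if A: "A \<in> sets borel" "bounded A"
  proof -
    have "\<forall>A\<in>sets borel. bounded A \<longrightarrow> (\<exists>k::nat. emeasure \<xi> A = of_nat k)"
      using assms by (simp add: point_measures_def)
    then obtain k :: nat where "emeasure \<xi> A = of_nat k" using A by meson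
    thus ?thesis by (simp add: ennreal_of_nat_eq_real_of_nat)
  qed
qed

lemma openin_vague_subset: "openin vague_topology V \<Longrightarrow> V \<subseteq> point_measures"
  using openin_subset[of vague_topology V]
  unfolding vague_topology_def topology_generated_by_topspace by blast

lemma space_point_measure_borel: "space point_measure_borel = point_measures"
  unfolding point_measure_borel_def using openin_vague_subset by (intro space_measure_of) auto

lemma sets_point_measure_borel: "openin vague_topology V \<Longrightarrow> V \<in> sets point_measure_borel"
  unfolding point_measure_borel_def using openin_vague_subset
  by (subst sets_measure_of) auto

lemma measurable_point_measure_cong:
  assumes "\<And>\<xi>. \<xi> \<in> point_measures \<Longrightarrow> h \<xi> = g \<xi>" "g \<in> measurable point_measure_borel N"
  shows "h \<in> measurable point_measure_borel N"
  using assms(2) by (subst measurable_cong[where g=g]) (auto simp: space_point_measure_borel assms(1))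

lemma pairing_continuous_measurable:
  assumes "continuous_on UNIV g" "compactly_supported g"
  shows "pairing g \<in> borel_measurable point_measure_borel"
proof (rule borel_measurableI)
  fix U :: "real set" assume "open U"
  hence "openin vague_topology {\<xi> \<in> point_measures. pairing g \<xi> \<in> U}"
    unfolding vague_topology_def using assms by (intro topology_generated_by_Basis) blast
  moreover have "pairing g -` U \<inter> space point_measure_borel = {\<xi> \<in> point_measures. pairing g \<xi> \<in> U}"
    by (auto simp: space_point_measure_borel)
  ultimately show "pairing g -` U \<inter> space point_measure_borel \<in> sets point_measure_borel"
    by (simp add: sets_point_measure_borel)
qed

text \<open>The vague topology provides measurable pairings only for continuous functions, whereas
  test functions are merely Borel. Compact sets are the bridge: their indicators are limits of
  continuous compactly supported functions, and finiteness on balls allows dominated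
  convergence.\<close>

lemma emeasure_compact_measurable:
  fixes S :: "'a::euclidean_space set"
  assumes S: "compact S"
  shows "(\<lambda>\<xi>. emeasure \<xi> S) \<in> borel_measurable point_measure_borel"
proof (cases "S = {}")
  case False
  \<comment> \<open>\<open>Suc n\<close> instead of \<open>n\<close> keeps every support within
    distance 1 of \<open>S\<close>, so a single ball dominates all of them.\<close>
  define g where "g n x = max 0 (1 - real (Suc n) * infdist x S)" for n and x :: 'a
  have cont: "continuous_on UNIV (g n)" for n
    unfolding g_def by (intro continuous_intros)
  obtain r where r: "S \<subseteq> cball 0 r" using compact_imp_bounded[OF S] by (auto simp: bounded_iff subset_iff)
  have supp: "{x. g n x \<noteq> 0} \<subseteq> cball 0 (r + 1)" for n
  proof
    fix x assume "x \<in> {x. g n x \<noteq> 0}"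
    hence "real (Suc n) * infdist x S < 1" by (auto simp: g_def max_def split: if_splits)
    moreover have "infdist x S \<le> real (Suc n) * infdist x S" by (simp add: distrib_right infdist_nonneg)
    ultimately have "infdist x S < 1" by linarith
    moreover obtain y where "y \<in> S" "infdist x S = dist x y"
      using infdist_attains_inf[OF compact_imp_closed[OF S] False] by metis
    ultimately have "norm x \<le> norm y + 1" "norm y \<le> r"
      using r norm_triangle_sub[of x y] by (auto simp: dist_norm)
    thus "x \<in> cball 0 (r + 1)" by simp
  qed
  have cs: "compactly_supported (g n)" for n
    unfolding compactly_supported_def compact_closure by (rule bounded_subset[OF bounded_cball supp])
  have lim: "(\<lambda>n. pairing (g n) \<xi>) \<longlonglongrightarrow> measure \<xi> S" if \<xi>: "\<xi> \<in> point_measures" for \<xi>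
  proof -
    note [measurable_cong] = point_measuresD(1)[OF \<xi>]
    have [measurable]: "cball (0::'a) r \<in> sets borel" by simp
    have "(\<lambda>n. \<integral>x. g n x \<partial>\<xi>) \<longlonglongrightarrow> (\<integral>x. indicator S x \<partial>\<xi>)"
    proof (rule integral_dominated_convergence[where w="indicator (cball 0 (r + 1))"])
      show "integrable \<xi> (indicator (cball 0 (r + 1)) :: 'a \<Rightarrow> real)"
        by (intro integrable_real_indicator point_measuresD(3)[OF \<xi>]) (simp_all add: point_measuresD(1)[OF \<xi>])
      show "(indicator S :: 'a \<Rightarrow> real) \<in> borel_measurable \<xi>"
        using borel_closed[OF compact_imp_closed[OF S]] by measurable
      show "g n \<in> borel_measurable \<xi>" for n
        using borel_measurable_continuous_onI[OF cont[of n]] by measurable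
      show "AE x in \<xi>. norm (g n x) \<le> indicator (cball 0 (r + 1)) x" for n
      proof (rule AE_I2)
        fix x
        have "0 \<le> g n x" "g n x \<le> 1" by (auto simp: g_def infdist_nonneg)
        thus "norm (g n x) \<le> indicator (cball 0 (r + 1)) x"
          using supp[of n] by (cases "g n x = 0") (auto simp: indicator_def)
      qed
      show "AE x in \<xi>. (\<lambda>n. g n x) \<longlonglongrightarrow> indicator S x"
      proof (rule AE_I2)
        fix x
        show "(\<lambda>n. g n x) \<longlonglongrightarrow> indicator S x"
        proof (cases "x \<in> S")
          case False
          hence pos: "0 < infdist x S"
            using infdist_pos_not_in_closed[OF compact_imp_closed[OF S] \<open>S \<noteq> {}\<close>] by simp
          then obtain N where N: "1 < real N * infdist x S" using reals_Archimedean3[of "infdist x S"] by blast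
          have "\<forall>\<^sub>F n in sequentially. g n x = indicator S x"
            using eventually_ge_at_top[of N]
          proof eventually_elim
            case (elim n)
            have "real N * infdist x S \<le> real (Suc n) * infdist x S"
              using elim pos by (intro mult_right_mono) auto
            thus ?case using N False by (simp add: g_def)
          qed
          thus ?thesis by (rule tendsto_eventually)
        qed (simp add: g_def)
      qed
    qed
    thus ?thesis using point_measuresD(2)[OF \<xi>] by (simp add: pairing_def)
  qed
  have "measure \<xi> S = lim (\<lambda>n. pairing (g n) \<xi>)" if "\<xi> \<in> point_measures" for \<xi>
    using limI[OF lim[OF that]] by simp
  moreover have "(\<lambda>\<xi>. lim (\<lambda>n. pairing (g n) \<xi>)) \<in> borel_measurable point_measure_borel"
    by (rule borel_measurable_lim_metric) (rule pairing_continuous_measurable[OF cont cs])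
  ultimately have "(\<lambda>\<xi>. measure \<xi> S) \<in> borel_measurable point_measure_borel"
    by (rule measurable_point_measure_cong)
  hence "(\<lambda>\<xi>. ennreal (measure \<xi> S)) \<in> borel_measurable point_measure_borel" by measurable
  moreover have "emeasure \<xi> S = ennreal (measure \<xi> S)" if "\<xi> \<in> point_measures" for \<xi>
    using point_measuresD(3)[OF that borel_closed[OF compact_imp_closed[OF S]] compact_imp_bounded[OF S]]
    by (intro emeasure_eq_ennreal_measure) simp
  ultimately show ?thesis
    by (rule measurable_point_measure_cong[rotated])
qed simp

text \<open>Dynkin's argument from closed sets. Intersecting with a ball makes closed sets compact
  and all masses finite, so complements are handled by subtraction.\<close>

lemma emeasure_Int_cball_measurable:
  fixes A :: "'a::euclidean_space set"
  assumes A: "A \<in> sets borel"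
  shows "(\<lambda>\<xi>. emeasure \<xi> (A \<inter> cball 0 r)) \<in> borel_measurable point_measure_borel"
proof -
  have A': "A \<in> sigma_sets UNIV (Collect closed)"
    using A by (simp add: borel_eq_closed)
  have stable: "Int_stable (Collect closed :: 'a set set)" by (auto simp: Int_stable_def)
  show ?thesis
    using stable subset_UNIV[of "Collect closed", folded Pow_UNIV] A'
  proof (induction rule: sigma_sets_induct_disjoint)
    case (basic A)
    thus ?case by (intro emeasure_compact_measurable) (auto intro: closed_Int_compact)
  next
    case (compl A)
    have A: "A \<in> sets borel" using compl.hyps by (simp add: borel_eq_closed)
    have "emeasure \<xi> ((UNIV - A) \<inter> cball 0 r) = emeasure \<xi> (cball 0 r) - emeasure \<xi> (A \<inter> cball 0 r)"
      if \<xi>: "\<xi> \<in> point_measures" for \<xi>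
    proof -
      have "(UNIV - A) \<inter> cball 0 r = cball 0 r - (A \<inter> cball 0 r)" by auto
      moreover have "emeasure \<xi> (A \<inter> cball 0 r) < \<infinity>"
        using A by (intro point_measuresD(3)[OF \<xi>]) (auto intro: bounded_subset[OF bounded_cball])
      ultimately show ?thesis
        using A point_measuresD(1)[OF \<xi>] by (simp add: emeasure_Diff)
    qed
    moreover have "(\<lambda>\<xi>. emeasure \<xi> (cball 0 r) - emeasure \<xi> (A \<inter> cball 0 r)) \<in> borel_measurable point_measure_borel"
      using compl.IH emeasure_compact_measurable[OF compact_cball[of "0::'a" r]] by measurable
    ultimately show ?case
    by (rule measurable_point_measure_cong)
  next
    case (union A)
    have A: "A i \<in> sets borel" for i using union.hyps(2) by (auto simp: borel_eq_closed)
    have "emeasure \<xi> (\<Union>(range A) \<inter> cball 0 r) = (\<Sum>i. emeasure \<xi> (A i \<inter> cball 0 r))"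
      if \<xi>: "\<xi> \<in> point_measures" for \<xi>
    proof -
      have "\<Union>(range A) \<inter> cball 0 r = (\<Union>i. A i \<inter> cball 0 r)" by auto
      moreover have "disjoint_family (\<lambda>i. A i \<inter> cball 0 r)"
        using union.hyps(1) by (auto simp: disjoint_family_on_def)
      ultimately show ?thesis
        using A point_measuresD(1)[OF \<xi>] by (subst suminf_emeasure) auto
    qed
    moreover have "(\<lambda>\<xi>. \<Sum>i. emeasure \<xi> (A i \<inter> cball 0 r)) \<in> borel_measurable point_measure_borel"
      using union.IH by measurable
    ultimately show ?case
    by (rule measurable_point_measure_cong)
  qed simp
qed

lemma nn_integral_cball_measurable:
  fixes u :: "'a::euclidean_space \<Rightarrow> ennreal"
  assumes u: "u \<in> borel_measurable borel"
  shows "(\<lambda>\<xi>. \<integral>\<^sup>+x. u x * indicator (cball 0 r) x \<partial>\<xi>) \<in> borel_measurable point_measure_borel"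
  using u
proof (induction rule: borel_measurable_induct)
  case (cong f g)
  thus ?case by simp
next
  case (set A)
  have "(\<integral>\<^sup>+x. indicator A x * indicator (cball 0 r) x \<partial>\<xi>) = emeasure \<xi> (A \<inter> cball 0 r)"
    if \<xi>: "\<xi> \<in> point_measures" for \<xi>
    using set point_measuresD(1)[OF \<xi>] by (simp add: indicator_inter_arith[symmetric])
  thus ?case
    by (rule measurable_point_measure_cong) (assumption, rule emeasure_Int_cball_measurable[OF set])
next
  case (mult u c)
  have "(\<integral>\<^sup>+x. c * u x * indicator (cball 0 r) x \<partial>\<xi>) = c * (\<integral>\<^sup>+x. u x * indicator (cball 0 r) x \<partial>\<xi>)"
    if \<xi>: "\<xi> \<in> point_measures" for \<xi>
  proof -
    note [measurable_cong] = point_measuresD(1)[OF \<xi>]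
    have [measurable]: "cball (0::'a) r \<in> sets borel" by simp
    have [measurable]: "u \<in> borel_measurable borel" by fact
    have "(\<lambda>x. u x * indicator (cball 0 r) x) \<in> borel_measurable \<xi>" by measurable
    thus ?thesis by (subst nn_integral_cmult[symmetric]) (auto simp: mult.assoc)
  qed
  thus ?case
    by (rule measurable_point_measure_cong) (assumption, use mult.IH in measurable)
next
  case (add u v)
  have "(\<integral>\<^sup>+x. (v x + u x) * indicator (cball 0 r) x \<partial>\<xi>)
      = (\<integral>\<^sup>+x. v x * indicator (cball 0 r) x \<partial>\<xi>) + (\<integral>\<^sup>+x. u x * indicator (cball 0 r) x \<partial>\<xi>)"
    if \<xi>: "\<xi> \<in> point_measures" for \<xi>
  proof -
    have [measurable]: "cball (0::'a) r \<in> sets borel" by simp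
    note [measurable_cong] = point_measuresD(1)[OF \<xi>] and [measurable] = add(1,3)
    show ?thesis by (subst nn_integral_add[symmetric]) (auto simp: distrib_right)
  qed
  thus ?case
    by (rule measurable_point_measure_cong) (assumption, use add.IH in measurable)
next
  case (seq U)
  have "(\<integral>\<^sup>+x. (SUP i. U i) x * indicator (cball 0 r) x \<partial>\<xi>) = (SUP i. \<integral>\<^sup>+x. U i x * indicator (cball 0 r) x \<partial>\<xi>)"
    if \<xi>: "\<xi> \<in> point_measures" for \<xi>
  proof -
    have [measurable]: "cball (0::'a) r \<in> sets borel" by simp
    note [measurable_cong] = point_measuresD(1)[OF \<xi>] and [measurable] = seq(1)
    have "incseq (\<lambda>i x. U i x * indicator (cball 0 r) x)"
      using seq(3) by (auto simp: incseq_def le_fun_def intro!: mult_right_mono)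
    from nn_integral_monotone_convergence_SUP[OF this, of \<xi>]
    show ?thesis by (simp add: SUP_mult_right_ennreal[symmetric] image_comp)
  qed
  thus ?case
    by (rule measurable_point_measure_cong) (assumption, use seq.IH in measurable)
qed

lemma pairing_measurable:
  fixes f :: "'a::euclidean_space \<Rightarrow> real"
  assumes f: "test_function f"
  shows "pairing f \<in> borel_measurable point_measure_borel"
proof -
  have fm: "f \<in> borel_measurable borel" and f0: "\<And>x. 0 \<le> f x" using f by (auto simp: test_function_def)
  have "bounded (closure {x. f x \<noteq> 0})"
    using f by (auto simp: test_function_def compactly_supported_def intro: compact_imp_bounded)
  then obtain r where "\<forall>x\<in>closure {x. f x \<noteq> 0}. norm x \<le> r" unfolding bounded_iff by blast
  hence "closure {x. f x \<noteq> 0} \<subseteq> cball 0 r" by auto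
  hence r: "{x. f x \<noteq> 0} \<subseteq> cball 0 r" by (rule order_trans[OF closure_subset])
  have "pairing f \<xi> = enn2real (\<integral>\<^sup>+x. ennreal (f x) * indicator (cball 0 r) x \<partial>\<xi>)"
    if \<xi>: "\<xi> \<in> point_measures" for \<xi>
  proof -
    have [measurable]: "cball (0::'a) r \<in> sets borel" by simp
    note [measurable_cong] = point_measuresD(1)[OF \<xi>] and [measurable] = fm
    have "pairing f \<xi> = enn2real (\<integral>\<^sup>+x. ennreal (f x) \<partial>\<xi>)"
      unfolding pairing_def using f0 by (intro integral_eq_nn_integral) auto
    also have "(\<integral>\<^sup>+x. ennreal (f x) \<partial>\<xi>) = (\<integral>\<^sup>+x. ennreal (f x) * indicator (cball 0 r) x \<partial>\<xi>)"
    proof (rule nn_integral_cong)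
      show "ennreal (f x) = ennreal (f x) * indicator (cball 0 r) x" for x
        using r by (cases "f x = 0") (auto simp: indicator_def)
    qed
    finally show ?thesis .
  qed
  moreover have "(\<lambda>\<xi>. enn2real (\<integral>\<^sup>+x. ennreal (f x) * indicator (cball 0 r) x \<partial>\<xi>)) \<in> borel_measurable point_measure_borel"
    using nn_integral_cball_measurable[of "\<lambda>x. ennreal (f x)" r] fm by measurable
  ultimately show ?thesis
    by (rule measurable_point_measure_cong)
qed

lemma pairing_nonneg: "test_function f \<Longrightarrow> 0 \<le> pairing f \<xi>"
  unfolding pairing_def test_function_def by (intro Bochner_Integration.integral_nonneg) auto

section \<open>The Laplace functional and the first two moments\<close>

text \<open>The product of 1 - y + y^2/2 and 1 + y + y^2/2 is 1 + (y^2/2)^2, hence at least 1, and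
  the second factor is at most exp y.\<close>

lemma exp_minus_le_quadratic: "0 \<le> y \<Longrightarrow> exp (- y) \<le> 1 - y + y\<^sup>2 / 2" for y :: real
proof -
  assume y: "0 \<le> y"
  have "exp (- y) = 1 / exp y" by (simp add: exp_minus inverse_eq_divide)
  also have "\<dots> \<le> 1 / (1 + y + y\<^sup>2 / 2)"
    using exp_lower_Taylor_quadratic[OF y] y by (intro divide_left_mono mult_pos_pos add_pos_nonneg) auto
  also have "\<dots> \<le> 1 - y + y\<^sup>2 / 2"
  proof -
    have "0 < 1 + y + y\<^sup>2 / 2" using y by (intro add_pos_nonneg) auto
    moreover have "1 \<le> (1 - y + y\<^sup>2 / 2) * (1 + y + y\<^sup>2 / 2)"
    proof -
      have "(1 - y + y\<^sup>2 / 2) * (1 + y + y\<^sup>2 / 2) = 1 + (y\<^sup>2 / 2)\<^sup>2"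
        by (simp add: algebra_simps power2_eq_square)
      thus ?thesis by simp
    qed
    ultimately show ?thesis by (simp add: pos_divide_le_eq)
  qed
  finally show ?thesis .
qed

lemma exp_le_cubic:
  fixes x :: real
  assumes "0 \<le> x" "x \<le> 1"
  shows "exp x \<le> 1 + x + x\<^sup>2 / 2 + x ^ 3"
proof -
  obtain t where t: "\<bar>t\<bar> \<le> \<bar>x\<bar>" "exp x = (\<Sum>m<3. x ^ m / fact m) + exp t / fact 3 * x ^ 3"
    using Maclaurin_exp_le[of x 3] by blast
  have "exp t \<le> exp 1" using t(1) assms by simp
  also have "exp 1 \<le> (3 :: real)" by (rule exp_le)
  finally have "exp t / fact 3 \<le> 1" by (simp add: eval_nat_numeral)
  hence "exp t / fact 3 * x ^ 3 \<le> 1 * x ^ 3" using assms by (intro mult_right_mono) auto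
  moreover have "(\<Sum>m<3. x ^ m / fact m) = 1 + x + x\<^sup>2 / 2" by (simp add: eval_nat_numeral)
  ultimately show ?thesis using t(2) by simp
qed

text \<open>Rewriting the determinant bounds as exponentials makes them additive in the exponent.\<close>

lemma det_upper_exp:
  fixes T :: real
  assumes "0 \<le> T" "T \<le> 1 / 2"
  shows "1 + T + T\<^sup>2 / 2 + T ^ 3 / (1 - T) \<le> exp (T + 2 * T ^ 3)"
proof -
  have "T ^ 3 / (1 - T) \<le> 2 * T ^ 3"
    using assms mult_left_mono[of T "1 / 2" "T ^ 3"] by (simp add: divide_le_eq algebra_simps)
  hence "1 + T + T\<^sup>2 / 2 + T ^ 3 / (1 - T) \<le> exp T + 2 * T ^ 3"
    using exp_lower_Taylor_quadratic[OF assms(1)] by simp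
  also have "\<dots> \<le> exp T + exp T * (2 * T ^ 3)"
    using assms mult_right_mono[of 1 "exp T" "2 * T ^ 3"] by simp
  also have "\<dots> = exp T * (1 + 2 * T ^ 3)" by (simp add: algebra_simps)
  also have "\<dots> \<le> exp T * exp (2 * T ^ 3)" by (intro mult_left_mono exp_ge_add_one_self) auto
  finally show ?thesis by (simp add: exp_add)
qed

text \<open>\<open>d\<close> collects what is lost: t0^3 from replacing exp t0 by its quadratic
  Taylor polynomial, c T / 2 from Tr K^2, and 2 T^3 from the minors of size at least 3. The
  inequality exp(-d - 2 d^2) \<le> 1 - d then moves this loss into the exponent. A separate
  \<open>t0\<close> is kept because \<open>T\<close> will be known only through a lower bound
  polynomial in s.\<close>

lemma det_lower_exp:
  fixes T :: real
  assumes t0: "0 \<le> t0" "t0 \<le> T" and T: "T \<le> 1 / 2" and c: "c * T / 2 \<le> d - t0 ^ 3 - 2 * T ^ 3" and d: "0 \<le> d" "d \<le> 1 / 2"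
  shows "exp (t0 - d - 2 * d\<^sup>2) \<le> 1 + T + (T\<^sup>2 - c * T) / 2 - T ^ 3 / (1 - T)"
proof -
  have "- d - 2 * d\<^sup>2 \<le> ln (1 - d)" using ln_one_minus_pos_lower_bound[OF d] by simp
  hence "exp (- d - 2 * d\<^sup>2) \<le> 1 - d" using ln_ge_iff[of "1 - d"] d by simp
  hence "exp (t0 - d - 2 * d\<^sup>2) \<le> exp t0 * (1 - d)"
    using mult_left_mono[of "exp (- d - 2 * d\<^sup>2)" "1 - d" "exp t0"] by (simp add: exp_add[symmetric] algebra_simps)
  also have "\<dots> \<le> exp t0 - d"
    using mult_right_mono[of 1 "exp t0" d] t0 d by (simp add: algebra_simps)
  also have "\<dots> \<le> 1 + t0 + t0\<^sup>2 / 2 + t0 ^ 3 - d" using exp_le_cubic[of t0] t0 T by simp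
  also have "\<dots> \<le> 1 + T + T\<^sup>2 / 2 - c * T / 2 - 2 * T ^ 3"
    using c t0(2) power_mono[OF t0(2,1), of 2] by linarith
  also have "\<dots> \<le> 1 + T + (T\<^sup>2 - c * T) / 2 - T ^ 3 / (1 - T)"
  proof -
    have "T ^ 3 / (1 - T) \<le> 2 * T ^ 3"
      using t0 T mult_left_mono[of T "1 / 2" "T ^ 3"] by (simp add: divide_le_eq algebra_simps)
    thus ?thesis by (simp add: diff_divide_distrib)
  qed
  finally show ?thesis .
qed

text \<open>Expansion exp(-x) = 1 - x + x^2/2 + o(x^2) at x = s (a + s r(s)). Since \<open>r\<close>
  only has to converge, one statement serves both bounds of the Laplace functional.\<close>

lemma exp_second_order:
  fixes r :: "real \<Rightarrow> real"
  assumes "(r \<longlongrightarrow> b) (at_right 0)"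
  shows "((\<lambda>s. (exp (- (s * (a + s * r s))) - 1 + a * s) / s\<^sup>2) \<longlongrightarrow> a\<^sup>2 / 2 - b) (at_right 0)"
proof -
  \<comment> \<open>The removable singularity is filled in, since s (a + s r(s)) may vanish for s >
    0.\<close>
  define h :: "real \<Rightarrow> real" where "h x = (if x = 0 then 1 / 2 else (exp (- x) - 1 + x) / x\<^sup>2)" for x
  have "((\<lambda>x::real. (exp (- x) - 1 + x) / x\<^sup>2) \<longlongrightarrow> 1 / 2) (at 0)" by real_asymp
  hence "(h \<longlongrightarrow> 1 / 2) (at 0)"
    by (rule Lim_transform_eventually) (auto simp: h_def eventually_at_filter)
  hence "isCont h 0" by (simp add: isCont_def h_def)
  have h: "exp (- x) - 1 + x = h x * x\<^sup>2" for x by (simp add: h_def)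
  have id: "((\<lambda>s::real. s) \<longlongrightarrow> 0) (at_right 0)" by (rule tendsto_ident_at)
  have z1: "((\<lambda>s. a + s * r s) \<longlongrightarrow> a + 0 * b) (at_right 0)" by (intro tendsto_intros id assms)
  have z: "((\<lambda>s. s * (a + s * r s)) \<longlongrightarrow> 0 * (a + 0 * b)) (at_right 0)" by (intro tendsto_mult id z1)
  hence "((\<lambda>s. h (s * (a + s * r s))) \<longlongrightarrow> h 0) (at_right 0)"
    by (intro isCont_tendsto_compose[OF \<open>isCont h 0\<close>]) simp
  hence "((\<lambda>s. h (s * (a + s * r s)) * (a + s * r s)\<^sup>2 - r s) \<longlongrightarrow> h 0 * (a + 0 * b)\<^sup>2 - b) (at_right 0)"
    by (intro tendsto_diff tendsto_mult tendsto_power z1 assms)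
  moreover have "\<forall>\<^sub>F s in at_right 0. h (s * (a + s * r s)) * (a + s * r s)\<^sup>2 - r s
      = (exp (- (s * (a + s * r s))) - 1 + a * s) / s\<^sup>2"
    using eventually_at_right_less[of 0]
  proof eventually_elim
    case (elim s)
    have "exp (- (s * (a + s * r s))) - 1 + a * s = h (s * (a + s * r s)) * (s * (a + s * r s))\<^sup>2 - s\<^sup>2 * r s"
      unfolding h[symmetric] by (simp add: algebra_simps power2_eq_square)
    also have "\<dots> = (h (s * (a + s * r s)) * (a + s * r s)\<^sup>2 - r s) * s\<^sup>2"
      unfolding power_mult_distrib by (simp only: left_diff_distrib right_diff_distrib ac_simps)
    finally show ?case using elim by simp
  qed
  ultimately show ?thesis by (simp add: h_def Lim_transform_eventually)
qed

section \<open>Test functions under scaling and dilation\<close>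

lemma test_functionD:
  assumes "test_function f"
  shows "f \<in> borel_measurable borel" "0 \<le> f x" "compact (closure {x. f x \<noteq> 0})" "\<exists>N\<ge>0. \<forall>x. f x \<le> N"
proof -
  show "f \<in> borel_measurable borel" "0 \<le> f x" "compact (closure {x. f x \<noteq> 0})"
    using assms by (auto simp: test_function_def compactly_supported_def)
  obtain N where "\<forall>y\<in>range f. norm y \<le> N" using assms by (auto simp: test_function_def bounded_iff)
  hence "\<forall>x. f x \<le> max 0 N" by (auto simp: abs_le_iff le_max_iff_disj)
  thus "\<exists>N\<ge>0. \<forall>x. f x \<le> N" by (intro exI[of _ "max 0 N"]) auto
qed

lemma test_function_integrable:
  fixes f :: "'a::euclidean_space \<Rightarrow> real"
  assumes f: "test_function f"
  shows "integrable lborel f" "integrable lborel (\<lambda>x. (f x)\<^sup>2)"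
proof -
  note [measurable] = test_functionD(1)[OF f]
  obtain N where N: "0 \<le> N" "\<And>x. f x \<le> N" using test_functionD(4)[OF f] by blast
  let ?S = "closure {x. f x \<noteq> 0}"
  have S: "integrable lborel (indicator ?S :: 'a \<Rightarrow> real)"
    using test_functionD(3)[OF f] by (intro integrable_real_indicator emeasure_compact_finite) auto
  have supp: "f x = 0" if "x \<notin> ?S" for x using that closure_subset[of "{x. f x \<noteq> 0}"] by auto
  show i: "integrable lborel f"
  proof (rule Bochner_Integration.integrable_bound)
    show "integrable lborel (\<lambda>x. N * indicator ?S x)" using S by simp
    show "AE x in lborel. norm (f x) \<le> norm (N * indicator ?S x)"
    proof (rule AE_I2)
      show "norm (f x) \<le> norm (N * indicator ?S x)" for x
        using N(2)[of x] supp[of x] test_functionD(2)[OF f, of x] by (cases "x \<in> ?S") simp_all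
    qed
  qed measurable
  show "integrable lborel (\<lambda>x. (f x)\<^sup>2)"
  proof (rule Bochner_Integration.integrable_bound)
    show "integrable lborel (\<lambda>x. N * f x)" using i by simp
    show "AE x in lborel. norm ((f x)\<^sup>2) \<le> norm (N * f x)"
      using N test_functionD(2)[OF f] by (intro AE_I2) (auto simp: power2_eq_square intro: mult_right_mono)
  qed measurable
qed

lemma test_function_scale:
  assumes "test_function f" "0 \<le> s"
  shows "test_function (\<lambda>x. s * f x)"
  unfolding test_function_def
proof (intro conjI allI)
  note [measurable] = test_functionD(1)[OF assms(1)]
  show "(\<lambda>x. s * f x) \<in> borel_measurable borel" by measurable
  show "0 \<le> s * f x" for x using test_functionD(2)[OF assms(1)] assms(2) by simp
  obtain N where N: "0 \<le> N" "\<And>x. f x \<le> N" using test_functionD(4)[OF assms(1)] by blast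
  show "bounded (range (\<lambda>x. s * f x))"
    unfolding bounded_iff
    by (rule exI[of _ "s * N"]) (use assms(2) N test_functionD(2)[OF assms(1)] in \<open>auto simp: abs_mult intro!: mult_left_mono\<close>)
  have "closed (closure {x. s * f x \<noteq> 0})" "closure {x. s * f x \<noteq> 0} \<subseteq> closure {x. f x \<noteq> 0}"
    by (auto intro!: closure_mono)
  thus "compactly_supported (\<lambda>x. s * f x)"
    unfolding compactly_supported_def using test_functionD(3)[OF assms(1)]
    by (metis closed_Int_compact inf.absorb_iff1)
qed

lemma test_function_dilate:
  fixes f :: "'a::euclidean_space \<Rightarrow> real"
  assumes "test_function f" "0 < \<kappa>"
  shows "test_function (\<lambda>x. f (x /\<^sub>R \<kappa>))"
  unfolding test_function_def
proof (intro conjI allI)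
  note [measurable] = test_functionD(1)[OF assms(1)]
  show "(\<lambda>x. f (x /\<^sub>R \<kappa>)) \<in> borel_measurable borel" by measurable
  show "0 \<le> f (x /\<^sub>R \<kappa>)" for x using test_functionD(2)[OF assms(1)] by simp
  show "bounded (range (\<lambda>x. f (x /\<^sub>R \<kappa>)))"
    using assms(1) unfolding test_function_def by (auto intro: bounded_subset)
  have "compact ((*\<^sub>R) \<kappa> ` closure {x. f x \<noteq> 0})"
    by (intro compact_scaling test_functionD(3)[OF assms(1)])
  moreover have "{x. f (x /\<^sub>R \<kappa>) \<noteq> 0} \<subseteq> (*\<^sub>R) \<kappa> ` closure {x. f x \<noteq> 0}"
  proof
    fix x assume "x \<in> {x. f (x /\<^sub>R \<kappa>) \<noteq> 0}"
    hence "x /\<^sub>R \<kappa> \<in> closure {x. f x \<noteq> 0}" using closure_subset[of "{x. f x \<noteq> 0}"] by auto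
    moreover have "x = \<kappa> *\<^sub>R (x /\<^sub>R \<kappa>)" using assms(2) by simp
    ultimately show "x \<in> (*\<^sub>R) \<kappa> ` closure {x. f x \<noteq> 0}" by blast
  qed
  ultimately show "compactly_supported (\<lambda>x. f (x /\<^sub>R \<kappa>))"
    unfolding compactly_supported_def compact_closure using bounded_subset compact_imp_bounded by blast
qed

lemma isCont_tendsto_at_right: "isCont g x \<Longrightarrow> (g \<longlongrightarrow> g x) (at_right x)" for g :: "real \<Rightarrow> real"
  using continuous_at_imp_continuous_at_within[of x g "{x<..}"] by (simp add: continuous_within)

lemma exp_difference_quotient:
  fixes y :: real
  shows "((\<lambda>s. (1 - exp (- (s * y))) / s) \<longlongrightarrow> y) (at_right 0)"
proof -
  have "((\<lambda>s. 1 - exp (- (s * y))) has_real_derivative y) (at 0)"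
    by (auto intro!: derivative_eq_intros)
  hence "((\<lambda>s. (1 - exp (- (s * y))) / s) \<longlongrightarrow> y) (at 0)"
    by (simp add: has_field_derivative_iff)
  thus ?thesis by (rule tendsto_within_subset) simp
qed

locale boson_field =
  fixes \<beta> \<rho> :: real and \<nu> :: "'a::euclidean_space measure measure" and f :: "'a \<Rightarrow> real" and M N :: real
  assumes \<beta>: "0 < \<beta>" and dim: "2 < DIM('a)" and \<rho>: "critical_density TYPE('a) \<beta> < \<rho>"
    and \<nu>: "boson_point_field \<beta> \<rho> \<nu>" and f: "test_function f"
    and N: "\<And>x. f x \<le> N" and M: "0 \<le> M"
begin

definition "\<rho>c = critical_density TYPE('a) \<beta>"
definition "I = (\<integral>x. f x \<partial>lborel)"
definition "J = (\<integral>x. (f x)\<^sup>2 \<partial>lborel)"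
definition "tail = (\<integral>p. indicator {p. M < bose \<beta> p} p * bose \<beta> (p :: 'a) \<partial>lborel) / (2 * pi) ^ DIM('a)"
text \<open>For the test function s f, \<open>sqnorm_W_le\<close> holds with b = s N and \<tau> at
  most s I, so that \<open>s * C\<close> bounds the squared norm of its W.\<close>

definition "C = M * N + I * tail"
definition "\<phi> s = (\<integral>\<xi>. exp (- (s * pairing f \<xi>)) \<partial>\<nu>)"
text \<open>\<open>s\<^sup>2 * err s\<close> is the loss \<open>d\<close> of
  \<open>det_lower_exp\<close> for the test function s f, with t0 = \<rho>c s (I - s J / 2), c = s C
  and T replaced by its bound \<rho>c s I.\<close>

definition "err s = s * (\<rho>c * (I - s * J / 2)) ^ 3 + C * \<rho>c * I / 2 + 2 * s * (\<rho>c * I) ^ 3"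
text \<open>Solved from the requirement that s (\<rho> I + s \<open>rem s\<close>) be the lower
  bound obtained for minus the logarithm of \<phi>(s): the terms come from \<tau>, from the factor 1
  - s C of the resolvent, and from d + 2 d^2 of the determinant.\<close>

definition "rem s = - (\<rho> * J / 2) - (\<rho> - \<rho>c) * C * (I - s * J / 2) - err s - 2 * s\<^sup>2 * (err s)\<^sup>2"

lemma N_nonneg: "0 \<le> N"
  using test_functionD(2)[OF f] N order_trans by blast

lemma I_nonneg: "0 \<le> I" and J_nonneg: "0 \<le> J" and tail_nonneg: "0 \<le> tail"
  unfolding I_def J_def tail_def using test_functionD(2)[OF f]
  by (auto intro!: Bochner_Integration.integral_nonneg divide_nonneg_nonneg mult_nonneg_nonneg bose_nonneg[OF \<beta>])

lemma C_nonneg: "0 \<le> C"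
  unfolding C_def using M N_nonneg I_nonneg tail_nonneg by simp

lemma J_le: "J \<le> N * I"
  unfolding J_def I_def integral_mult_right_zero[symmetric]
  using test_function_integrable[OF f] test_functionD(2)[OF f] N
  by (intro integral_mono) (auto simp: power2_eq_square intro: mult_right_mono)

lemma \<rho>c_nonneg: "0 \<le> \<rho>c"
proof -
  interpret bose_test \<beta> f by unfold_locales (fact \<beta> dim f)+
  show ?thesis unfolding \<rho>c_def by (rule critical_density_nonneg)
qed

lemma \<rho>_pos: "0 < \<rho>"
  using \<rho>c_nonneg \<rho> by (simp add: \<rho>c_def)

lemma \<phi>_nonneg: "0 \<le> \<phi> s"
  by (simp add: \<phi>_def)

text \<open>All hypotheses only ask that s be small. The lower bound uses A \<le> \<tau> \<le> s I
  and the upper bound for the determinant, and its remainder vanishes with s. The upper bound loses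
  a second-order term, which survives as the limit of \<open>rem\<close> and becomes the excess of
  the second moment.\<close>

lemma \<phi>_bounds_at:
  assumes s: "0 < s" and sC: "s * C \<le> 1 / 2" and sI: "\<rho>c * (s * I) \<le> 1 / 2" and sN: "s * N \<le> 1"
    and e: "s\<^sup>2 * err s \<le> 1 / 2"
  shows "exp (- (s * (\<rho> * I + s * (2 * (\<rho>c * I) ^ 3 * s)))) \<le> \<phi> s"
    and "\<phi> s \<le> exp (- (s * (\<rho> * I + s * rem s)))"
proof -
  let ?g = "\<lambda>x. s * f x"
  have g: "test_function ?g" using f s by (intro test_function_scale) auto
  note fi = test_function_integrable[OF f] and sf0 = test_functionD(2)[OF f]
  interpret bose_test \<beta> ?g by unfold_locales (fact \<beta> dim g)+
  let ?\<tau> = "sqnorm w"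
  have \<tau>_eq: "?\<tau> = (\<integral>x. 1 - exp (- (s * f x)) \<partial>lborel)" by (simp add: sqnorm_def norm_w_sq)
  have \<tau>_int: "integrable lborel (\<lambda>x. 1 - exp (- (s * f x)))"
    using L2_integrable[OF L2_w] by (simp add: norm_w_sq)
  have sf: "0 \<le> s * f x" for x using s sf0 by simp
  have le1: "1 - exp (- (s * f x)) \<le> s * f x" for x using exp_ge_add_one_self[of "- (s * f x)"] by simp
  have \<tau>_le: "?\<tau> \<le> s * I"
    unfolding \<tau>_eq I_def integral_mult_right_zero[symmetric]
    using fi by (intro integral_mono \<tau>_int le1) auto
  define t where "t = s * (I - s * J / 2)"
  have "(\<integral>x. s * f x - s\<^sup>2 / 2 * (f x)\<^sup>2 \<partial>lborel) \<le> ?\<tau>"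
    unfolding \<tau>_eq
  proof (rule integral_mono[OF _ \<tau>_int])
    show "integrable lborel (\<lambda>x. s * f x - s\<^sup>2 / 2 * (f x)\<^sup>2)"
      by (intro Bochner_Integration.integrable_diff integrable_mult_right fi)
    show "s * f x - s\<^sup>2 / 2 * (f x)\<^sup>2 \<le> 1 - exp (- (s * f x))" for x
      using exp_minus_le_quadratic[OF sf[of x]] by (simp add: power_mult_distrib)
  qed
  hence t_le: "t \<le> ?\<tau>"
    using fi by (simp add: t_def I_def J_def power2_eq_square algebra_simps)
  \<comment> \<open>Then t is at least s I / 2, so \<open>t0\<close> = \<rho>c t is nonnegative as
    \<open>det_lower_exp\<close> demands.\<close>
  have "s * J \<le> 1 * I"
  proof -
    have "s * J \<le> s * (N * I)" using J_le s by (intro mult_left_mono) auto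
    also have "\<dots> \<le> 1 * I" unfolding mult.assoc[symmetric] using sN I_nonneg by (intro mult_right_mono) auto
    finally show ?thesis .
  qed
  hence t0: "0 \<le> t" unfolding t_def using s I_nonneg by (intro mult_nonneg_nonneg) auto
  interpret bose_test_bounded \<beta> ?g "s * C"
  proof
    show "0 \<le> s * C" "s * C \<le> 1 / 2" using s C_nonneg sC by auto
    fix u :: "'a \<Rightarrow> complex" assume u: "L2 u"
    have "1 - exp (- (s * f x)) \<le> s * N" for x
      by (rule order_trans[OF le1 mult_left_mono[OF N]]) (use s in simp)
    from sqnorm_W_le[OF u this M]
    have "sqnorm (W_op \<beta> ?g u) \<le> (M * (s * N) + ?\<tau> * tail) * sqnorm u" by (simp add: tail_def)
    also have "\<dots> \<le> (M * (s * N) + (s * I) * tail) * sqnorm u"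
      by (intro mult_right_mono add_left_mono \<tau>_le tail_nonneg) auto
    also have "\<dots> = s * C * sqnorm u" by (simp add: C_def algebra_simps)
    finally show "sqnorm (W_op \<beta> ?g u) \<le> s * C * sqnorm u" .
  qed
  obtain A where A: "inner_L2 w (inv_one_plus K w) = of_real A" "(1 - s * C) * ?\<tau> \<le> A" "A \<le> ?\<tau>"
    using inner_inv_one_plus_bounds by blast
  define T where "T = \<rho>c * ?\<tau>"
  have T: "0 \<le> T" "T \<le> \<rho>c * (s * I)" "\<rho>c * t \<le> T"
    unfolding T_def using \<rho>c_nonneg \<tau>_le t_le by (auto intro: mult_left_mono)
  have T12: "T \<le> 1 / 2" using T sI by simp
  have D_le: "norm (fredholm_det K) \<le> exp (T + 2 * T ^ 3)"
    using fredholm_det_bounds(1)[of T] det_upper_exp[OF T(1) T12] T12 by (simp add: T_def \<rho>c_def)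
  define d where "d = s\<^sup>2 * err s"
  have d_eq: "d = (\<rho>c * t) ^ 3 + s * C * (\<rho>c * (s * I)) / 2 + 2 * (\<rho>c * (s * I)) ^ 3"
    by (simp add: d_def err_def t_def power_mult_distrib algebra_simps power2_eq_square power3_eq_cube)
  have \<rho>ct: "0 \<le> \<rho>c * t" using \<rho>c_nonneg t0 by simp
  have "s * C * T / 2 \<le> s * C * (\<rho>c * (s * I)) / 2"
    using T(2) s C_nonneg by (intro divide_right_mono mult_left_mono) auto
  moreover have "T ^ 3 \<le> (\<rho>c * (s * I)) ^ 3" by (intro power_mono T)
  ultimately have c: "s * C * T / 2 \<le> d - (\<rho>c * t) ^ 3 - 2 * T ^ 3" unfolding d_eq by simp
  have d0: "0 \<le> d"
    unfolding d_eq using \<rho>ct s C_nonneg \<rho>c_nonneg I_nonneg by (intro add_nonneg_nonneg) auto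
  have D_ge: "exp (\<rho>c * t - d - 2 * d\<^sup>2) \<le> norm (fredholm_det K)"
    using det_lower_exp[OF \<rho>ct T(3) T12 c d0] e fredholm_det_bounds(2)[of T] T12
    by (simp add: T_def \<rho>c_def d_def)
  have D_pos: "0 < norm (fredholm_det K)" by (rule less_le_trans[OF exp_gt_zero D_ge])
  have "complex_of_real (\<integral>\<xi>. exp (- pairing ?g \<xi>) \<partial>\<nu>)
     = exp (- complex_of_real (\<rho> - critical_density TYPE('a) \<beta>) * inner_L2 w (inv_one_plus K w)) / fredholm_det K"
    using \<nu> g unfolding boson_point_field_def by blast
  also have "(\<integral>\<xi>. exp (- pairing ?g \<xi>) \<partial>\<nu>) = \<phi> s" by (simp add: \<phi>_def pairing_def)
  also have "- complex_of_real (\<rho> - critical_density TYPE('a) \<beta>) * inner_L2 w (inv_one_plus K w) = of_real (- ((\<rho> - \<rho>c) * A))"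
    by (simp add: A(1) \<rho>c_def algebra_simps)
  \<comment> \<open>Taking norms suffices because \<phi> is nonnegative and the numerator has a real
    exponent; the determinant is estimated only through its modulus.\<close>
  finally have "norm (complex_of_real (\<phi> s)) = norm (exp (complex_of_real (- ((\<rho> - \<rho>c) * A))) / fredholm_det K)"
    by (simp only:)
  hence \<phi>: "\<phi> s = exp (- ((\<rho> - \<rho>c) * A)) / norm (fredholm_det K)"
    using \<phi>_nonneg[of s] by (simp only: norm_divide norm_exp_eq_Re Re_complex_of_real norm_of_real abs_of_nonneg)
  have \<rho>': "0 \<le> \<rho> - \<rho>c" using \<rho> by (simp add: \<rho>c_def)
  have "(\<rho> - \<rho>c) * A + (T + 2 * T ^ 3) \<le> (\<rho> - \<rho>c) * ?\<tau> + (T + 2 * (\<rho>c * (s * I)) ^ 3)"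
    using \<rho>' A(3) T by (intro add_mono mult_left_mono power_mono) auto
  \<comment> \<open>The condensate density \<rho> - \<rho>c from the resolvent term and the density
    \<rho>c from the trace add up to \<rho>.\<close>
  also have "\<dots> = \<rho> * ?\<tau> + 2 * (\<rho>c * (s * I)) ^ 3" by (simp add: T_def algebra_simps)
  also have "\<dots> \<le> \<rho> * (s * I) + 2 * (\<rho>c * (s * I)) ^ 3"
    using \<rho>_pos \<tau>_le by simp
  also have "\<dots> = s * (\<rho> * I + s * (2 * (\<rho>c * I) ^ 3 * s))"
    by (simp add: power_mult_distrib algebra_simps power3_eq_cube)
  finally have "exp (- (s * (\<rho> * I + s * (2 * (\<rho>c * I) ^ 3 * s)))) \<le> exp (- ((\<rho> - \<rho>c) * A)) / exp (T + 2 * T ^ 3)"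
    by (simp add: exp_diff[symmetric])
  also have "\<dots> \<le> \<phi> s" unfolding \<phi> using D_le D_pos by (intro divide_left_mono mult_pos_pos) auto
  finally show "exp (- (s * (\<rho> * I + s * (2 * (\<rho>c * I) ^ 3 * s)))) \<le> \<phi> s" .
  have "\<phi> s \<le> exp (- ((\<rho> - \<rho>c) * A)) / exp (\<rho>c * t - d - 2 * d\<^sup>2)"
    unfolding \<phi> using D_ge D_pos by (intro divide_left_mono mult_pos_pos) auto
  also have "\<dots> = exp (- ((\<rho> - \<rho>c) * A) - (\<rho>c * t - d - 2 * d\<^sup>2))" by (simp only: exp_diff)
  also have "\<dots> \<le> exp (- (s * (\<rho> * I + s * rem s)))"
  proof -
    have "(1 - s * C) * t \<le> (1 - s * C) * ?\<tau>" using t_le sC by (intro mult_left_mono) auto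
    hence "(\<rho> - \<rho>c) * ((1 - s * C) * t) \<le> (\<rho> - \<rho>c) * A" using A(2) \<rho>' by (intro mult_left_mono) auto
    moreover have "s * (\<rho> * I + s * rem s) = (\<rho> - \<rho>c) * ((1 - s * C) * t) + \<rho>c * t - d - 2 * d\<^sup>2"
      by (simp add: rem_def t_def d_def field_simps power2_eq_square)
    ultimately show ?thesis by simp
  qed
  finally show "\<phi> s \<le> exp (- (s * (\<rho> * I + s * rem s)))" .
qed

lemma \<phi>_bounds:
  "\<forall>\<^sub>F s in at_right 0. exp (- (s * (\<rho> * I + s * (2 * (\<rho>c * I) ^ 3 * s)))) \<le> \<phi> s
     \<and> \<phi> s \<le> exp (- (s * (\<rho> * I + s * rem s)))"
proof -
  have small: "\<forall>\<^sub>F s in at_right 0. h s < b" if "isCont h 0" "h 0 < b" for h :: "real \<Rightarrow> real" and b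
    using isCont_tendsto_at_right[OF that(1)] that(2) by (rule order_tendstoD)
  have "\<forall>\<^sub>F s in at_right 0. s * C < 1 / 2" by (rule small) (auto intro: continuous_intros)
  moreover have "\<forall>\<^sub>F s in at_right 0. \<rho>c * (s * I) < 1 / 2" by (rule small) (auto intro: continuous_intros)
  moreover have "\<forall>\<^sub>F s in at_right 0. s * N < 1" by (rule small) (auto intro: continuous_intros)
  moreover have "\<forall>\<^sub>F s in at_right 0. s\<^sup>2 * err s < 1 / 2"
    by (rule small) (auto simp: err_def intro!: continuous_intros)
  ultimately show ?thesis
    using eventually_at_right_less[of 0]
    by eventually_elim (intro conjI \<phi>_bounds_at, auto)
qed

lemma rem_tendsto: "(rem \<longlongrightarrow> rem 0) (at_right 0)"
  by (rule isCont_tendsto_at_right) (auto simp: rem_def[abs_def] err_def intro!: continuous_intros)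

text \<open>Origin of the constant: the resolvent bound contributes 4 (\<rho> - \<rho>c) C I and the
  bound for Tr K^2 contributes 2 \<rho>c C I. The factor 4 appears because the second moment uses
  \<open>rem\<close> at 2 s.\<close>

lemma rem_0: "- 4 * rem 0 = 2 * \<rho> * J + (4 * \<rho> - 2 * \<rho>c) * C * I"
  by (simp add: rem_def err_def algebra_simps)

lemma prob: "prob_space \<nu>" and sets_\<nu>: "sets \<nu> = sets point_measure_borel"
  using \<nu> by (auto simp: boson_point_field_def)

lemma pairing_\<nu>_measurable [measurable]: "pairing f \<in> borel_measurable \<nu>"
  using pairing_measurable[OF f] by (simp add: measurable_cong_sets[OF sets_\<nu> refl])

lemma exp_integrable: "0 \<le> s \<Longrightarrow> integrable \<nu> (\<lambda>\<xi>. exp (- (s * pairing f \<xi>)))"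
proof -
  assume s: "0 \<le> s"
  interpret prob_space \<nu> by (rule prob)
  show ?thesis
    by (rule integrable_const_bound[where B=1]) (use s pairing_nonneg[OF f] in auto)
qed

text \<open>Since $\frac{1-e^{-sY}}{s} \to Y$ as $s \downarrow 0$, Fatou's lemma turns the second order expansion
  of the Laplace functional into a bound for the second moment.\<close>

lemma second_moment:
  "integrable \<nu> (\<lambda>\<xi>. (pairing f \<xi>)\<^sup>2)"
  "(\<integral>\<xi>. (pairing f \<xi>)\<^sup>2 \<partial>\<nu>) \<le> (\<rho> * I)\<^sup>2 + 2 * \<rho> * J + (4 * \<rho> - 2 * \<rho>c) * C * I"
proof -
  interpret prob_space \<nu> by (rule prob)
  define b where "b = (\<rho> * I)\<^sup>2 - 4 * rem 0"
  define X where "X s \<xi> = ((1 - exp (- (s * pairing f \<xi>))) / s)\<^sup>2" for s \<xi>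
  define s where "s n = inverse (real (Suc n))" for n
  have s0: "0 < s n" for n by (simp add: s_def)
  have slim: "s \<longlonglongrightarrow> 0" unfolding s_def by (rule LIMSEQ_inverse_real_of_nat)
  have sr: "filterlim s (at_right 0) sequentially"
    using slim s0 by (intro tendsto_imp_filterlim_at_right) auto
  have s2r: "filterlim (\<lambda>n. 2 * s n) (at_right 0) sequentially"
    using tendsto_mult[OF tendsto_const[of 2] slim] s0 by (intro tendsto_imp_filterlim_at_right) auto
  have X0: "0 \<le> X r \<xi>" for r \<xi> by (simp add: X_def)
  have X_int: "integrable \<nu> (X r)" and X_eq: "(\<integral>\<xi>. X r \<xi> \<partial>\<nu>) = (1 - 2 * \<phi> r + \<phi> (2 * r)) / r\<^sup>2"
    if r: "0 < r" for r
  proof -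
    have X: "X r = (\<lambda>\<xi>. (1 - 2 * exp (- (r * pairing f \<xi>)) + exp (- (2 * r * pairing f \<xi>))) / r\<^sup>2)"
      by (simp add: X_def fun_eq_iff power_divide power2_diff exp_double[symmetric])
    note ints = exp_integrable[of r] exp_integrable[of "2 * r"]
    show "integrable \<nu> (X r)" unfolding X using r ints by simp
    show "(\<integral>\<xi>. X r \<xi> \<partial>\<nu>) = (1 - 2 * \<phi> r + \<phi> (2 * r)) / r\<^sup>2"
      unfolding X \<phi>_def using r ints by (simp add: prob_space)
  qed
  \<comment> \<open>In 1 - 2 \<phi>(r) + \<phi>(2 r) the lower bound is used for \<phi>(r) and the
    upper one for \<phi>(2 r). \<open>E1\<close> and \<open>E2\<close> are their second-order
    quotients; in 4 \<open>E2 (2 * r)\<close> - 2 \<open>E1 r\<close> the constant and linear terms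
    cancel.\<close>
  define E1 where "E1 r = (exp (- (r * (\<rho> * I + r * (2 * (\<rho>c * I) ^ 3 * r)))) - 1 + \<rho> * I * r) / r\<^sup>2" for r
  define E2 where "E2 r = (exp (- (r * (\<rho> * I + r * rem r))) - 1 + \<rho> * I * r) / r\<^sup>2" for r
  have "((\<lambda>r. 2 * (\<rho>c * I) ^ 3 * r) \<longlongrightarrow> 2 * (\<rho>c * I) ^ 3 * 0) (at_right 0)"
    by (rule isCont_tendsto_at_right) (auto intro: continuous_intros)
  from exp_second_order[OF this] have E1: "(E1 \<longlongrightarrow> (\<rho> * I)\<^sup>2 / 2) (at_right 0)" unfolding E1_def by simp
  have E2: "(E2 \<longlongrightarrow> (\<rho> * I)\<^sup>2 / 2 - rem 0) (at_right 0)" unfolding E2_def by (rule exp_second_order[OF rem_tendsto])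
  have lim: "(\<lambda>n. 4 * E2 (2 * s n) - 2 * E1 (s n)) \<longlonglongrightarrow> 4 * ((\<rho> * I)\<^sup>2 / 2 - rem 0) - 2 * ((\<rho> * I)\<^sup>2 / 2)"
    by (intro tendsto_diff tendsto_mult tendsto_const filterlim_compose[OF E2 s2r] filterlim_compose[OF E1 sr])
  have ub: "\<forall>\<^sub>F n in sequentially. (\<integral>\<xi>. X (s n) \<xi> \<partial>\<nu>) \<le> 4 * E2 (2 * s n) - 2 * E1 (s n)"
    using eventually_compose_filterlim[OF \<phi>_bounds sr] eventually_compose_filterlim[OF \<phi>_bounds s2r]
  proof eventually_elim
    case (elim n)
    have sn: "0 < (s n)\<^sup>2" using s0[of n] by simp
    have "1 - 2 * \<phi> (s n) + \<phi> (2 * s n)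
        \<le> 1 - 2 * exp (- (s n * (\<rho> * I + s n * (2 * (\<rho>c * I) ^ 3 * s n)))) + exp (- (2 * s n * (\<rho> * I + 2 * s n * rem (2 * s n))))"
      using elim by simp
    also have "\<dots> = (4 * E2 (2 * s n) - 2 * E1 (s n)) * (s n)\<^sup>2"
      using sn by (simp add: E1_def E2_def power_mult_distrib field_simps)
    finally show ?case unfolding X_eq[OF s0] using sn by (simp add: pos_divide_le_eq)
  qed
  have "(\<integral>\<^sup>+\<xi>. ennreal ((pairing f \<xi>)\<^sup>2) \<partial>\<nu>) = (\<integral>\<^sup>+\<xi>. liminf (\<lambda>n. ennreal (X (s n) \<xi>)) \<partial>\<nu>)"
  proof (rule nn_integral_cong)
    fix \<xi>
    have "((\<lambda>r. (1 - exp (- (r * pairing f \<xi>))) / r) \<longlongrightarrow> pairing f \<xi>) (at_right 0)"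
      by (rule exp_difference_quotient)
    from filterlim_compose[OF this sr]
    have "(\<lambda>n. ennreal (X (s n) \<xi>)) \<longlonglongrightarrow> ennreal ((pairing f \<xi>)\<^sup>2)"
      unfolding X_def by (intro tendsto_ennrealI tendsto_power)
    thus "ennreal ((pairing f \<xi>)\<^sup>2) = liminf (\<lambda>n. ennreal (X (s n) \<xi>))"
      by (intro lim_imp_Liminf[symmetric]) simp_all
  qed
  also have "\<dots> \<le> liminf (\<lambda>n. \<integral>\<^sup>+\<xi>. ennreal (X (s n) \<xi>) \<partial>\<nu>)"
    by (rule nn_integral_liminf) (unfold X_def, measurable)
  also have "\<dots> \<le> liminf (\<lambda>n. ennreal (4 * E2 (2 * s n) - 2 * E1 (s n)))"
  proof (rule Liminf_mono)
    show "\<forall>\<^sub>F n in sequentially. (\<integral>\<^sup>+\<xi>. ennreal (X (s n) \<xi>) \<partial>\<nu>) \<le> ennreal (4 * E2 (2 * s n) - 2 * E1 (s n))"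
      using ub
    proof eventually_elim
      case (elim n)
      show ?case using elim X_int[OF s0[of n]] by (subst nn_integral_eq_integral) (auto simp: X0 intro!: ennreal_leI)
    qed
  qed
  also have "\<dots> = ennreal (4 * ((\<rho> * I)\<^sup>2 / 2 - rem 0) - 2 * ((\<rho> * I)\<^sup>2 / 2))"
    by (intro lim_imp_Liminf tendsto_ennrealI lim) simp
  also have "4 * ((\<rho> * I)\<^sup>2 / 2 - rem 0) - 2 * ((\<rho> * I)\<^sup>2 / 2) = b" by (simp add: b_def)
  finally have fin: "(\<integral>\<^sup>+\<xi>. ennreal ((pairing f \<xi>)\<^sup>2) \<partial>\<nu>) \<le> ennreal b" .
  show int: "integrable \<nu> (\<lambda>\<xi>. (pairing f \<xi>)\<^sup>2)"
    by (rule integrableI_bounded) (use fin in \<open>auto intro: le_less_trans\<close>)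
  have b: "b = (\<rho> * I)\<^sup>2 + 2 * \<rho> * J + (4 * \<rho> - 2 * \<rho>c) * C * I" using rem_0 by (simp add: b_def)
  have "0 \<le> (4 * \<rho> - 2 * \<rho>c) * C * I"
    using \<rho> \<rho>c_nonneg C_nonneg I_nonneg by (intro mult_nonneg_nonneg) (auto simp: \<rho>c_def)
  hence "0 \<le> b" unfolding b using \<rho>_pos J_nonneg by simp
  thus "(\<integral>\<xi>. (pairing f \<xi>)\<^sup>2 \<partial>\<nu>) \<le> (\<rho> * I)\<^sup>2 + 2 * \<rho> * J + (4 * \<rho> - 2 * \<rho>c) * C * I"
    using fin int unfolding b[symmetric] by (subst (asm) nn_integral_eq_integral) auto
qed

text \<open>Since 1 - exp(-s Y) \<le> s Y, the quotient (1 - \<phi>(s)) / s is at most E Y for every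
  s > 0; the upper bound for \<phi> and s tending to 0 then give the claim. Integrability is
  inherited from the second moment.\<close>

lemma first_moment:
  "integrable \<nu> (pairing f)" "\<rho> * I \<le> (\<integral>\<xi>. pairing f \<xi> \<partial>\<nu>)"
proof -
  interpret prob_space \<nu> by (rule prob)
  show int: "integrable \<nu> (pairing f)"
    by (rule square_integrable_imp_integrable[OF _ second_moment(1)]) measurable
  have "((\<lambda>s. (exp (- (s * (\<rho> * I + s * rem s))) - 1 + \<rho> * I * s) / s\<^sup>2 * s) \<longlongrightarrow> ((\<rho> * I)\<^sup>2 / 2 - rem 0) * 0) (at_right 0)"
    by (intro tendsto_mult exp_second_order[OF rem_tendsto] tendsto_ident_at)
  hence lim: "((\<lambda>s. \<rho> * I - (exp (- (s * (\<rho> * I + s * rem s))) - 1 + \<rho> * I * s) / s\<^sup>2 * s) \<longlongrightarrow> \<rho> * I - ((\<rho> * I)\<^sup>2 / 2 - rem 0) * 0) (at_right 0)"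
    by (intro tendsto_diff tendsto_const)
  have "\<rho> * I - ((\<rho> * I)\<^sup>2 / 2 - rem 0) * 0 \<le> (\<integral>\<xi>. pairing f \<xi> \<partial>\<nu>)"
  proof (rule tendsto_upperbound[OF lim])
    show "\<forall>\<^sub>F s in at_right 0. \<rho> * I - (exp (- (s * (\<rho> * I + s * rem s))) - 1 + \<rho> * I * s) / s\<^sup>2 * s \<le> (\<integral>\<xi>. pairing f \<xi> \<partial>\<nu>)"
      using \<phi>_bounds eventually_at_right_less[of 0]
    proof eventually_elim
      case (elim s)
      have "1 - \<phi> s = (\<integral>\<xi>. 1 - exp (- (s * pairing f \<xi>)) \<partial>\<nu>)"
        using elim exp_integrable[of s] by (simp add: \<phi>_def prob_space)
      also have "\<dots> \<le> (\<integral>\<xi>. s * pairing f \<xi> \<partial>\<nu>)"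
      proof (rule integral_mono)
        show "1 - exp (- (s * pairing f \<xi>)) \<le> s * pairing f \<xi>" for \<xi>
          using exp_ge_add_one_self[of "- (s * pairing f \<xi>)"] by simp
      qed (use elim exp_integrable[of s] int in auto)
      finally have "1 - exp (- (s * (\<rho> * I + s * rem s))) \<le> s * (\<integral>\<xi>. pairing f \<xi> \<partial>\<nu>)" using elim by simp
      moreover have "\<rho> * I - (exp (- (s * (\<rho> * I + s * rem s))) - 1 + \<rho> * I * s) / s\<^sup>2 * s
         = (1 - exp (- (s * (\<rho> * I + s * rem s)))) / s"
        using elim by (simp add: field_simps power2_eq_square)
      ultimately show ?case using elim by (simp add: pos_divide_le_eq mult.commute)
    qed
  qed simp
  thus "\<rho> * I \<le> (\<integral>\<xi>. pairing f \<xi> \<partial>\<nu>)" by simp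
qed

end

text \<open>Dilation multiplies \<open>I\<close> and \<open>J\<close> by \<kappa>^d and leaves
  \<open>N\<close> and the tail unchanged. After division by \<kappa>^(2d) the terms with
  \<open>J\<close> and \<open>M * N\<close> keep a factor \<kappa>^(-d). In the tail term both
  powers are used up, so it stays and has to be made small through \<open>M\<close>.\<close>

lemma boson_field_scaled:
  fixes f :: "'a::euclidean_space \<Rightarrow> real"
  assumes \<beta>: "0 < \<beta>" and dim: "2 < DIM('a)" and \<rho>: "critical_density TYPE('a) \<beta> < \<rho>"
    and \<nu>: "boson_point_field \<beta> \<rho> \<nu>" and f: "test_function f"
    and N: "\<And>x. f x \<le> N" and M: "0 \<le> M" and \<kappa>: "0 < \<kappa>"
  defines "X \<equiv> \<lambda>\<xi>. (1 / \<kappa> ^ DIM('a)) * pairing (\<lambda>x. f (x /\<^sub>R \<kappa>)) \<xi>"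
    and "a \<equiv> 4 * \<rho> - 2 * critical_density TYPE('a) \<beta>"
  shows "square_integrable \<nu> X"
    and "(\<integral>\<xi>. (X \<xi> - \<rho> * (\<integral>x. f x \<partial>lborel))\<^sup>2 \<partial>\<nu>)
      \<le> (2 * \<rho> * (\<integral>x. (f x)\<^sup>2 \<partial>lborel) + a * (M * N) * (\<integral>x. f x \<partial>lborel)) / \<kappa> ^ DIM('a)
        + a * (\<integral>x. f x \<partial>lborel)\<^sup>2 * ((\<integral>p. indicator {p. M < bose \<beta> p} p * bose \<beta> (p :: 'a) \<partial>lborel) / (2 * pi) ^ DIM('a))" (is ?bound)
proof -
  let ?g = "\<lambda>x. f (x /\<^sub>R \<kappa>)"
  interpret B: boson_field \<beta> \<rho> \<nu> ?g M N
    by unfold_locales (use assms test_function_dilate in auto)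
  interpret prob_space \<nu> by (rule B.prob)
  define k where "k = \<kappa> ^ DIM('a)"
  have k: "0 < k" using \<kappa> by (simp add: k_def)
  define I where "I = (\<integral>x. f x \<partial>lborel)"
  define J where "J = (\<integral>x. (f x)\<^sup>2 \<partial>lborel)"
  note [measurable] = test_functionD(1)[OF f]
  have BI: "B.I = k * I"
    unfolding B.I_def I_def k_def using \<kappa> by (subst integral_lborel_affine[of _ \<kappa> 0]) auto
  have BJ: "B.J = k * J"
    unfolding B.J_def J_def k_def using \<kappa> by (subst integral_lborel_affine[of _ \<kappa> 0]) auto
  have X: "X = (\<lambda>\<xi>. pairing ?g \<xi> / k)" by (simp add: X_def k_def)
  show "square_integrable \<nu> X"
    unfolding square_integrable_def X using B.second_moment(1) by (simp add: power_divide)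
  let ?E1 = "\<integral>\<xi>. pairing ?g \<xi> \<partial>\<nu>" and ?E2 = "\<integral>\<xi>. (pairing ?g \<xi>)\<^sup>2 \<partial>\<nu>"
  have I0: "0 \<le> I" using test_functionD(2)[OF f] by (simp add: I_def)
  have "(\<integral>\<xi>. (X \<xi> - \<rho> * I)\<^sup>2 \<partial>\<nu>)
      = (\<integral>\<xi>. (pairing ?g \<xi>)\<^sup>2 / k\<^sup>2 - 2 * \<rho> * I / k * pairing ?g \<xi> + (\<rho> * I)\<^sup>2 \<partial>\<nu>)"
    unfolding X by (simp add: power2_diff power_divide mult_ac diff_add_eq)
  also have "\<dots> = ?E2 / k\<^sup>2 - 2 * \<rho> * I / k * ?E1 + (\<rho> * I)\<^sup>2"
    using B.second_moment(1) B.first_moment(1) by (simp add: prob_space)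
  also have "\<dots> \<le> ((\<rho> * (k * I))\<^sup>2 + 2 * \<rho> * (k * J) + a * (M * N + k * I * B.tail) * (k * I)) / k\<^sup>2
      - 2 * \<rho> * I / k * (\<rho> * (k * I)) + (\<rho> * I)\<^sup>2"
  proof (intro add_right_mono diff_mono divide_right_mono mult_left_mono)
    show "?E2 \<le> (\<rho> * (k * I))\<^sup>2 + 2 * \<rho> * (k * J) + a * (M * N + k * I * B.tail) * (k * I)"
      using B.second_moment(2) by (simp add: BI BJ B.C_def B.\<rho>c_def a_def)
    show "\<rho> * (k * I) \<le> ?E1" using B.first_moment(2) by (simp add: BI)
    show "0 \<le> 2 * \<rho> * I / k" using B.\<rho>_pos I0 k by simp
  qed simp
  also have "\<dots> = (2 * \<rho> * J + a * (M * N) * I) / k + a * I\<^sup>2 * B.tail"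
    using k by (simp add: field_simps power2_eq_square)
  finally show ?bound
    unfolding I_def J_def k_def B.tail_def .
qed

lemma bose_tail_tendsto_0:
  assumes \<beta>: "0 < \<beta>" and dim: "2 < DIM('a::euclidean_space)"
  shows "(\<lambda>n. \<integral>p. indicator {p. real n < bose \<beta> p} p * bose \<beta> (p :: 'a) \<partial>lborel) \<longlonglongrightarrow> 0"
proof -
  have "(\<lambda>n. \<integral>p. indicator {p. real n < bose \<beta> p} p * bose \<beta> (p :: 'a) \<partial>lborel) \<longlonglongrightarrow> (\<integral>p. 0 \<partial>(lborel :: 'a measure))"
  proof (rule integral_dominated_convergence[where w="bose \<beta>"])
    show "AE p in lborel. (\<lambda>n. indicator {p. real n < bose \<beta> p} p * bose \<beta> (p :: 'a)) \<longlonglongrightarrow> 0"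
    proof (rule AE_I2, rule tendsto_eventually)
      fix p :: 'a
      obtain m where m: "bose \<beta> p \<le> real m" using real_arch_simple by blast
      show "\<forall>\<^sub>F n in sequentially. indicator {p. real n < bose \<beta> p} p * bose \<beta> p = 0"
        using eventually_ge_at_top[of m] by eventually_elim (use m in \<open>auto simp: indicator_def\<close>)
    qed
    show "AE p in lborel. norm (indicator {p. real n < bose \<beta> p} p * bose \<beta> (p :: 'a)) \<le> bose \<beta> p" for n
      using bose_nonneg[OF \<beta>] by (intro AE_I2) (auto simp: indicator_def)
  qed (use integrable_bose[OF \<beta> dim] in \<open>auto\<close>)
  thus ?thesis by simp
qed

theorem theorem1p1:
  fixes \<beta> \<rho> :: real
    and \<nu> :: "(real ^ 'd) measure measure"
    and f :: "real ^ 'd \<Rightarrow> real"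
  assumes "CARD('d) > 2"
    and "\<beta> > 0"
    and "\<rho> > critical_density TYPE(real ^ 'd) \<beta>"
    and "boson_point_field \<beta> \<rho> \<nu>"
    and "test_function f"
  shows "(\<forall>\<kappa>>0. square_integrable \<nu>
            (\<lambda>\<xi>. (1 / \<kappa> ^ CARD('d)) * pairing (\<lambda>x. f (x /\<^sub>R \<kappa>)) \<xi>)) \<and>
         L2_tendsto \<nu>
           (\<lambda>\<kappa> \<xi>. (1 / \<kappa> ^ CARD('d)) * pairing (\<lambda>x. f (x /\<^sub>R \<kappa>)) \<xi>)
           (\<lambda>\<xi>. \<rho> * (\<integral>x. f x \<partial>lborel)) (at_top :: real filter)"
proof -
  let ?d = "CARD('d)"
  have dim: "2 < DIM(real ^ 'd)" using assms(1) by simp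
  obtain N where N: "0 \<le> N" "\<And>x. f x \<le> N" using test_functionD(4)[OF assms(5)] by blast
  note scaled = boson_field_scaled[OF assms(2) dim assms(3,4,5) N(2)]
  define X where "X \<kappa> \<xi> = (1 / \<kappa> ^ ?d) * pairing (\<lambda>x. f (x /\<^sub>R \<kappa>)) \<xi>" for \<kappa> \<xi>
  define a where "a = 4 * \<rho> - 2 * critical_density TYPE(real ^ 'd) \<beta>"
  define I where "I = (\<integral>x. f x \<partial>lborel)"
  define J where "J = (\<integral>x. (f x)\<^sup>2 \<partial>lborel)"
  define t where "t n = (\<integral>p. indicator {p. real n < bose \<beta> p} p * bose \<beta> (p :: real ^ 'd) \<partial>lborel) / (2 * pi) ^ ?d" for n
  define V where "V \<kappa> = (\<integral>\<xi>. (X \<kappa> \<xi> - \<rho> * I)\<^sup>2 \<partial>\<nu>)" for \<kappa>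
  have sq: "square_integrable \<nu> (X \<kappa>)" if "0 < \<kappa>" for \<kappa>
    unfolding X_def using scaled(1)[of 0 \<kappa>] that by simp
  have V_le: "V \<kappa> \<le> (2 * \<rho> * J + a * (real n * N) * I) / \<kappa> ^ ?d + a * I\<^sup>2 * t n" if "0 < \<kappa>" for \<kappa> n
    unfolding V_def X_def I_def J_def a_def t_def using scaled(2)[of "real n" \<kappa>] that by simp
  have "(V \<longlongrightarrow> 0) at_top"
  proof (rule order_tendstoI)
    fix y :: real assume "y < 0"
    moreover have "0 \<le> V \<kappa>" for \<kappa> by (simp add: V_def)
    ultimately show "\<forall>\<^sub>F \<kappa> in at_top. y < V \<kappa>" by (intro always_eventually allI) (rule less_le_trans)
  next
    fix y :: real assume y: "0 < y"
    have "(\<lambda>n. a * I\<^sup>2 * t n) \<longlonglongrightarrow> a * I\<^sup>2 * (0 / (2 * pi) ^ ?d)"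
      unfolding t_def using bose_tail_tendsto_0[OF assms(2) dim] by (intro tendsto_intros) auto
    hence "\<forall>\<^sub>F n in sequentially. a * I\<^sup>2 * t n < y / 2" using y by (intro order_tendstoD) auto
    \<comment> \<open>The cut-off level is fixed first, from the tail alone; only then is \<kappa>
      sent to infinity with this level held constant.\<close>
    then obtain n where n: "a * I\<^sup>2 * t n < y / 2" by (auto simp: eventually_sequentially)
    have "filterlim (\<lambda>\<kappa>::real. \<kappa> ^ ?d) at_top at_top" by (intro filterlim_pow_at_top filterlim_ident) simp
    hence "((\<lambda>\<kappa>. (2 * \<rho> * J + a * (real n * N) * I) / \<kappa> ^ ?d) \<longlongrightarrow> 0) at_top"
      by (rule tendsto_divide_0[OF tendsto_const filterlim_at_top_imp_at_infinity])
    hence "\<forall>\<^sub>F \<kappa> in at_top. (2 * \<rho> * J + a * (real n * N) * I) / \<kappa> ^ ?d < y / 2"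
      using y by (intro order_tendstoD) auto
    thus "\<forall>\<^sub>F \<kappa> in at_top. V \<kappa> < y"
      using eventually_gt_at_top[of 0]
    proof eventually_elim
      case (elim \<kappa>)
      show ?case using V_le[OF elim(2), of n] elim(1) n by linarith
    qed
  qed
  from tendsto_real_sqrt[OF this] have lim: "((\<lambda>\<kappa>. sqrt (\<integral>\<xi>. (norm (X \<kappa> \<xi> - \<rho> * I))\<^sup>2 \<partial>\<nu>)) \<longlongrightarrow> 0) at_top"
    by (simp add: V_def)
  have "prob_space \<nu>" using assms(4) by (simp add: boson_point_field_def)
  then interpret prob_space \<nu> .
  have const: "square_integrable \<nu> (\<lambda>\<xi>. \<rho> * I)" by (simp add: square_integrable_def)
  have "\<forall>\<^sub>F \<kappa> in at_top. square_integrable \<nu> (X \<kappa>)"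
    using eventually_gt_at_top[of 0] by eventually_elim (rule sq)
  with lim const sq show ?thesis
    unfolding L2_tendsto_def X_def I_def by blast
qed

end
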